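(* Let $d=1$ and consider a one-dimensional random walk with internal states satisfying the basic assumptions (i)–(iv). Then for an arbitrary distribution of $\varepsilon_0$, $$E_1(n)\sim\sqrt{\frac{8|\sigma|}{\pi}}\;n^{1/2}\qquad(n\to\infty),$$ where $|\sigma|$ is the determinant of the $1\times1$ covariance matrix $\sigma$ (i.e. the variance $\sigma_{1,1}$), and $a_n\sim b_n$ means $a_n/b_n\to1$.
   Context: Random walk with internal states (RWwIS). $E=\{1,\dots,s\}$ is a finite set, $d\ge1$ (here $d=1$), and $p_{y,j,k}\ge 0$ ($y\in\mathbb{Z}^d$, $j,k\in E$) satisfy $\sum_{y,k}p_{y,j,k}=1$ for each $j$. The RWwIS is the Markov chain $\xi_n=(\eta_n,\varepsilon_n)$ on $\mathbb{Z}^d\times E$ with $P(\xi_{n+1}=(x',k)\mid \xi_n=(x,j))=p_{x'-x,j,k}$; we start from $\eta_0=0$. Put $A_y=(p_{y,j,k})_{j,k}$, $Q=\sum_y A_y$, $M_l=\sum_y y_lA_y$, $\Sigma_{l,m}=\sum_y y_ly_mA_y$, $\underline{1}=(1,\dots,1)^T\in\mathbb{R}^s$. Basic assumptions: (i) the Markov chain $(\varepsilon_n)$ on $E$, whose transition matrix is $Q$, is irreducible and aperiodic; $\mu$ is its unique stationary distribution. (ii) Trivial arithmetic: for $j\in E$ the subgroup of $\mathbb{Z}^d$ generated by all differences $y-y'$ such that for some $n\geq 1$ both $P(\xi_n=(y,j)\mid\xi_0=(0,j))>0$ and $P(\xi_n=(y',j)\mid\xi_0=(0,j))>0$ is $\mathbb{Z}^d$.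 (iii) Zero mean: $\langle\mu,M_l\underline{1}\rangle=0$ for all $l$. (iv) The second moments $\sum_y\|y\|^2A_y$ converge and the covariance matrix $\sigma=(\sigma_{l,m})_{1\le l,m\le d}$, $\sigma_{l,m}=\langle\mu,\Sigma_{l,m}\underline{1}\rangle-\langle\mu,M_l(Q-1)^{-1}M_m\underline{1}\rangle-\langle\mu,M_m(Q-1)^{-1}M_l\underline{1}\rangle$, is nonsingular (positive definite); here $(Q-1)^{-1}M_m\underline{1}$ is the unique vector $v$ with $\langle\mu,v\rangle=0$ and $Qv-v=M_m\underline{1}$. $L_d(n)=\#\{\eta_0,\dots,\eta_n\}$ is the number of distinct sites visited up to $n$ steps, and $E_d(n)$ is its expectation. *)

theory Defs
  imports "HOL-Probability.Probability" "HOL-Computational_Algebra.Group_Closure"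
    "HOL-Library.Landau_Symbols"
begin

section \<open>Discrete Markov chains\<close>

text \<open>A kernel is given by its one-step transition probabilities \<open>K x y\<close>.\<close>

definition markov_chain ::
    "'a measure \<Rightarrow> ('s \<Rightarrow> 's \<Rightarrow> real) \<Rightarrow> (nat \<Rightarrow> 'a \<Rightarrow> 's) \<Rightarrow> bool" where
  "markov_chain M K X \<longleftrightarrow>
     prob_space M \<and>
     (\<forall>n. X n \<in> M \<rightarrow>\<^sub>M count_space UNIV) \<and>
     (\<forall>n z w. \<P>(\<omega> in M. \<forall>i\<le>n. X i \<omega> = z i) > 0 \<longrightarrow>
        \<P>(\<omega> in M. X (Suc n) \<omega> = w \<bar> \<forall>i\<le>n. X i \<omega> = z i) = K (z n) w)"

primrec transition_prob :: "('s \<Rightarrow> 's \<Rightarrow> real) \<Rightarrow> nat \<Rightarrow> 's \<Rightarrow> 's \<Rightarrow> real" where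
  "transition_prob K 0 x y = of_bool (x = y)"
| "transition_prob K (Suc n) x y = (\<Sum>\<^sub>\<infinity>u. K x u * transition_prob K n u y)"

definition irreducible_kernel :: "('s \<Rightarrow> 's \<Rightarrow> real) \<Rightarrow> bool" where
  "irreducible_kernel K \<longleftrightarrow> (\<forall>x y. \<exists>n. transition_prob K n x y > 0)"

definition aperiodic_kernel :: "('s \<Rightarrow> 's \<Rightarrow> real) \<Rightarrow> bool" where
  "aperiodic_kernel K \<longleftrightarrow> (\<forall>x. Gcd {n. n \<ge> 1 \<and> transition_prob K n x x > 0} = 1)"

definition stationary_distribution :: "real^'e^'e \<Rightarrow> real^'e \<Rightarrow> bool" where
  "stationary_distribution P \<mu> \<longleftrightarrow>
     (\<forall>j. \<mu> $ j \<ge> 0) \<and> (\<Sum>j\<in>UNIV. \<mu> $ j) = 1 \<and> \<mu> v* P = \<mu>"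


section \<open>One-dimensional random walks with internal states\<close>

text \<open>
  The finite set of internal states is the universe of a finite type, and \<open>p y j k\<close> is the
  probability of jumping by \<open>y\<close> while the internal state changes from \<open>j\<close> to \<open>k\<close>.
\<close>

definition rwis_kernel ::
    "(int \<Rightarrow> 'e \<Rightarrow> 'e \<Rightarrow> real) \<Rightarrow> int \<times> 'e \<Rightarrow> int \<times> 'e \<Rightarrow> real" where
  "rwis_kernel p = (\<lambda>(x, j) (x', k). p (x' - x) j k)"

definition jump_matrix :: "(int \<Rightarrow> 'e::finite \<Rightarrow> 'e \<Rightarrow> real) \<Rightarrow> int \<Rightarrow> real^'e^'e" where
  "jump_matrix p y = (\<chi> j k. p y j k)"

definition Q_matrix :: "(int \<Rightarrow> 'e::finite \<Rightarrow> 'e \<Rightarrow> real) \<Rightarrow> real^'e^'e" where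
  "Q_matrix p = (\<Sum>\<^sub>\<infinity>y. jump_matrix p y)"

definition M_matrix :: "(int \<Rightarrow> 'e::finite \<Rightarrow> 'e \<Rightarrow> real) \<Rightarrow> real^'e^'e" where
  "M_matrix p = (\<Sum>\<^sub>\<infinity>y. of_int y *\<^sub>R jump_matrix p y)"

definition Sigma_matrix :: "(int \<Rightarrow> 'e::finite \<Rightarrow> 'e \<Rightarrow> real) \<Rightarrow> real^'e^'e" where
  "Sigma_matrix p = (\<Sum>\<^sub>\<infinity>y. (of_int y)\<^sup>2 *\<^sub>R jump_matrix p y)"

definition trivial_arithmetic :: "(int \<Rightarrow> 'e \<Rightarrow> 'e \<Rightarrow> real) \<Rightarrow> bool" where
  "trivial_arithmetic p \<longleftrightarrow>
     (\<forall>j. group_closure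
        {y - y' | y y'. \<exists>n\<ge>1. transition_prob (rwis_kernel p) n (0, j) (y, j) > 0 \<and>
                              transition_prob (rwis_kernel p) n (0, j) (y', j) > 0} = UNIV)"

text \<open>
  \<open>Q - 1\<close> is singular; its inverse is meant on the vectors orthogonal to \<open>\<mu>\<close>.  The description
  is unique if \<open>Q\<close> is irreducible with stationary distribution \<open>\<mu>\<close> and \<open>\<mu> \<bullet> w = 0\<close>.
\<close>

definition Q_minus_1_inverse ::
    "(int \<Rightarrow> 'e::finite \<Rightarrow> 'e \<Rightarrow> real) \<Rightarrow> real^'e \<Rightarrow> real^'e \<Rightarrow> real^'e" where
  "Q_minus_1_inverse p \<mu> w = (THE v. \<mu> \<bullet> v = 0 \<and> Q_matrix p *v v - v = w)"

text \<open>
  The single entry, and hence the determinant, of the \<open>1 \<times> 1\<close> covariance matrix; the two mixed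
  terms of the general formula coincide.  As a vector, \<open>1\<close> has all components equal to one.
\<close>

definition rwis_variance ::
    "(int \<Rightarrow> 'e::finite \<Rightarrow> 'e \<Rightarrow> real) \<Rightarrow> real^'e \<Rightarrow> real" where
  "rwis_variance p \<mu> =
     \<mu> \<bullet> (Sigma_matrix p *v 1)
     - \<mu> \<bullet> (M_matrix p *v Q_minus_1_inverse p \<mu> (M_matrix p *v 1))
     - \<mu> \<bullet> (M_matrix p *v Q_minus_1_inverse p \<mu> (M_matrix p *v 1))"

definition visited_sites :: "(nat \<Rightarrow> 'a \<Rightarrow> int) \<Rightarrow> nat \<Rightarrow> 'a \<Rightarrow> nat" where
  "visited_sites \<eta> n \<omega> = card ((\<lambda>i. \<eta> i \<omega>) ` {0..n})"

end

theory Submission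
  imports Defs "HOL-Real_Asymp.Real_Asymp"
begin

text \<open>
  Let \<open>q\<^sub>n(j)\<close> be the probability that the walk started in \<open>(0, j)\<close> does not return to the site
  \<open>0\<close> during the steps \<open>1, \<dots>, n\<close>, and let \<open>r\<^sub>n(j)\<close> be the mean number of sites visited.  The starting
  site contributes to the range exactly when the remaining path avoids it, so translation invariance
  gives \<open>r\<^sub>n\<^sub>+\<^sub>1 = q\<^sub>n\<^sub>+\<^sub>1 + Q r\<^sub>n\<close> (\<open>mean_range_Suc\<close>).  Splitting at the last visit to \<open>0\<close> expresses the
  certain event that the starting site has been visited as a convolution of \<open>P(\<xi>\<^sub>k = (0, i))\<close> with
  \<open>q\<^sub>n\<^sub>-\<^sub>k(i)\<close> (\<open>last_visit_decomposition\<close>).  For the generating functions at \<open>0 < z < 1\<close> these are two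
  linear relations,
  \<open>r(z) = q(z) + z Q r(z)\<close> and \<open>\<Sum>i. U\<^sub>j\<^sub>i(z) q\<^sub>i(z) = 1 / (1 - z)\<close>, where \<open>U\<^sub>j\<^sub>i(z)\<close> is the
  Green function of the walk at the origin.

  Everything then follows from the singularity of \<open>U\<close> at \<open>z = 1\<close>.  By Fourier inversion \<open>2 \<pi> U\<^sub>j\<^sub>i(z)\<close>
  is the integral over \<open>[-\<pi>, \<pi>]\<close> of an entry of the resolvent \<open>(1 - z \<alpha>(t))\<^sup>-\<^sup>1\<close>, where
  \<open>\<alpha>(t) = \<Sum>y. e\<^sup>i\<^sup>t\<^sup>y A\<^sub>y\<close>.  Two facts
  determine the integral up to a relative error \<open>o(1)\<close>.  Away from \<open>t = 0\<close> the resolvent stays bounded: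
  an eigenvector of \<open>\<alpha>(t)\<close> for the eigenvalue \<open>1\<close> forces \<open>e\<^sup>i\<^sup>t\<^sup>y = 1\<close> along all loops at some state, and
  these generate the integers (\<open>no_unimodular_eigenvalue\<close>).  Near \<open>(t, z) = (0, 1)\<close> the entry is
  \<open>\<mu>\<^sub>i / (1 - z + \<sigma> t\<^sup>2 / 2)\<close> up to a relative error \<open>o(1)\<close> (\<open>resolvent_near_origin\<close>).  No spectral
  perturbation theory is needed for this: testing the resolvent equation with the approximate left
  eigenvector \<open>\<mu> + i t \<nu>\<close>, where \<open>\<nu> (1 - Q) = \<mu> M\<close>, removes the term of order \<open>t\<close>, and the term of order
  \<open>t\<^sup>2\<close> is \<open>\<sigma> / 2\<close>.  Integrating the Lorentz kernel gives \<open>U\<^sub>j\<^sub>i(z) \<sim> \<mu>\<^sub>i / \<surd>(2 \<sigma> (1 - z))\<close>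
  (\<open>green_asymptotics\<close>).

  Since \<open>q \<ge> 0\<close>, the second linear relation yields \<open>\<mu> \<cdot> q(z) \<sim> \<surd>(2 \<sigma> / (1 - z))\<close> although the leading part of
  the matrix \<open>U\<close> has rank one, and the first yields \<open>(1 - z) r\<^sub>j(z) \<sim> \<surd>(2 \<sigma> / (1 - z))\<close>.  The left-hand
  side is the generating function of the increments of \<open>r\<^sub>n(j)\<close>, which are nonnegative, so Karamata's
  Tauberian theorem (\<open>karamata_half\<close>) turns this into
  \<open>r\<^sub>n(j) \<sim> (2 / \<surd>\<pi>) \<surd>(2 \<sigma> n) = \<surd>(8 \<sigma> n / \<pi>)\<close>.  The limit is the same for all \<open>j\<close>, so the
  asymptotics carry over to every initial distribution of the internal state.
\<close>

section \<open>A Tauberian theorem of Karamata\<close>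

text \<open>
  The normal distribution with variance \<open>1/2\<close>, whose density is \<open>e\<^sup>-\<^sup>s\<^sup>2 / \<surd>\<pi>\<close>.  In the variable \<open>t = s\<^sup>2\<close>
  it becomes the Gamma distribution of index \<open>1/2\<close>, which is the limit law in Karamata's theorem for a
  singularity of order \<open>1/2\<close>; the Gaussian form keeps its integrals elementary.
\<close>

definition gauss :: "real measure" where
  "gauss = density lborel (normal_density 0 (1 / sqrt 2))"

lemma normal_density_half: "normal_density 0 (1 / sqrt 2) s = exp (- s\<^sup>2) / sqrt pi"
  by (simp add: normal_density_def power_divide)

lemma prob_space_gauss: "prob_space gauss"
  unfolding gauss_def by (rule prob_space_normal_density) simp

lemma sets_gauss [measurable_cong, simp]: "sets gauss = sets borel"
  by (simp add: gauss_def)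

lemma integral_gauss:
  fixes f :: "real \<Rightarrow> real"
  assumes [measurable]: "f \<in> borel_measurable borel"
  shows "integral\<^sup>L gauss f = (\<integral>s. exp (- s\<^sup>2) / sqrt pi * f s \<partial>lborel)"
  unfolding gauss_def
  by (subst integral_density) (simp_all add: normal_density_half normal_density_nonneg)

lemma gauss_moment:
  "(LINT s|gauss. exp (- s\<^sup>2) ^ k) = 1 / sqrt (real (Suc k))"
proof -
  define K where "K = real (Suc k)"
  have K: "K > 0" by (simp add: K_def)
  have "exp (- s\<^sup>2) / sqrt pi * exp (- s\<^sup>2) ^ k = 1 / sqrt K * normal_density 0 (1 / sqrt (2 * K)) s" for s
  proof -
    have "exp (- s\<^sup>2) * exp (- s\<^sup>2) ^ k = exp (- s\<^sup>2) ^ Suc k" by simp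
    also have "\<dots> = exp (- (K * s\<^sup>2))"
      unfolding K_def by (subst exp_of_nat_mult [symmetric]) simp
    finally have "exp (- s\<^sup>2) * exp (- s\<^sup>2) ^ k = exp (- (K * s\<^sup>2))" .
    then show ?thesis using K
      by (simp add: normal_density_def power_divide power_mult_distrib real_sqrt_mult real_sqrt_divide mult.commute)
  qed
  then show ?thesis
    by (subst integral_gauss) (simp_all add: K_def)
qed

text \<open>
  The value \<open>2 / \<surd>\<pi> = 1 / \<Gamma>(3/2)\<close> is the Tauberian constant.
\<close>

lemma gauss_cutoff:
  "(LINT s|gauss. of_bool (\<bar>s\<bar> \<le> 1) * exp (s\<^sup>2)) = 2 / sqrt pi"
proof -
  have "exp (- s\<^sup>2) / sqrt pi * (of_bool (\<bar>s\<bar> \<le> 1) * exp (s\<^sup>2)) = indicator {-1..1} s * (1 / sqrt pi)" for s :: real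
    by (auto simp: indicator_def abs_le_iff exp_minus)
  then show ?thesis
    by (subst integral_gauss) simp_all
qed

text \<open>
  The bounds are used for one fixed \<open>m\<close> at a time, so their convergence need not be uniform in \<open>m\<close>.
\<close>

lemma LIMSEQ_double_sandwich:
  fixes X :: "nat \<Rightarrow> real"
  assumes lo: "\<And>m n. n \<ge> 1 \<Longrightarrow> lo m n \<le> X n" and up: "\<And>m n. n \<ge> 1 \<Longrightarrow> X n \<le> up m n"
    and lo_lim: "\<And>m. lo m \<longlonglongrightarrow> lo' m" and up_lim: "\<And>m. up m \<longlonglongrightarrow> up' m"
    and lo': "lo' \<longlonglongrightarrow> l" and up': "up' \<longlonglongrightarrow> l"
  shows "X \<longlonglongrightarrow> l"
proof (rule order_tendstoI)
  fix y assume "y < l"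
  then have "eventually (\<lambda>m. y < lo' m) sequentially" using lo' by (rule order_tendstoD(1)[rotated])
  then obtain m where "y < lo' m" by (auto simp: eventually_sequentially)
  then have "eventually (\<lambda>n. y < lo m n) sequentially" using lo_lim[of m] by (rule order_tendstoD(1)[rotated])
  then show "eventually (\<lambda>n. y < X n) sequentially"
    using eventually_ge_at_top[of 1] by eventually_elim (use lo in \<open>force intro: less_le_trans\<close>)
next
  fix y assume "y > l"
  then have "eventually (\<lambda>m. y > up' m) sequentially" using up' by (rule order_tendstoD(2)[rotated])
  then obtain m where "y > up' m" by (auto simp: eventually_sequentially)
  then have "eventually (\<lambda>n. y > up m n) sequentially" using up_lim[of m] by (rule order_tendstoD(2)[rotated])
  then show "eventually (\<lambda>n. y > X n) sequentially"
    using eventually_ge_at_top[of 1] by eventually_elim (use up in \<open>force intro: le_less_trans\<close>)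
qed

text \<open>
  Karamata's argument: the weights \<open>\<surd>(1 - z) a\<^sub>n z\<^sup>n\<close>, placed at the points \<open>z\<^sup>n\<close> of \<open>[0, 1]\<close>, have moments
  that are again values of the generating function, at powers of \<open>z\<close>.  Hence as \<open>z\<close> tends to \<open>1\<close> their
  moments converge to those of \<open>C\<close> times the law of \<open>e\<^sup>-\<^sup>s\<^sup>2\<close>, and by Weierstrass approximation so do the
  integrals of continuous functions.  The partial sum up to \<open>N\<close> is the integral of
  \<open>1/x\<close> cut off below \<open>1/e\<close>, for \<open>z = e\<^sup>-\<^sup>1\<^sup>/\<^sup>N\<close>; this function has a single discontinuity, which the limit
  law does not charge.
\<close>

locale abelian_half_limit =
  fixes a :: "nat \<Rightarrow> real" and C :: real
  assumes nonneg: "\<And>n. a n \<ge> 0"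
    and summable: "\<And>z. 0 < z \<Longrightarrow> z < 1 \<Longrightarrow> summable (\<lambda>n. a n * z ^ n)"
    and abelian: "((\<lambda>z. sqrt (1 - z) * (\<Sum>n. a n * z ^ n)) \<longlongrightarrow> C) (at_left 1)"
begin

definition base :: "nat \<Rightarrow> real" where "base N = exp (- 1 / real N)"

definition damped_sum :: "nat \<Rightarrow> (real \<Rightarrow> real) \<Rightarrow> real" where
  "damped_sum N f = sqrt (1 - base N) * (\<Sum>n. a n * base N ^ n * f (base N ^ n))"

definition damped_limit :: "(real \<Rightarrow> real) \<Rightarrow> real" where
  "damped_limit f = C * (LINT s|gauss. f (exp (- s\<^sup>2)))"

lemma base: "N \<ge> 1 \<Longrightarrow> 0 < base N" "N \<ge> 1 \<Longrightarrow> base N < 1" "N \<ge> 1 \<Longrightarrow> base N ^ n \<in> {0..1}"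
proof -
  assume "N \<ge> 1"
  show 1: "0 < base N" by (simp add: base_def)
  show 2: "base N < 1" using \<open>N \<ge> 1\<close> by (simp add: base_def)
  show "base N ^ n \<in> {0..1}" using 1 2 by (auto intro: power_le_one)
qed

lemma damped_sum_summable:
  assumes "N \<ge> 1" and "\<And>x. x \<in> {0..1} \<Longrightarrow> \<bar>f x\<bar> \<le> B"
  shows "summable (\<lambda>n. a n * base N ^ n * f (base N ^ n))"
proof (rule summable_comparison_test')
  show "summable (\<lambda>n. B * (a n * base N ^ n))" using base[OF assms(1)] by (intro summable_mult summable) auto
  show "norm (a n * base N ^ n * f (base N ^ n)) \<le> B * (a n * base N ^ n)" for n
  proof -
    have "\<bar>f (base N ^ n)\<bar> * (a n * base N ^ n) \<le> B * (a n * base N ^ n)"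
      using base(1)[OF assms(1)] nonneg[of n] by (intro mult_right_mono assms base) (use assms in auto)
    then show ?thesis using base(1)[OF assms(1)] nonneg[of n] by (simp add: abs_mult mult_ac)
  qed
qed

lemma damped_sum_mono:
  assumes "N \<ge> 1" "\<And>x. x \<in> {0..1} \<Longrightarrow> f x \<le> g x" 
    and f: "\<And>x. x \<in> {0..1} \<Longrightarrow> \<bar>f x\<bar> \<le> B" and g: "\<And>x. x \<in> {0..1} \<Longrightarrow> \<bar>g x\<bar> \<le> B"
  shows "damped_sum N f \<le> damped_sum N g"
  unfolding damped_sum_def using base[OF assms(1)] nonneg
  by (intro mult_left_mono suminf_le damped_sum_summable[OF assms(1) f] damped_sum_summable[OF assms(1) g] assms(2))
     (auto simp: less_imp_le)

text \<open>
  The \<open>k\<close>-th moment is the generating function at \<open>z\<^sup>k\<^sup>+\<^sup>1\<close>, and \<open>1 - z\<^sup>k\<^sup>+\<^sup>1 \<sim> (k + 1) (1 - z)\<close>.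
\<close>

lemma damped_sum_power: "(\<lambda>N. damped_sum N (\<lambda>x. x ^ k)) \<longlonglongrightarrow> damped_limit (\<lambda>x. x ^ k)"
proof -
  define K where "K = real (Suc k)"
  have K: "K > 0" by (simp add: K_def)
  have base_power: "base N ^ Suc k = exp (- K / real N)" for N
    unfolding base_def K_def by (subst exp_of_nat_mult [symmetric]) (simp add: diff_divide_distrib add_divide_distrib)
  have "(\<lambda>N. sqrt (1 - base N) / sqrt (1 - exp (- K / real N)) *
          (sqrt (1 - base N ^ Suc k) * (\<Sum>n. a n * (base N ^ Suc k) ^ n))) \<longlonglongrightarrow> 1 / sqrt K * C"
  proof (rule tendsto_mult)
    show "(\<lambda>N. sqrt (1 - base N) / sqrt (1 - exp (- K / real N))) \<longlonglongrightarrow> 1 / sqrt K"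
      unfolding base_def using K by (real_asymp simp: powr_half_sqrt inverse_eq_divide)
    have "filterlim (\<lambda>N. base N ^ Suc k) (at_left 1) sequentially"
      unfolding base_power using K by real_asymp
    from filterlim_compose[OF abelian this]
    show "(\<lambda>N. sqrt (1 - base N ^ Suc k) * (\<Sum>n. a n * (base N ^ Suc k) ^ n)) \<longlonglongrightarrow> C" .
  qed
  also have "1 / sqrt K * C = damped_limit (\<lambda>x. x ^ k)"
    unfolding damped_limit_def gauss_moment K_def by simp
  finally show ?thesis
  proof (rule Lim_transform_eventually)
    show "\<forall>\<^sub>F N in sequentially. sqrt (1 - base N) / sqrt (1 - exp (- K / real N)) *
          (sqrt (1 - base N ^ Suc k) * (\<Sum>n. a n * (base N ^ Suc k) ^ n)) = damped_sum N (\<lambda>x. x ^ k)"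
      using eventually_ge_at_top[of 1]
    proof eventually_elim
      case (elim N)
      have "base N ^ Suc k < 1" using elim K unfolding base_power by simp
      then have "sqrt (1 - base N ^ Suc k) \<noteq> 0" by simp
      moreover have "(\<lambda>n. a n * (base N ^ Suc k) ^ n) = (\<lambda>n. a n * base N ^ n * (base N ^ n) ^ k)"
        by (simp add: power_mult_distrib power_mult [symmetric] mult_ac)
      ultimately show ?case unfolding damped_sum_def base_power [symmetric] by (simp del: power_Suc)
    qed
  qed
qed

lemma damped_sum_continuous:
  assumes f: "continuous_on UNIV f"
  shows "(\<lambda>N. damped_sum N f) \<longlonglongrightarrow> damped_limit f"
proof -
  interpret G: prob_space gauss by (rule prob_space_gauss)
  have bounded: "\<exists>B. \<forall>x\<in>{0..1}. \<bar>g x\<bar> \<le> B" if "continuous_on UNIV g" for g :: "real \<Rightarrow> real"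
  proof -
    have "compact (g ` {0..1})"
      by (rule compact_continuous_image) (use that continuous_on_subset in auto)
    then have "bounded (g ` {0..1})" by (rule compact_imp_bounded)
    then show ?thesis by (auto simp: bounded_iff)
  qed
  have intg: "integrable gauss (\<lambda>s. g (exp (- s\<^sup>2)))" if g: "continuous_on UNIV g" for g :: "real \<Rightarrow> real"
  proof -
    obtain B where B: "\<And>x. x \<in> {0..1} \<Longrightarrow> \<bar>g x\<bar> \<le> B" using bounded[OF g] by blast
    have [measurable]: "g \<in> borel_measurable borel" using g by (rule borel_measurable_continuous_onI)
    show ?thesis by (rule G.integrable_const_bound[where B = B]) (auto intro!: AE_I2 B)
  qed
  let ?c = "\<bar>C\<bar> + 1"
  show ?thesis
  proof (rule LIMSEQ_I)
    fix e :: real assume e: "e > 0"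
    have c_pos: "?c > 0" by linarith
    define d where "d = e / 4 / ?c"
    have d: "d > 0" unfolding d_def using e c_pos by (intro divide_pos_pos) auto
    have cd: "?c * d = e / 4"
      unfolding d_def using c_pos by (subst times_divide_eq_right, subst nonzero_mult_div_cancel_left) auto
    obtain p where p: "real_polynomial_function p" and fp: "\<And>x. x \<in> {0..1} \<Longrightarrow> \<bar>f x - p x\<bar> < d"
      using Stone_Weierstrass_real_polynomial_function[of "{0..1}" f d] f d
      by (metis compact_Icc continuous_on_subset top_greatest)
    obtain b m where pb: "p = (\<lambda>x. \<Sum>i\<le>m. b i * x ^ i)"
      using p unfolding real_polynomial_function_iff_sum by blast
    have pc: "continuous_on UNIV p" unfolding pb by (intro continuous_intros)
    have fin: "damped_sum N p = (\<Sum>i\<le>m. b i * damped_sum N (\<lambda>x. x ^ i))" if "N \<ge> 1" for N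
    proof -
      have "(\<Sum>n. a n * base N ^ n * p (base N ^ n)) = (\<Sum>n. \<Sum>i\<le>m. b i * (a n * base N ^ n * (base N ^ n) ^ i))"
        unfolding pb by (simp add: sum_distrib_left mult_ac)
      also have "\<dots> = (\<Sum>i\<le>m. \<Sum>n. b i * (a n * base N ^ n * (base N ^ n) ^ i))"
        by (intro suminf_sum summable_mult damped_sum_summable[where B = 1] that) (auto simp: power_abs intro: power_le_one)
      also have "\<dots> = (\<Sum>i\<le>m. b i * (\<Sum>n. a n * base N ^ n * (base N ^ n) ^ i))"
        by (intro sum.cong refl suminf_mult damped_sum_summable[where B = 1] that) (auto simp: power_abs intro: power_le_one)
      finally show ?thesis unfolding damped_sum_def by (simp add: sum_distrib_left mult_ac)
    qed
    have limp: "damped_limit p = (\<Sum>i\<le>m. b i * damped_limit (\<lambda>x. x ^ i))"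
    proof -
      have "(\<integral>s. p (exp (- s\<^sup>2)) \<partial>gauss) = (\<Sum>i\<le>m. \<integral>s. b i * exp (- s\<^sup>2) ^ i \<partial>gauss)"
        unfolding pb by (subst Bochner_Integration.integral_sum)
          (auto intro!: integrable_mult_right intg[of "\<lambda>x. x ^ _"] continuous_intros)
      then show ?thesis unfolding damped_limit_def by (simp add: sum_distrib_left mult_ac)
    qed
    have "(\<lambda>N. \<Sum>i\<le>m. b i * damped_sum N (\<lambda>x. x ^ i)) \<longlonglongrightarrow> damped_limit p"
      unfolding limp by (intro tendsto_intros damped_sum_power)
    then have "eventually (\<lambda>N. dist (\<Sum>i\<le>m. b i * damped_sum N (\<lambda>x. x ^ i)) (damped_limit p) < e / 4) sequentially"
      by (rule tendstoD) (use e in simp)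
    moreover have "eventually (\<lambda>N. damped_sum N (\<lambda>x. x ^ 0) < ?c) sequentially"
      using damped_sum_power[of 0] by (rule order_tendstoD) (simp add: damped_limit_def G.prob_space)
    ultimately have "eventually (\<lambda>N. norm (damped_sum N f - damped_limit f) < e) sequentially"
      using eventually_ge_at_top[of 1]
    proof eventually_elim
      case (elim N)
      obtain Bf where Bf: "\<And>x. x \<in> {0..1} \<Longrightarrow> \<bar>f x\<bar> \<le> Bf" using bounded[OF f] by blast
      obtain Bp where Bp: "\<And>x. x \<in> {0..1} \<Longrightarrow> \<bar>p x\<bar> \<le> Bp" using bounded[OF pc] by blast
      have "\<bar>damped_sum N f - damped_sum N p\<bar> \<le> d * damped_sum N (\<lambda>x. x ^ 0)"
      proof -
        have "damped_sum N f - damped_sum N p = sqrt (1 - base N) * (\<Sum>n. a n * base N ^ n * (f (base N ^ n) - p (base N ^ n)))"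
          unfolding damped_sum_def right_diff_distrib [symmetric]
          by (subst suminf_diff [OF damped_sum_summable[OF elim(3) Bf] damped_sum_summable[OF elim(3) Bp]])
             (simp_all add: right_diff_distrib)
        also have "\<bar>\<dots>\<bar> = sqrt (1 - base N) * \<bar>\<Sum>n. a n * base N ^ n * (f (base N ^ n) - p (base N ^ n))\<bar>"
          using base(2)[OF elim(3)] by (simp add: abs_mult)
        also have "\<dots> \<le> sqrt (1 - base N) * (\<Sum>n. d * (a n * base N ^ n))"
        proof (intro mult_left_mono)
          have sd: "summable (\<lambda>n. d * (a n * base N ^ n))" using base[OF elim(3)] by (intro summable_mult summable) auto
          have le: "norm (a n * base N ^ n * (f (base N ^ n) - p (base N ^ n))) \<le> d * (a n * base N ^ n)" for n
          proof -
            have "\<bar>f (base N ^ n) - p (base N ^ n)\<bar> * (a n * base N ^ n) \<le> d * (a n * base N ^ n)"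
              using fp[OF base(3)[OF elim(3)], of n] base(1)[OF elim(3)] nonneg[of n] by (intro mult_right_mono) auto
            then show ?thesis using base(1)[OF elim(3)] nonneg[of n] by (simp add: abs_mult mult_ac)
          qed
          show "\<bar>\<Sum>n. a n * base N ^ n * (f (base N ^ n) - p (base N ^ n))\<bar> \<le> (\<Sum>n. d * (a n * base N ^ n))"
            using norm_suminf_le[OF le sd] by simp
        qed (use base(2)[OF elim(3)] in auto)
        also have "\<dots> = d * damped_sum N (\<lambda>x. x ^ 0)"
          unfolding damped_sum_def using base[OF elim(3)] by (subst suminf_mult) (auto intro: summable)
        finally show ?thesis .
      qed
      also have "\<dots> \<le> d * ?c" using elim(2) d by (intro mult_left_mono) auto
      also have "\<dots> = e / 4" using cd by (simp add: mult.commute)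
      finally have 1: "\<bar>damped_sum N f - damped_sum N p\<bar> \<le> e / 4" .
      have 2: "\<bar>damped_sum N p - damped_limit p\<bar> < e / 4" using elim(1) fin[OF elim(3)] by (simp add: dist_real_def)
      have "\<bar>damped_limit f - damped_limit p\<bar> = \<bar>C\<bar> * \<bar>\<integral>s. f (exp (- s\<^sup>2)) - p (exp (- s\<^sup>2)) \<partial>gauss\<bar>"
        unfolding damped_limit_def by (subst Bochner_Integration.integral_diff) (auto intro!: intg f pc simp: abs_mult [symmetric] algebra_simps)
      also have "\<dots> \<le> \<bar>C\<bar> * (\<integral>s. d \<partial>gauss)"
      proof (rule mult_left_mono)
        have "\<bar>\<integral>s. f (exp (- s\<^sup>2)) - p (exp (- s\<^sup>2)) \<partial>gauss\<bar> \<le> (\<integral>s. \<bar>f (exp (- s\<^sup>2)) - p (exp (- s\<^sup>2))\<bar> \<partial>gauss)"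
          by (rule integral_abs_bound)
        also have "\<dots> \<le> (\<integral>s. d \<partial>gauss)"
          by (rule integral_mono[OF integrable_abs[OF Bochner_Integration.integrable_diff[OF intg[OF f] intg[OF pc]]]])
               (auto intro!: less_imp_le fp)
        finally show "\<bar>\<integral>s. f (exp (- s\<^sup>2)) - p (exp (- s\<^sup>2)) \<partial>gauss\<bar> \<le> (\<integral>s. d \<partial>gauss)" .
      qed simp
      also have "\<dots> = \<bar>C\<bar> * d" by (simp add: G.prob_space)
      also have "\<dots> \<le> ?c * d" using d by (intro mult_right_mono) auto
      also have "\<dots> = e / 4" by (rule cd)
      finally have 3: "\<bar>damped_limit f - damped_limit p\<bar> \<le> e / 4" .
      show ?case using 1 2 3 e unfolding real_norm_def by linarith
    qed
    then show "\<exists>no. \<forall>n\<ge>no. norm (damped_sum n f - damped_limit f) < e" by (simp add: eventually_sequentially)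
  qed
qed

theorem karamata_half: "(\<lambda>N. (\<Sum>k\<le>N. a k) / sqrt (real N)) \<longlonglongrightarrow> C * (2 / sqrt pi)"
proof -
  interpret G: prob_space gauss by (rule prob_space_gauss)
  define c :: real where "c = exp (- 1)"
  have c: "c > 0" by (simp add: c_def)
  \<comment> \<open>Continuous functions above and below \<open>g\<close>: the jump at \<open>c\<close> is replaced by a ramp of width \<open>1/m\<close> on
    its left, respectively on its right.  The denominator is kept away from \<open>0\<close>.\<close>
  define up where "up m x = min 1 (max 0 (1 + real m * (x - c))) / max x c" for m :: nat and x
  define lo where "lo m x = min 1 (max 0 (real m * (x - c))) / max x c" for m :: nat and x
  define g where "g x = (if x \<ge> c then 1 / x else 0)" for x
  have cont: "continuous_on UNIV (up m)" "continuous_on UNIV (lo m)" for m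
  proof -
    have "max x c \<noteq> 0" for x using c by (simp add: max_def)
    then show "continuous_on UNIV (up m)" "continuous_on UNIV (lo m)"
      unfolding up_def lo_def by (intro continuous_intros; blast)+
  qed
  have bound: "\<bar>h / max x c\<bar> \<le> 1 / c" if "h \<in> {0..1}" for h x
    using c that by (simp add: max_def) (auto intro!: frac_le)
  have ub: "\<bar>up m x\<bar> \<le> 1 / c" "\<bar>lo m x\<bar> \<le> 1 / c" "\<bar>g x\<bar> \<le> 1 / c" for m x
  proof -
    show "\<bar>up m x\<bar> \<le> 1 / c" "\<bar>lo m x\<bar> \<le> 1 / c"
      unfolding up_def lo_def by (rule bound; simp)+
    show "\<bar>g x\<bar> \<le> 1 / c" using c by (auto simp: g_def intro!: frac_le)
  qed
  have gle: "lo m x \<le> g x" "g x \<le> up m x" for m x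
  proof -
    show "g x \<le> up m x" using c by (auto simp: g_def up_def max_def)
    show "lo m x \<le> g x"
    proof (cases "x \<ge> c")
      case False
      then have "real m * (x - c) \<le> 0" by (simp add: mult_nonneg_nonpos)
      then show ?thesis using False by (simp add: lo_def g_def max_def min_def)
    qed (use c in \<open>auto simp: g_def lo_def max_def divide_right_mono\<close>)
  qed
  have sg: "damped_sum N g = sqrt (1 - base N) * (\<Sum>k\<le>N. a k)" if N: "N \<ge> 1" for N
  proof -
    have "(base N ^ n \<ge> c) = (n \<le> N)" for n
    proof -
      have "base N ^ n = exp (- (real n / real N))"
        unfolding base_def by (subst exp_of_nat_mult [symmetric]) simp
      then show ?thesis using N by (simp add: c_def)
    qed
    then have "a n * base N ^ n * g (base N ^ n) = (if n \<in> {..N} then a n else 0)" for n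
      using base(1)[OF N] by (simp add: g_def)
    then have "(\<Sum>n. a n * base N ^ n * g (base N ^ n)) = (\<Sum>n. if n \<in> {..N} then a n else 0)" by simp
    also have "\<dots> = (\<Sum>k\<le>N. a k)" by (subst suminf_finite[of "{..N}"]) auto
    finally show ?thesis by (simp add: damped_sum_def)
  qed
  have G2: "(\<integral>s. g (exp (- s\<^sup>2)) \<partial>gauss) = 2 / sqrt pi"
  proof -
    have "g (exp (- s\<^sup>2)) = of_bool (\<bar>s\<bar> \<le> 1) * exp (s\<^sup>2)" for s
      by (simp add: g_def c_def abs_square_le_1 [symmetric] exp_minus divide_simps)
    then show ?thesis by (simp add: gauss_cutoff)
  qed
  have meas [measurable]: "up m \<in> borel_measurable borel" "lo m \<in> borel_measurable borel" for m
    using cont by (auto intro: borel_measurable_continuous_onI)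
  have [measurable]: "g \<in> borel_measurable borel" unfolding g_def by measurable
  have up_lim: "(\<lambda>m. damped_limit (up m)) \<longlonglongrightarrow> C * (2 / sqrt pi)"
    unfolding damped_limit_def G2 [symmetric]
  proof (intro tendsto_mult tendsto_const integral_dominated_convergence[where w = "\<lambda>_. 1 / c"])
    have "(\<lambda>m. up m x) \<longlonglongrightarrow> g x" for x
    proof (cases "x \<ge> c")
      case True
      then have "up m x = g x" for m using c by (simp add: up_def g_def max_def min_def)
      then show ?thesis by simp
    next
      case False
      then have "filterlim (\<lambda>m. 1 + real m * (x - c)) at_bot sequentially" by real_asymp
      then have "eventually (\<lambda>m. 1 + real m * (x - c) \<le> 0) sequentially" by (simp add: filterlim_at_bot)
      then have "eventually (\<lambda>m. up m x = g x) sequentially"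
        by eventually_elim (use False in \<open>simp add: up_def g_def max_def min_def\<close>)
      then show ?thesis by (rule tendsto_eventually)
    qed
    then show "AE s in gauss. (\<lambda>m. up m (exp (- s\<^sup>2))) \<longlonglongrightarrow> g (exp (- s\<^sup>2))" by auto
  qed (use ub in auto)
  have lo_lim: "(\<lambda>m. damped_limit (lo m)) \<longlonglongrightarrow> C * (2 / sqrt pi)"
    unfolding damped_limit_def G2 [symmetric]
  proof (intro tendsto_mult tendsto_const integral_dominated_convergence[where w = "\<lambda>_. 1 / c"])
    have lim: "(\<lambda>m. lo m x) \<longlonglongrightarrow> g x" if "x \<noteq> c" for x
    proof (cases "x > c")
      case False
      then have "lo m x = g x" for m
        using c that mult_nonneg_nonpos[of "real m" "x - c"] by (simp add: lo_def g_def max_def min_def)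
      then show ?thesis by simp
    next
      case True
      then have "filterlim (\<lambda>m. real m * (x - c)) at_top sequentially" by real_asymp
      then have "eventually (\<lambda>m. real m * (x - c) \<ge> 1) sequentially" by (simp add: filterlim_at_top)
      then have "eventually (\<lambda>m. lo m x = g x) sequentially"
        by eventually_elim (use True in \<open>simp add: lo_def g_def max_def min_def\<close>)
      then show ?thesis by (rule tendsto_eventually)
    qed
    \<comment> \<open>The lower ramps fail to converge to \<open>g\<close> at \<open>c\<close> only, that is for \<open>s = 1\<close> or \<open>s = -1\<close>.\<close>
    have "AE s in lborel. s \<noteq> (1::real)" "AE s in lborel. s \<noteq> (-1::real)" by (rule AE_lborel_singleton)+
    then have "AE s in lborel. exp (- s\<^sup>2) \<noteq> c"
      by eventually_elim (auto simp: c_def power2_eq_1_iff)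
    then have "AE s in gauss. exp (- s\<^sup>2) \<noteq> c"
      unfolding gauss_def by (subst AE_density) auto
    then show "AE s in gauss. (\<lambda>m. lo m (exp (- s\<^sup>2))) \<longlonglongrightarrow> g (exp (- s\<^sup>2))"
      by eventually_elim (rule lim)
  qed (use ub in auto)
  have "(\<lambda>N. damped_sum N g) \<longlonglongrightarrow> C * (2 / sqrt pi)"
  proof (rule LIMSEQ_double_sandwich[OF _ _ _ _ lo_lim up_lim])
    show "damped_sum N (lo m) \<le> damped_sum N g" "damped_sum N g \<le> damped_sum N (up m)" if "1 \<le> N" for m N
      by (rule damped_sum_mono[OF that _ ub(2) ub(3)] damped_sum_mono[OF that _ ub(3) ub(1)], rule gle)+
    show "(\<lambda>N. damped_sum N (lo m)) \<longlonglongrightarrow> damped_limit (lo m)" "(\<lambda>N. damped_sum N (up m)) \<longlonglongrightarrow> damped_limit (up m)" for m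
      by (rule damped_sum_continuous, rule cont)+
  qed
  then have "(\<lambda>N. damped_sum N g * (1 / (sqrt (real N) * sqrt (1 - base N)))) \<longlonglongrightarrow> C * (2 / sqrt pi) * 1"
  proof (rule tendsto_mult)
    show "(\<lambda>N. 1 / (sqrt (real N) * sqrt (1 - base N))) \<longlonglongrightarrow> 1" unfolding base_def by real_asymp
  qed
  then have "(\<lambda>N. damped_sum N g * (1 / (sqrt (real N) * sqrt (1 - base N)))) \<longlonglongrightarrow> C * (2 / sqrt pi)" by simp
  then show ?thesis
  proof (rule Lim_transform_eventually)
    show "\<forall>\<^sub>F N in sequentially. damped_sum N g * (1 / (sqrt (real N) * sqrt (1 - base N))) = (\<Sum>k\<le>N. a k) / sqrt (real N)"
      using eventually_ge_at_top[of 1]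
    proof eventually_elim
      case (elim N)
      then have "sqrt (1 - base N) \<noteq> 0" using base(2)[of N] by simp
      then show ?case using sg[OF elim] by simp
    qed
  qed
qed

end

section \<open>The walk as a family of discrete distributions\<close>

abbreviation expect :: "'a pmf \<Rightarrow> ('a \<Rightarrow> 'b) \<Rightarrow> 'b::{banach, second_countable_topology}" where
  "expect p f \<equiv> integral\<^sup>L (measure_pmf p) f"

lemma integrable_bounded_pmf:
  fixes f :: "'a \<Rightarrow> 'b::{banach, second_countable_topology}"
  assumes "\<And>x. x \<in> set_pmf p \<Longrightarrow> norm (f x) \<le> B"
  shows "integrable (measure_pmf p) f"
  by (rule measure_pmf.integrable_const_bound[where B = B]) (auto simp: AE_measure_pmf_iff assms)

text \<open>
  The bound is required on the support only, because the number of distinct sites is bounded on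
  paths of a fixed length but not on all lists.
\<close>

lemma expectation_bind_real:
  fixes f :: "'b \<Rightarrow> real"
  assumes "\<And>x. x \<in> set_pmf (bind_pmf p N) \<Longrightarrow> \<bar>f x\<bar> \<le> B"
  shows "expect (bind_pmf p N) f = expect p (\<lambda>x. expect (N x) f)"
proof -
  define g where "g x = (if x \<in> set_pmf (bind_pmf p N) then f x else 0)" for x
  have "expect (bind_pmf p N) f = expect (bind_pmf p N) g"
    by (rule integral_cong_AE) (auto simp: AE_measure_pmf_iff g_def)
  also have "\<dots> = expect p (\<lambda>x. expect (N x) g)"
    unfolding measure_pmf_bind
  proof (rule integral_bind[where K = "count_space UNIV" and B = "\<bar>B\<bar>" and B' = 1])
    show "finite_measure (measure_pmf p)" by unfold_locales
    show "\<bar>g x\<bar> \<le> \<bar>B\<bar>" for x using assms[of x] abs_ge_self[of B] by (auto simp: g_def simp del: set_bind_pmf)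
  qed (auto simp: measure_pmf_in_subprob_algebra measure_pmf.emeasure_space_1)
  also have "\<dots> = expect p (\<lambda>x. expect (N x) f)"
  proof (rule integral_cong_AE)
    show "AE x in p. expect (N x) g = expect (N x) f"
      unfolding AE_measure_pmf_iff by (auto intro!: integral_cong_AE simp: AE_measure_pmf_iff g_def)
  qed auto
  finally show ?thesis .
qed

lemma expectation_bind_complex:
  fixes f :: "'b \<Rightarrow> complex"
  assumes "\<And>x. norm (f x) \<le> B"
  shows "expect (bind_pmf p N) f = expect p (\<lambda>x. expect (N x) f)"
proof -
  have int: "integrable (measure_pmf q) f" for q by (rule integrable_bounded_pmf) (rule assms)
  have int2: "integrable (measure_pmf p) (\<lambda>x. expect (N x) f)"
  proof (rule integrable_bounded_pmf)
    fix x
    have "norm (expect (N x) f) \<le> expect (N x) (\<lambda>x. norm (f x))"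
      by (rule integral_norm_bound)
    also have "\<dots> \<le> expect (N x) (\<lambda>x. B)"
      by (rule integral_mono) (auto intro: integrable_norm int assms)
    finally show "norm (expect (N x) f) \<le> B" by simp
  qed
  have "Re (expect (bind_pmf p N) f) = Re (expect p (\<lambda>x. expect (N x) f))"
    using assms abs_Re_le_cmod
    by (simp add: int int2 flip: integral_Re) (rule expectation_bind_real[where B = B], meson order_trans)
  moreover have "Im (expect (bind_pmf p N) f) = Im (expect p (\<lambda>x. expect (N x) f))"
    using assms abs_Im_le_cmod
    by (simp add: int int2 flip: integral_Im) (rule expectation_bind_real[where B = B], meson order_trans)
  ultimately show ?thesis by (rule complex_eqI)
qed

lemma expectation_split_state:
  fixes f :: "'a \<Rightarrow> 'e::finite \<Rightarrow> 'b::{banach, second_countable_topology, real_normed_algebra_1}"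
  assumes "\<And>y k. norm (f y k) \<le> B"
  shows "expect P (\<lambda>(y, k). f y k) =
     (\<Sum>k\<in>UNIV. expect P (\<lambda>(y, l). f y k * of_bool (l = k)))"
proof -
  have "expect P (\<lambda>(y, k). f y k) = expect P (\<lambda>(y, l). \<Sum>k\<in>UNIV. f y k * of_bool (l = k))"
    by (rule Bochner_Integration.integral_cong) (auto simp: of_bool_def if_distrib cong: if_cong)
  also have "\<dots> = expect P (\<lambda>w. \<Sum>k\<in>UNIV. case w of (y, l) \<Rightarrow> f y k * of_bool (l = k))"
    by (simp add: case_prod_unfold)
  also have "\<dots> = (\<Sum>k\<in>UNIV. expect P (\<lambda>(y, l). f y k * of_bool (l = k)))"
  proof (rule Bochner_Integration.integral_sum, rule integrable_bounded_pmf[where B = B])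
    fix k and w :: "'a \<times> 'e"
    show "norm (case w of (y, l) \<Rightarrow> f y k * of_bool (l = k)) \<le> B"
      using assms[of "fst w" k] order_trans[OF norm_ge_zero assms[of "fst w" k]] by (auto simp: case_prod_unfold of_bool_def)
  qed
  finally show ?thesis .
qed

text \<open>
  For each internal state, the joint distribution of the displacement and of the next internal state.
\<close>

type_synonym 'e jumps = "'e \<Rightarrow> (int \<times> 'e) pmf"

definition step :: "'e jumps \<Rightarrow> int \<times> 'e \<Rightarrow> (int \<times> 'e) pmf" where
  "step J s = map_pmf (\<lambda>(y, k). (fst s + y, k)) (J (snd s))"

text \<open>
  Both the law of the position after \<open>n\<close> steps and the law of the whole path recurse on the first step.
  First-step recursion suits the renewal arguments below: after one step the walk is a translate of a
  walk from the origin.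
\<close>

primrec walk :: "'e jumps \<Rightarrow> nat \<Rightarrow> int \<times> 'e \<Rightarrow> (int \<times> 'e) pmf" where
  "walk J 0 s = return_pmf s"
| "walk J (Suc n) s = bind_pmf (step J s) (walk J n)"

primrec traj :: "'e jumps \<Rightarrow> nat \<Rightarrow> int \<times> 'e \<Rightarrow> (int \<times> 'e) list pmf" where
  "traj J 0 s = return_pmf [s]"
| "traj J (Suc n) s = bind_pmf (step J s) (\<lambda>t. map_pmf ((#) s) (traj J n t))"

definition sites :: "(int \<times> 'e) list \<Rightarrow> int set" where
  "sites l = fst ` set l"

lemma sites_Cons [simp]: "sites (s # l) = insert (fst s) (sites l)" 
  and sites_append [simp]: "sites (l @ l') = sites l \<union> sites l'"
  and sites_Nil [simp]: "sites [] = {}" and finite_sites [simp]: "finite (sites l)"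
  by (auto simp: sites_def)

definition Q_prob :: "'e jumps \<Rightarrow> 'e \<Rightarrow> 'e \<Rightarrow> real" where
  "Q_prob J j k = expect (J j) (\<lambda>(y, l). of_bool (l = k))"

text \<open>
  The tail of the path drops the time \<open>0\<close>, at which the walk is at the origin by definition.
\<close>

definition no_return :: "'e jumps \<Rightarrow> nat \<Rightarrow> 'e \<Rightarrow> real" where
  "no_return J n j = expect (traj J n (0, j)) (\<lambda>l. of_bool (0 \<notin> sites (tl l)))"

definition hit_origin :: "'e jumps \<Rightarrow> nat \<Rightarrow> int \<times> 'e \<Rightarrow> real" where
  "hit_origin J n s = expect (traj J n s) (\<lambda>l. of_bool (0 \<in> sites l))"

definition mean_range :: "'e jumps \<Rightarrow> nat \<Rightarrow> 'e \<Rightarrow> real" where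
  "mean_range J n j = expect (traj J n (0, j)) (\<lambda>l. real (card (sites l)))"

lemma length_traj: "l \<in> set_pmf (traj J n s) \<Longrightarrow> length l = Suc n"
  by (induction n arbitrary: s l) auto

lemma card_sites_traj: "l \<in> set_pmf (traj J n s) \<Longrightarrow> card (sites l) \<le> Suc n"
  unfolding sites_def using length_traj[of l] by (metis card_image_le card_length le_trans List.finite_set)

text \<open>
  The same law built by appending the last step.  This form matches the Markov property of a given
  chain, and it shows that the range grows with time.
\<close>

lemma traj_snoc:
  "traj J (Suc n) s = bind_pmf (traj J n s) (\<lambda>l. map_pmf (\<lambda>t. l @ [t]) (step J (last l)))"
proof (induction n arbitrary: s)
  case 0
  show ?case by (simp add: bind_return_pmf map_pmf_def bind_assoc_pmf)
next
  case (Suc n)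
  have "traj J (Suc (Suc n)) s = bind_pmf (step J s) (\<lambda>t. map_pmf ((#) s) (traj J (Suc n) t))" by simp
  also have "\<dots> = bind_pmf (step J s) (\<lambda>t. bind_pmf (traj J n t) (\<lambda>l. map_pmf (\<lambda>u. s # l @ [u]) (step J (last l))))"
    by (subst Suc) (simp add: map_bind_pmf map_pmf_comp)
  also have "\<dots> = bind_pmf (step J s) (\<lambda>t. bind_pmf (traj J n t) (\<lambda>l. map_pmf (\<lambda>u. (s # l) @ [u]) (step J (last (s # l)))))"
    by (intro bind_pmf_cong refl) (auto dest: length_traj)
  also have "\<dots> = bind_pmf (traj J (Suc n) s) (\<lambda>l. map_pmf (\<lambda>t. l @ [t]) (step J (last l)))"
    by (simp add: bind_assoc_pmf bind_map_pmf)
  finally show ?case .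
qed

lemma step_translate: "step J (x, j) = map_pmf (\<lambda>(y, k). (x + y, k)) (step J (0, j))"
  by (simp add: step_def map_pmf_comp case_prod_unfold)

lemma step_origin: "step J (0, j) = J j"
  by (simp add: step_def map_pmf_idI)

lemma walk_translate: "walk J n (x, j) = map_pmf (\<lambda>(y, k). (x + y, k)) (walk J n (0, j))"
proof (induction n arbitrary: x j)
  case (Suc n)
  have "walk J (Suc n) (x, j) = bind_pmf (J j) (\<lambda>(y, k). walk J n (x + y, k))"
    by (simp add: step_translate[of J x] step_origin bind_map_pmf case_prod_unfold)
  also have "\<dots> = bind_pmf (J j) (\<lambda>(y, k). map_pmf (\<lambda>(y, k). (x + y, k)) (walk J n (y, k)))"
  proof (intro bind_pmf_cong refl)
    fix w show "(case w of (y, k) \<Rightarrow> walk J n (x + y, k)) =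
       (case w of (y, k) \<Rightarrow> map_pmf (\<lambda>(y, k). (x + y, k)) (walk J n (y, k)))"
    proof (cases w)
      case (Pair y k)
      show ?thesis unfolding Pair prod.case
        by (subst Suc[of "x + y" k], subst Suc[of y k]) (simp add: map_pmf_comp case_prod_unfold add_ac)
    qed
  qed
  also have "\<dots> = map_pmf (\<lambda>(y, k). (x + y, k)) (walk J (Suc n) (0, j))"
    by (simp add: step_origin map_bind_pmf case_prod_unfold)
  finally show ?case .
qed simp

lemma traj_translate: "traj J n (x, j) = map_pmf (map (\<lambda>(y, k). (x + y, k))) (traj J n (0, j))"
proof (induction n arbitrary: x j)
  case (Suc n)
  have "traj J (Suc n) (x, j) = bind_pmf (J j) (\<lambda>(y, k). map_pmf ((#) (x, j)) (traj J n (x + y, k)))"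
    by (simp add: step_translate[of J x] step_origin bind_map_pmf case_prod_unfold)
  also have "\<dots> = bind_pmf (J j) (\<lambda>(y, k). map_pmf (map (\<lambda>(y, k). (x + y, k))) (map_pmf ((#) (0, j)) (traj J n (y, k))))"
  proof (intro bind_pmf_cong refl)
    fix w show "(case w of (y, k) \<Rightarrow> map_pmf ((#) (x, j)) (traj J n (x + y, k))) =
       (case w of (y, k) \<Rightarrow> map_pmf (map (\<lambda>(y, k). (x + y, k))) (map_pmf ((#) (0, j)) (traj J n (y, k))))"
    proof (cases w)
      case (Pair y k)
      show ?thesis unfolding Pair prod.case
        by (subst Suc[of "x + y" k], subst Suc[of y k]) (simp add: map_pmf_comp case_prod_unfold add_ac o_def)
    qed
  qed
  also have "\<dots> = map_pmf (map (\<lambda>(y, k). (x + y, k))) (traj J (Suc n) (0, j))"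
    by (simp add: step_origin map_bind_pmf case_prod_unfold)
  finally show ?case .
qed simp

lemma mean_range_translate:
  "expect (traj J n s) (\<lambda>l. real (card (sites l))) = mean_range J n (snd s)"
proof -
  have "card (sites (map (\<lambda>(y, k). (x + y, k)) l)) = card (sites l)" for x :: int and l :: "(int \<times> 'a) list"
  proof -
    have "sites (map (\<lambda>(y, k). (x + y, k)) l) = (+) x ` sites l"
      by (force simp: sites_def image_image case_prod_unfold)
    then show ?thesis by (simp add: card_image)
  qed
  then show ?thesis
    unfolding mean_range_def
    by (cases s, simp only: snd_conv, subst traj_translate) simp
qed

lemma mean_range_0 [simp]: "mean_range J 0 j = 1"
  by (simp add: mean_range_def)

lemma no_return_0 [simp]: "no_return J 0 j = 1"
  by (simp add: no_return_def)

lemma no_return_Suc: "no_return J (Suc n) j = 1 - expect (J j) (hit_origin J n)"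
proof -
  have "no_return J (Suc n) j = expect (J j)
     (\<lambda>t. expect (traj J n t) (\<lambda>l. of_bool (0 \<notin> sites l)))"
    unfolding no_return_def by (simp add: step_origin, subst expectation_bind_real[where B = 1]) auto
  also have "\<dots> = expect (J j) (\<lambda>t. 1 - hit_origin J n t)"
  proof (rule Bochner_Integration.integral_cong[OF refl])
    fix t
    have "expect (traj J n t) (\<lambda>l. of_bool (0 \<notin> sites l)) =
       expect (traj J n t) (\<lambda>l. 1 - of_bool (0 \<in> sites l) :: real)"
      by (rule Bochner_Integration.integral_cong) auto
    also have "\<dots> = 1 - hit_origin J n t"
      unfolding hit_origin_def by (subst Bochner_Integration.integral_diff) (auto intro!: integrable_bounded_pmf[where B = 1])
    finally show "expect (traj J n t) (\<lambda>l. of_bool (0 \<notin> sites l)) = 1 - hit_origin J n t" .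
  qed
  also have "\<dots> = 1 - expect (J j) (hit_origin J n)"
  proof (subst Bochner_Integration.integral_diff)
    show "integrable (J j) (hit_origin J n)"
      by (rule integrable_bounded_pmf[where B = 1])
        (auto simp: hit_origin_def abs_le_iff intro!: measure_pmf.integral_le_const integrable_bounded_pmf[where B = 1] order_trans[OF _ Bochner_Integration.integral_nonneg])
  qed auto
  finally show ?thesis .
qed

lemma hit_origin_bounds: "0 \<le> hit_origin J n s" "hit_origin J n s \<le> 1"
  unfolding hit_origin_def
  by (auto intro!: measure_pmf.integral_le_const integrable_bounded_pmf[where B = 1])

lemma no_return_bounds: "0 \<le> no_return J n j" "no_return J n j \<le> 1"
  unfolding no_return_def
  by (auto intro!: measure_pmf.integral_le_const integrable_bounded_pmf[where B = 1])

lemma hit_origin_0: "hit_origin J 0 s = of_bool (fst s = 0)"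
  by (auto simp: hit_origin_def)

lemma hit_origin_Suc:
  "hit_origin J (Suc n) s = (if fst s = 0 then 1 else expect (step J s) (hit_origin J n))"
proof -
  have "hit_origin J (Suc n) s = expect (step J s)
     (\<lambda>t. expect (traj J n t) (\<lambda>l. of_bool (0 = fst s \<or> 0 \<in> sites l)))"
    unfolding hit_origin_def traj.simps by (subst expectation_bind_real[where B = 1]) simp_all
  then show ?thesis by (auto simp: hit_origin_def [abs_def])
qed

text \<open>
  The summand for \<open>k\<close> and \<open>i\<close> is the probability that the last visit to the origin up to time \<open>n\<close>
  happens at time \<open>k\<close> in the state \<open>i\<close>.  Both sides satisfy the same first-step recursion.
\<close>

lemma hit_origin_last_visit:
  fixes J :: "'e::finite jumps"
  shows "hit_origin J n s = (\<Sum>k\<le>n. \<Sum>i\<in>UNIV. pmf (walk J k s) (0, i) * no_return J (n - k) i)"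
proof (induction n arbitrary: s)
  case 0
  have "(\<Sum>i\<in>UNIV. pmf (return_pmf s) (0, i)) = of_bool (fst s = 0)"
    by (cases s) (auto simp: pmf_return of_bool_def indicator_def)
  then show ?case by (simp add: hit_origin_0)
next
  case (Suc n)
  have "(\<Sum>i\<in>UNIV. pmf (return_pmf s) (0, i) * no_return J (Suc n) i) = of_bool (fst s = 0) * no_return J (Suc n) (snd s)"
    by (cases s) (auto simp: pmf_return of_bool_def indicator_def if_distrib if_distribR cong: if_cong)
  then have "(\<Sum>k\<le>Suc n. \<Sum>i\<in>UNIV. pmf (walk J k s) (0, i) * no_return J (Suc n - k) i) =
    of_bool (fst s = 0) * no_return J (Suc n) (snd s) +
    (\<Sum>k\<le>n. \<Sum>i\<in>UNIV. expect (step J s) (\<lambda>t. pmf (walk J k t) (0, i)) * no_return J (n - k) i)"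
    by (subst sum.atMost_Suc_shift) (simp add: pmf_bind)
  also have "(\<Sum>k\<le>n. \<Sum>i\<in>UNIV. expect (step J s) (\<lambda>t. pmf (walk J k t) (0, i)) * no_return J (n - k) i)
     = expect (step J s) (\<lambda>t. \<Sum>k\<le>n. \<Sum>i\<in>UNIV. pmf (walk J k t) (0, i) * no_return J (n - k) i)"
    by (subst Bochner_Integration.integral_sum integral_mult_left_zero [symmetric]
         | intro sum.cong refl Bochner_Integration.integrable_sum integrable_mult_left integrable_bounded_pmf[where B = 1]
         | simp add: pmf_le_1)+
  also have "\<dots> = expect (step J s) (hit_origin J n)"
    by (rule Bochner_Integration.integral_cong[OF refl]) (simp only: Suc)
  also have "of_bool (fst s = 0) * no_return J (Suc n) (snd s) + \<dots> = hit_origin J (Suc n) s"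
    using step_origin[of J "snd s"] by (cases s) (auto simp: hit_origin_Suc no_return_Suc)
  finally show ?case by simp
qed

lemma last_visit_decomposition:
  fixes J :: "'e::finite jumps"
  shows "(\<Sum>k\<le>n. \<Sum>i\<in>UNIV. pmf (walk J k (0, j)) (0, i) * no_return J (n - k) i) = 1"
proof -
  have "hit_origin J n (0, j) = 1" by (cases n) (simp_all add: hit_origin_0 hit_origin_Suc)
  then show ?thesis by (simp add: hit_origin_last_visit)
qed

lemma mean_range_bounds: "0 \<le> mean_range J n j" "mean_range J n j \<le> real (Suc n)"
  unfolding mean_range_def
  by (auto intro!: measure_pmf.integral_le_const integrable_bounded_pmf[where B = "real (Suc n)"]
     simp: AE_measure_pmf_iff simp del: of_nat_Suc dest!: card_sites_traj)

text \<open>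
  The starting site is a new one for the rest of the path exactly if the walk does not return to it.
  Counting it separately leaves the range of the path after the first step, which by translation
  invariance depends on that step through the internal state only.
\<close>

lemma mean_range_Suc:
  fixes J :: "'e::finite jumps"
  shows "mean_range J (Suc n) j = no_return J (Suc n) j + (\<Sum>k\<in>UNIV. Q_prob J j k * mean_range J n k)"
proof -
  have b: "\<bar>real (card (sites l))\<bar> \<le> real (Suc (Suc n))" if "l \<in> set_pmf (traj J (Suc n) s)" for l s
    using card_sites_traj[OF that] by simp
  have "mean_range J (Suc n) j = expect (J j) (\<lambda>t. expect (traj J n t)
     (\<lambda>l. real (card (insert 0 (sites l)))))"
    unfolding mean_range_def traj.simps
    by (subst expectation_bind_real[OF b[of _ "(0, j)"]]) (simp_all add: step_origin)
  also have "\<dots> = expect (J j) (\<lambda>t. (1 - hit_origin J n t) + mean_range J n (snd t))"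
  proof (rule Bochner_Integration.integral_cong[OF refl])
    fix t
    have "expect (traj J n t) (\<lambda>l. real (card (insert 0 (sites l)))) =
      expect (traj J n t) (\<lambda>l. (1 - of_bool (0 \<in> sites l)) + real (card (sites l)))"
      by (rule Bochner_Integration.integral_cong) (auto simp: card_insert_if)
    also have "\<dots> = (1 - hit_origin J n t) + mean_range J n (snd t)"
      unfolding hit_origin_def mean_range_translate[symmetric]
    proof (subst Bochner_Integration.integral_add)
      show "integrable (measure_pmf (traj J n t)) (\<lambda>l. real (card (sites l)))"
        by (rule integrable_bounded_pmf[where B = "real (Suc n)"]) (simp del: of_nat_Suc add: card_sites_traj)
      show "integrable (measure_pmf (traj J n t)) (\<lambda>l. 1 - of_bool (0 \<in> sites l) :: real)"
        by (rule integrable_bounded_pmf[where B = 1]) auto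
      show "expect (traj J n t) (\<lambda>l. 1 - of_bool (0 \<in> sites l)) +
          expect (traj J n t) (\<lambda>l. real (card (sites l))) =
          1 - expect (traj J n t) (\<lambda>l. of_bool (0 \<in> sites l)) +
          expect (traj J n t) (\<lambda>l. real (card (sites l)))"
        by (subst Bochner_Integration.integral_diff) (auto intro!: integrable_bounded_pmf[where B = 1])
    qed
    finally show "expect (traj J n t) (\<lambda>l. real (card (insert 0 (sites l)))) =
       (1 - hit_origin J n t) + mean_range J n (snd t)" .
  qed
  also have "\<dots> = no_return J (Suc n) j + expect (J j) (\<lambda>t. mean_range J n (snd t))"
    unfolding no_return_Suc
  proof (subst Bochner_Integration.integral_add)
    show "integrable (J j) (\<lambda>t. mean_range J n (snd t))"
      using mean_range_bounds[of J n] by (intro integrable_bounded_pmf[where B = "real (Suc n)"]) (simp del: of_nat_Suc)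
    have *: "integrable (J j) (hit_origin J n)"
      using hit_origin_bounds[of J n] by (intro integrable_bounded_pmf[where B = 1]) auto
    then show "integrable (J j) (\<lambda>t. 1 - hit_origin J n t)" by auto
    show "expect (J j) (\<lambda>t. 1 - hit_origin J n t) + expect (J j) (\<lambda>t. mean_range J n (snd t)) =
      1 - expect (J j) (hit_origin J n) + expect (J j) (\<lambda>t. mean_range J n (snd t))"
      by (subst Bochner_Integration.integral_diff[OF _ *]) auto
  qed
  also have "expect (J j) (\<lambda>t. mean_range J n (snd t)) = (\<Sum>k\<in>UNIV. Q_prob J j k * mean_range J n k)"
    using expectation_split_state[of "\<lambda>y k. mean_range J n k" "real (Suc n)" "J j"] mean_range_bounds[of J n]
    by (simp add: case_prod_unfold Q_prob_def mult.commute del: of_nat_Suc)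
  finally show ?thesis .
qed

lemma mean_range_mono: "mean_range J n j \<le> mean_range J (Suc n) j"
proof -
  have b: "\<bar>real (card (sites l))\<bar> \<le> real (Suc (Suc n))" if "l \<in> set_pmf (traj J (Suc n) s)" for l s
    using card_sites_traj[OF that] by simp
  have bd: "card (sites l \<union> {x}) \<le> Suc (Suc n)" if "l \<in> set_pmf (traj J n s)" for l s x
    using card_sites_traj[OF that] by (simp add: card_insert_if)
  have "mean_range J (Suc n) j = expect (traj J n (0, j))
     (\<lambda>l. expect (step J (last l)) (\<lambda>t. real (card (sites (l @ [t])))))"
    unfolding mean_range_def traj_snoc
    by (subst expectation_bind_real[OF b[of _ "(0, j)", unfolded traj_snoc]]) simp_all
  also have "\<dots> \<ge> expect (traj J n (0, j)) (\<lambda>l. real (card (sites l)))"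
  proof (rule integral_mono_AE)
    show "integrable (measure_pmf (traj J n (0, j))) (\<lambda>l. real (card (sites l)))"
      by (rule integrable_bounded_pmf[where B = "real (Suc n)"]) (simp del: of_nat_Suc add: card_sites_traj)
    show "integrable (measure_pmf (traj J n (0, j)))
       (\<lambda>l. expect (step J (last l)) (\<lambda>t. real (card (sites (l @ [t])))))"
    proof (rule integrable_bounded_pmf[where B = "real (Suc (Suc n))"])
      fix l assume l: "l \<in> set_pmf (traj J n (0, j))"
      have "expect (step J (last l)) (\<lambda>t. real (card (sites (l @ [t])))) \<le> real (Suc (Suc n))"
        using bd[OF l] by (intro measure_pmf.integral_le_const integrable_bounded_pmf[where B = "real (Suc (Suc n))"])
           (auto simp del: of_nat_Suc Un_insert_right)
      then show "norm (expect (step J (last l)) (\<lambda>t. real (card (sites (l @ [t]))))) \<le> real (Suc (Suc n))"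
        by (simp add: abs_le_iff integral_nonneg_AE order_trans[OF _ integral_nonneg_AE] del: sites_append)
    qed
    show "AE l in traj J n (0, j). real (card (sites l)) \<le> expect (step J (last l)) (\<lambda>t. real (card (sites (l @ [t]))))"
      unfolding AE_measure_pmf_iff
    proof
      fix l assume l: "l \<in> set_pmf (traj J n (0, j))"
      show "real (card (sites l)) \<le> expect (step J (last l)) (\<lambda>t. real (card (sites (l @ [t]))))"
        using bd[OF l] by (intro measure_pmf.integral_ge_const integrable_bounded_pmf[where B = "real (Suc (Suc n))"])
           (auto simp del: of_nat_Suc Un_insert_right intro!: card_mono)
    qed
  qed
  finally show ?thesis unfolding mean_range_def .
qed

section \<open>Characteristic functions and Fourier inversion\<close>

definition jump_char :: "'e jumps \<Rightarrow> real \<Rightarrow> 'e \<Rightarrow> 'e \<Rightarrow> complex" where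
  "jump_char J t j k = expect (J j) (\<lambda>(y, l). cis (t * of_int y) * of_bool (l = k))"

definition walk_char :: "'e jumps \<Rightarrow> real \<Rightarrow> nat \<Rightarrow> 'e \<Rightarrow> 'e \<Rightarrow> complex" where
  "walk_char J t n j k = expect (walk J n (0, j)) (\<lambda>(y, l). cis (t * of_int y) * of_bool (l = k))"

lemma walk_char_0 [simp]: "walk_char J t 0 j k = of_bool (j = k)"
  by (simp add: walk_char_def)

text \<open>
  The characteristic functions of the walk are the entries of the powers of the matrix \<open>\<alpha>(t)\<close> given by
  \<open>jump_char\<close>.
\<close>

lemma walk_char_Suc:
  fixes J :: "'e::finite jumps"
  shows "walk_char J t (Suc n) j k = (\<Sum>i\<in>UNIV. jump_char J t j i * walk_char J t n i k)"
proof -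
  let ?g = "\<lambda>(y, l). cis (t * of_int y) * of_bool (l = k)"
  have shift: "expect (walk J n (y, i)) ?g = cis (t * of_int y) * walk_char J t n i k" for y i
  proof -
    have "expect (walk J n (y, i)) ?g
        = expect (walk J n (0, i)) (\<lambda>w. cis (t * of_int y) * ?g w)"
      by (subst walk_translate) (simp add: case_prod_unfold cis_mult [symmetric] algebra_simps)
    then show ?thesis by (simp add: walk_char_def)
  qed
  have "walk_char J t (Suc n) j k
      = expect (J j) (\<lambda>w. expect (walk J n w) ?g)"
    unfolding walk_char_def walk.simps
    by (subst expectation_bind_complex[where B = 1]) (auto simp: norm_mult step_origin)
  also have "\<dots> = expect (J j) (\<lambda>(y, i). cis (t * of_int y) * walk_char J t n i k)"
    by (rule Bochner_Integration.integral_cong) (auto simp: shift)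
  also have "\<dots> = (\<Sum>i\<in>UNIV. expect (J j) (\<lambda>(y, l). (cis (t * of_int y) * walk_char J t n i k) * of_bool (l = i)))"
    by (rule expectation_split_state[where B = "Max (range (\<lambda>i. norm (walk_char J t n i k)))"]) (simp add: norm_mult)
  also have "\<dots> = (\<Sum>i\<in>UNIV. jump_char J t j i * walk_char J t n i k)"
    unfolding jump_char_def by (simp add: case_prod_unfold mult_ac flip: integral_mult_right_zero)
  finally show ?thesis .
qed

lemma norm_walk_char_le: "norm (walk_char J t n j k) \<le> 1"
proof -
  have "norm (walk_char J t n j k) \<le> expect (walk J n (0, j)) (\<lambda>w. norm (case w of (y, l) \<Rightarrow> cis (t * of_int y) * of_bool (l = k)))"
    unfolding walk_char_def by (rule integral_norm_bound)
  also have "\<dots> \<le> 1"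
    by (rule measure_pmf.integral_le_const) (auto intro!: integrable_bounded_pmf[where B = 1] simp: norm_mult)
  finally show ?thesis .
qed

lemma continuous_jump_char: "continuous_on UNIV (\<lambda>t. jump_char J t j k)"
proof (rule continuous_at_imp_continuous_on, intro ballI continuous_at_sequentiallyI)
  fix t and s :: "nat \<Rightarrow> real" assume s: "s \<longlonglongrightarrow> t"
  show "(\<lambda>n. jump_char J (s n) j k) \<longlonglongrightarrow> jump_char J t j k"
    unfolding jump_char_def
    by (rule integral_dominated_convergence[where w = "\<lambda>_. 1"])
       (auto simp: norm_mult intro!: AE_I2 tendsto_intros s)
qed

lemma continuous_walk_char:
  fixes J :: "'e::finite jumps"
  shows "continuous_on UNIV (\<lambda>t. walk_char J t n j k)"
  by (induction n arbitrary: j) (simp_all add: walk_char_Suc, intro continuous_intros continuous_jump_char)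

text \<open>
  Lebesgue measure on one period, without normalisation.
\<close>

definition circle :: "real measure" where
  "circle = restrict_space lborel {-pi..pi}"

lemma space_circle: "space circle = {-pi..pi}"
  by (simp add: circle_def space_restrict_space)

lemma finite_measure_circle: "finite_measure circle"
  by (rule finite_measureI) (simp add: circle_def space_restrict_space emeasure_restrict_space)

lemma measure_circle: "measure circle (space circle) = 2 * pi"
  by (simp add: circle_def space_restrict_space measure_restrict_space)

lemma borel_measurable_circle [measurable]: "f \<in> borel_measurable borel \<Longrightarrow> f \<in> borel_measurable circle"
  unfolding circle_def by (rule measurable_restrict_space1) simp

lemma integral_circle_continuous:
  fixes f :: "real \<Rightarrow> 'b::euclidean_space"
  assumes "continuous_on UNIV f"
  shows "integral\<^sup>L circle f = integral {-pi..pi} f" "integrable circle f"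
proof -
  have "set_integrable lborel {-pi..pi} f"
    unfolding set_integrable_def
    using borel_integrable_compact[of "{-pi..pi}" f] assms continuous_on_subset by auto
  then show "integral\<^sup>L circle f = integral {-pi..pi} f" "integrable circle f"
    unfolding circle_def using set_borel_integral_eq_integral(2)[of "{-pi..pi}" f]
    by (simp_all add: integral_restrict_space integrable_restrict_space set_integrable_def set_lebesgue_integral_def)
qed

lemma integral_circle_cis: "(LINT t|circle. cis (t * of_int y)) = 2 * pi * of_bool (y = 0)"
proof (cases "y = 0")
  case True
  then show ?thesis using measure_circle by (simp add: scaleR_conv_of_real)
next
  case False
  have "((\<lambda>t. cis (t * of_int y)) has_integral (cis (pi * of_int y) / (\<i> * of_int y) - cis (- pi * of_int y) / (\<i> * of_int y))) {-pi..pi}"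
  proof (rule fundamental_theorem_of_calculus)
    fix t :: real
    have "((\<lambda>w. exp (\<i> * of_int y * w) / (\<i> * of_int y)) has_field_derivative exp (\<i> * of_int y * of_real t)) (at (of_real t))"
      using False by (auto intro!: derivative_eq_intros)
    then have "((\<lambda>t. exp (\<i> * of_int y * of_real t) / (\<i> * of_int y)) has_vector_derivative exp (\<i> * of_int y * of_real t)) (at t within {-pi..pi})"
      by (rule has_vector_derivative_real_field)
    then show "((\<lambda>t. cis (t * of_int y) / (\<i> * of_int y)) has_vector_derivative cis (t * of_int y)) (at t within {-pi..pi})"
      by (simp add: cis_conv_exp mult_ac)
  qed simp
  moreover have "cis (pi * of_int y) = cis (- pi * of_int y)"
    by (rule complex_eqI) (auto simp: sin_times_pi_eq_0 mult.commute)
  ultimately have "integral {-pi..pi} (\<lambda>t. cis (t * of_int y)) = 0" by (simp add: integral_unique)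
  then show ?thesis using False
    by (subst integral_circle_continuous) (auto intro!: continuous_intros)
qed

lemma fourier_inversion:
  fixes J :: "'e::finite jumps"
  shows "(LINT t|circle. walk_char J t n j k) = 2 * pi * pmf (walk J n (0, j)) (0, k)"
proof -
  interpret C: finite_measure circle by (rule finite_measure_circle)
  interpret P: pair_sigma_finite "measure_pmf (walk J n (0, j))" circle ..
  have fin: "finite_measure (measure_pmf (walk J n (0, j)) \<Otimes>\<^sub>M circle)"
    by (rule finite_measure_pair_measure) (unfold_locales)
  have int: "integrable (measure_pmf (walk J n (0, j)) \<Otimes>\<^sub>M circle) (\<lambda>(w, t). cis (t * of_int (fst w)) * of_bool (snd w = k))"
  proof (rule finite_measure.integrable_const_bound[OF fin, where B = 1])
    show "(\<lambda>(w, t). cis (t * of_int (fst w)) * of_bool (snd w = k)) \<in> borel_measurable (measure_pmf (walk J n (0, j)) \<Otimes>\<^sub>M circle)"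
    proof -
      have 1: "(\<lambda>(w, t). cis (t * of_int (fst w)) * of_bool (snd w = k)) \<in> borel_measurable (count_space UNIV \<Otimes>\<^sub>M circle)"
      proof (rule measurable_pair_measure_countable1)
        fix w :: "int \<times> 'e"
        have "(\<lambda>t. cis (t * of_int (fst w)) * of_bool (snd w = k)) \<in> borel_measurable borel"
          by (intro borel_measurable_continuous_onI continuous_intros)
        then show "(\<lambda>t. case (w, t) of (w, t) \<Rightarrow> cis (t * of_int (fst w)) * of_bool (snd w = k)) \<in> borel_measurable circle"
          unfolding prod.case by (rule borel_measurable_circle)
      qed simp
      have 2: "sets (measure_pmf (walk J n (0, j)) \<Otimes>\<^sub>M circle) = sets (count_space UNIV \<Otimes>\<^sub>M circle)"
        by (intro sets_pair_measure_cong) auto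
      show ?thesis using 1 unfolding measurable_cong_sets[OF 2 refl] .
    qed
  qed (auto simp: norm_mult intro!: AE_I2)
  have "(LINT t|circle. walk_char J t n j k)
     = (\<integral>t. (\<integral>w. cis (t * of_int (fst w)) * of_bool (snd w = k) \<partial>walk J n (0, j)) \<partial>circle)"
    by (simp add: walk_char_def case_prod_unfold)
  also have "\<dots> = (\<integral>w. (\<integral>t. cis (t * of_int (fst w)) * of_bool (snd w = k) \<partial>circle) \<partial>walk J n (0, j))"
    by (rule P.Fubini_integral[OF int])
  also have "\<dots> = (\<integral>w. complex_of_real (2 * pi * indicator {(0, k)} w) \<partial>walk J n (0, j))"
    by (rule Bochner_Integration.integral_cong) (auto simp: integral_circle_cis indicator_def)
  also have "\<dots> = complex_of_real (2 * pi * (\<integral>w. indicator {(0, k)} w \<partial>walk J n (0, j)))"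
    by (simp only: integral_complex_of_real integral_mult_right_zero)
  also have "(\<integral>w. indicator {(0, k)} w \<partial>walk J n (0, j)) = pmf (walk J n (0, j)) (0, k)"
    by (simp add: measure_pmf_single)
  finally show ?thesis by simp
qed

definition green :: "'e jumps \<Rightarrow> real \<Rightarrow> 'e \<Rightarrow> 'e \<Rightarrow> real" where
  "green J z j k = (\<Sum>n. pmf (walk J n (0, j)) (0, k) * z ^ n)"

text \<open>
  For fixed \<open>z\<close> and \<open>t\<close> this is the resolvent \<open>(1 - z \<alpha>(t))\<^sup>-\<^sup>1\<close>.  The equation for its columns is
  \<open>green_char_eq\<close>.
\<close>

definition green_char :: "'e jumps \<Rightarrow> real \<Rightarrow> real \<Rightarrow> 'e \<Rightarrow> 'e \<Rightarrow> complex" where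
  "green_char J z t j k = (\<Sum>n. walk_char J t n j k * of_real z ^ n)"

lemma summable_green_char:
  assumes "0 \<le> z" "z < 1"
  shows "summable (\<lambda>n. walk_char J t n j k * of_real z ^ n)"
proof (rule summable_comparison_test')
  show "summable (\<lambda>n. z ^ n)" using assms by (intro summable_geometric) auto
  show "norm (walk_char J t n j k * of_real z ^ n) \<le> z ^ n" for n
    using mult_right_mono[OF norm_walk_char_le, of "z ^ n" J t n j k] assms by (simp add: norm_mult norm_power)
qed

lemma green_char_eq:
  fixes J :: "'e::finite jumps"
  assumes z: "0 \<le> z" "z < 1"
  shows "green_char J z t j k = of_bool (j = k) + of_real z * (\<Sum>i\<in>UNIV. jump_char J t j i * green_char J z t i k)"
proof -
  have "green_char J z t j k = of_bool (j = k) + (\<Sum>n. walk_char J t (Suc n) j k * of_real z ^ Suc n)"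
    unfolding green_char_def using suminf_split_head[OF summable_green_char[OF z, of J t j k]] by simp
  also have "(\<Sum>n. walk_char J t (Suc n) j k * of_real z ^ Suc n)
      = (\<Sum>n. \<Sum>i\<in>UNIV. of_real z * jump_char J t j i * (walk_char J t n i k * of_real z ^ n))"
    by (simp add: walk_char_Suc sum_distrib_left sum_distrib_right mult_ac)
  also have "\<dots> = (\<Sum>i\<in>UNIV. \<Sum>n. of_real z * jump_char J t j i * (walk_char J t n i k * of_real z ^ n))"
    by (intro suminf_sum summable_mult summable_green_char z)
  also have "\<dots> = of_real z * (\<Sum>i\<in>UNIV. jump_char J t j i * green_char J z t i k)"
    unfolding green_char_def by (subst suminf_mult[OF summable_green_char[OF z]]) (simp add: sum_distrib_left mult_ac)
  finally show ?thesis .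
qed

lemma green_fourier:
  fixes J :: "'e::finite jumps"
  assumes z: "0 \<le> z" "z < 1"
  shows "(LINT t|circle. green_char J z t j k) = 2 * pi * green J z j k"
    and "integrable circle (\<lambda>t. green_char J z t j k)"
proof -
  interpret C: finite_measure circle by (rule finite_measure_circle)
  let ?f = "\<lambda>n t. walk_char J t n j k * of_real z ^ n"
  have geo: "summable (\<lambda>n. z ^ n)" using z by (intro summable_geometric) auto
  have int: "integrable circle (?f n)" for n
    by (intro integral_circle_continuous continuous_intros continuous_walk_char)
  have le: "norm (?f n t) \<le> z ^ n" for n t
    using mult_right_mono[OF norm_walk_char_le, of "z ^ n" J t n j k] z by (simp add: norm_mult norm_power)
  have s1: "summable (\<lambda>n. norm (?f n t))" for t
    by (rule summable_comparison_test'[OF geo]) (use le in auto)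
  have s2: "summable (\<lambda>n. \<integral>t. norm (?f n t) \<partial>circle)"
  proof (rule summable_comparison_test'[OF summable_mult[OF geo, of "2 * pi"]])
    fix n
    have "(\<integral>t. norm (?f n t) \<partial>circle) \<le> (\<integral>t. z ^ n \<partial>circle)"
      by (rule integral_mono) (use le int in auto)
    then show "norm (\<integral>t. norm (?f n t) \<partial>circle) \<le> 2 * pi * z ^ n"
      by (simp add: measure_circle mult.commute)
  qed
  have "(LINT t|circle. green_char J z t j k) = (\<Sum>n. integral\<^sup>L circle (?f n))"
    unfolding green_char_def by (rule integral_suminf) (use int s1 s2 in auto)
  also have "\<dots> = (\<Sum>n. complex_of_real (2 * pi * (pmf (walk J n (0, j)) (0, k) * z ^ n)))"
    by (simp add: fourier_inversion mult_ac)
  also have "\<dots> = complex_of_real (\<Sum>n. 2 * pi * (pmf (walk J n (0, j)) (0, k) * z ^ n))"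
  proof (rule suminf_of_real [symmetric])
    show "summable (\<lambda>n. 2 * pi * (pmf (walk J n (0, j)) (0, k) * z ^ n))"
      by (intro summable_mult summable_comparison_test'[OF geo])
         (use z in \<open>auto simp: abs_mult intro!: mult_left_le_one_le pmf_le_1\<close>)
  qed
  also have "(\<Sum>n. 2 * pi * (pmf (walk J n (0, j)) (0, k) * z ^ n)) = 2 * pi * green J z j k"
    unfolding green_def
    by (intro suminf_mult summable_comparison_test'[OF geo])
       (use z in \<open>auto simp: abs_mult intro!: mult_left_le_one_le pmf_le_1\<close>)
  finally show "(LINT t|circle. green_char J z t j k) = 2 * pi * green J z j k" by simp
  show "integrable circle (\<lambda>t. green_char J z t j k)"
    unfolding green_char_def by (rule integrable_suminf) (use int s1 s2 in auto)
qed

section \<open>The fundamental matrix of an irreducible chain\<close>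

lemma sum_of_bool:
  fixes f :: "'e::finite \<Rightarrow> 'b::semiring_1"
  shows "(\<Sum>k\<in>UNIV. of_bool (j = k) * f k) = f j" "(\<Sum>k\<in>UNIV. f k * of_bool (k = j)) = f j"
  by (simp_all add: of_bool_def if_distrib if_distribR cong: if_cong)

lemma sum_of_bool_complex:
  fixes f :: "'e::finite \<Rightarrow> complex"
  shows "(\<Sum>k\<in>UNIV. complex_of_real (of_bool (j = k)) * f k) = f j"
  by (simp add: of_bool_def if_distrib if_distribR cong: if_cong)

text \<open>
  Irreducibility in the form in which it is used: a nonempty set of states that cannot be left is
  everything.
\<close>

locale irreducible_chain =
  fixes Q :: "'e::finite \<Rightarrow> 'e \<Rightarrow> real" and \<mu> :: "'e \<Rightarrow> real"
  assumes Q_nonneg: "\<And>j k. Q j k \<ge> 0" and Q_sum: "\<And>j. (\<Sum>k\<in>UNIV. Q j k) = 1"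
    and mu_nonneg: "\<And>j. \<mu> j \<ge> 0" and mu_sum: "(\<Sum>j\<in>UNIV. \<mu> j) = 1"
    and mu_Q: "\<And>k. (\<Sum>j\<in>UNIV. \<mu> j * Q j k) = \<mu> k"
    and irred: "\<And>A. A \<noteq> {} \<Longrightarrow> (\<And>j k. j \<in> A \<Longrightarrow> Q j k > 0 \<Longrightarrow> k \<in> A) \<Longrightarrow> A = UNIV"
begin

lemma mu_sum_Q: "(\<Sum>j\<in>UNIV. \<mu> j * (\<Sum>k\<in>UNIV. Q j k * f k)) = (\<Sum>k\<in>UNIV. \<mu> k * f k)"
proof -
  have "(\<Sum>j\<in>UNIV. \<mu> j * (\<Sum>k\<in>UNIV. Q j k * f k)) = (\<Sum>k\<in>UNIV. (\<Sum>j\<in>UNIV. \<mu> j * Q j k) * f k)"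
    by (simp add: sum_distrib_left sum_distrib_right mult_ac) (rule sum.swap)
  then show ?thesis by (simp add: mu_Q)
qed

lemma mu_pos: "\<mu> k > 0"
proof -
  have "{k. \<mu> k > 0} = UNIV"
  proof (rule irred)
    show "{k. \<mu> k > 0} \<noteq> {}"
    proof
      assume "{k. \<mu> k > 0} = {}"
      then have "\<mu> k = 0" for k using mu_nonneg[of k] by (auto simp: less_le)
      then show False using mu_sum by simp
    qed
    fix j k assume "j \<in> {k. \<mu> k > 0}" "Q j k > 0"
    then have "0 < \<mu> j * Q j k" by simp
    also have "\<dots> \<le> (\<Sum>j\<in>UNIV. \<mu> j * Q j k)"
      by (rule member_le_sum) (auto intro: mult_nonneg_nonneg mu_nonneg Q_nonneg)
    finally show "k \<in> {k. \<mu> k > 0}" by (simp add: mu_Q)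
  qed
  then show ?thesis by auto
qed

lemma mu_le_1: "\<mu> k \<le> 1"
  using member_le_sum[of k UNIV \<mu>] mu_nonneg mu_sum by simp

text \<open>
  The maximum principle: the states where \<open>f\<close> attains its maximum cannot be left.
\<close>

lemma harmonic_constant:
  assumes f: "\<And>j. f j = (\<Sum>k\<in>UNIV. Q j k * f k)"
  shows "f j = f k"
proof -
  define m where "m = Max (range f)"
  have le: "f j \<le> m" for j by (simp add: m_def)
  have "{j. f j = m} = UNIV"
  proof (rule irred)
    have "m \<in> range f" unfolding m_def by (rule Max_in) auto
    then show "{j. f j = m} \<noteq> {}" by auto
    fix j k assume j: "j \<in> {j. f j = m}" and Q: "Q j k > 0"
    have "(\<Sum>k\<in>UNIV. Q j k * (m - f k)) = m * (\<Sum>k\<in>UNIV. Q j k) - f j"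
      by (subst (2) f) (simp add: algebra_simps sum_subtractf sum_distrib_left)
    also have "\<dots> = 0" using j by (simp add: Q_sum)
    finally have "Q j k * (m - f k) = 0"
      using le Q_nonneg by (subst (asm) sum_nonneg_eq_0_iff) (auto intro!: mult_nonneg_nonneg)
    then show "k \<in> {j. f j = m}" using Q by simp
  qed
  then show ?thesis by (metis UNIV_I mem_Collect_eq)
qed

text \<open>
  The entries of \<open>T = 1 - Q + 1 \<mu>\<^sup>T\<close>, whose inverse is the fundamental matrix of the chain.  Since \<open>T\<close> fixes the vector \<open>1\<close>
  and the row \<open>\<mu>\<close>, its inverse inverts \<open>1 - Q\<close> on the complements of the one-dimensional kernels.
\<close>

abbreviation "T_entry j k \<equiv> of_bool (j = k) - Q j k + \<mu> k"

definition fundamental_inverse :: "('e \<Rightarrow> 'e \<Rightarrow> real) \<Rightarrow> bool" where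
  "fundamental_inverse R \<longleftrightarrow>
     (\<forall>j l. (\<Sum>k\<in>UNIV. R j k * T_entry k l) = of_bool (j = l)) \<and>
     (\<forall>j l. (\<Sum>k\<in>UNIV. T_entry j k * R k l) = of_bool (j = l))"

lemma fundamental_inverse_exists: "\<exists>R. fundamental_inverse R"
proof -
  define T :: "real^'e^'e" where "T = (\<chi> j k. T_entry j k)"
  have T_apply: "(\<Sum>k\<in>UNIV. T $ j $ k * f k) = f j - (\<Sum>k\<in>UNIV. Q j k * f k) + (\<Sum>k\<in>UNIV. \<mu> k * f k)" for f :: "'e \<Rightarrow> real" and j
    by (simp add: T_def distrib_right left_diff_distrib sum.distrib sum_subtractf sum_of_bool)
  have "\<forall>x. T *v x = 0 \<longrightarrow> x = 0"
  proof (intro allI impI)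
    fix x assume "T *v x = 0"
    then have z: "x $ j - (\<Sum>k\<in>UNIV. Q j k * x $ k) + (\<Sum>k\<in>UNIV. \<mu> k * x $ k) = 0" for j
      by (simp add: vec_eq_iff matrix_vector_mult_def T_apply)
    have "(\<Sum>j\<in>UNIV. \<mu> j * (x $ j - (\<Sum>k\<in>UNIV. Q j k * x $ k) + (\<Sum>k\<in>UNIV. \<mu> k * x $ k))) = (\<Sum>k\<in>UNIV. \<mu> k * x $ k)"
      by (simp add: distrib_left right_diff_distrib sum.distrib sum_subtractf mu_sum_Q sum_distrib_right [symmetric] mu_sum)
    then have m0: "(\<Sum>k\<in>UNIV. \<mu> k * x $ k) = 0" by (simp add: z)
    then have "x $ j = (\<Sum>k\<in>UNIV. Q j k * x $ k)" for j using z[of j] by simp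
    then have const: "x $ j = x $ k" for j k by (rule harmonic_constant)
    have "(\<Sum>k\<in>UNIV. \<mu> k * x $ k) = (\<Sum>k\<in>UNIV. \<mu> k * x $ j)" for j
      by (intro sum.cong refl) (metis const)
    then have "x $ j = 0" for j using m0 by (simp add: sum_distrib_right [symmetric] mu_sum)
    then show "x = 0" by (simp add: vec_eq_iff)
  qed
  then obtain B where BT: "B ** T = mat 1"
    using matrix_left_invertible_ker by blast
  then have TB: "T ** B = mat 1" by (simp add: matrix_left_right_inverse)
  have "fundamental_inverse (\<lambda>j k. B $ j $ k)"
    unfolding fundamental_inverse_def
  proof (intro conjI allI)
    fix j l
    have "(B ** T) $ j $ l = of_bool (j = l)" "(T ** B) $ j $ l = of_bool (j = l)"
      by (simp_all add: BT TB mat_def)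
    then show "(\<Sum>k\<in>UNIV. B $ j $ k * T_entry k l) = of_bool (j = l)"
      "(\<Sum>k\<in>UNIV. T_entry j k * B $ k $ l) = of_bool (j = l)"
      by (simp_all add: matrix_matrix_mult_def T_def)
  qed
  then show ?thesis by blast
qed

context
  fixes R assumes R: "fundamental_inverse R"
begin

lemma R_left: "(\<Sum>k\<in>UNIV. R j k * T_entry k l) = of_bool (j = l)"
  and R_right: "(\<Sum>k\<in>UNIV. T_entry j k * R k l) = of_bool (j = l)"
  using R by (auto simp: fundamental_inverse_def)

lemma R_sum: "(\<Sum>k\<in>UNIV. R j k) = 1"
proof -
  have "(\<Sum>l\<in>UNIV. T_entry k l) = 1" for k
    using sum_of_bool(1)[of k "\<lambda>_. 1"] by (simp add: sum.distrib sum_subtractf Q_sum mu_sum)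
  then have "(\<Sum>k\<in>UNIV. R j k) = (\<Sum>k\<in>UNIV. R j k * (\<Sum>l\<in>UNIV. T_entry k l))" by simp
  also have "\<dots> = (\<Sum>l\<in>UNIV. \<Sum>k\<in>UNIV. R j k * T_entry k l)"
    unfolding sum_distrib_left by (rule sum.swap)
  also have "\<dots> = 1" using sum_of_bool(1)[of j "\<lambda>_. 1"] by (simp add: R_left)
  finally show ?thesis .
qed

text \<open>
  How far \<open>f\<close> is from being constant is controlled by \<open>f - Q f\<close>.
\<close>

lemma fundamental_inverse_apply:
  fixes f :: "'e \<Rightarrow> complex"
  shows "f j - (\<Sum>l\<in>UNIV. of_real (\<mu> l) * f l) =
        (\<Sum>k\<in>UNIV. of_real (R j k) * (f k - (\<Sum>l\<in>UNIV. of_real (Q k l) * f l)))"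
proof -
  have Tc: "f k - (\<Sum>l\<in>UNIV. of_real (Q k l) * f l) = (\<Sum>l\<in>UNIV. of_real (T_entry k l) * f l) - (\<Sum>l\<in>UNIV. of_real (\<mu> l) * f l)" for k
    by (simp add: distrib_right left_diff_distrib sum.distrib sum_subtractf sum_of_bool_complex)
  have "(\<Sum>k\<in>UNIV. of_real (R j k) * (f k - (\<Sum>l\<in>UNIV. of_real (Q k l) * f l)))
    = (\<Sum>k\<in>UNIV. \<Sum>l\<in>UNIV. of_real (R j k * T_entry k l) * f l) - of_real (\<Sum>k\<in>UNIV. R j k) * (\<Sum>l\<in>UNIV. of_real (\<mu> l) * f l)"
  proof -
    define c where "c = (\<Sum>l\<in>UNIV. of_real (\<mu> l) * f l)"
    show ?thesis
      unfolding Tc c_def [symmetric] right_diff_distrib sum_subtractf of_real_sum sum_distrib_right [of _ _ c]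
      by (simp only: sum_distrib_left mult.assoc of_real_mult)
  qed
  also have "(\<Sum>k\<in>UNIV. \<Sum>l\<in>UNIV. of_real (R j k * T_entry k l) * f l) = (\<Sum>l\<in>UNIV. of_real (\<Sum>k\<in>UNIV. R j k * T_entry k l) * f l)"
    unfolding of_real_sum sum_distrib_right by (rule sum.swap)
  also have "\<dots> = f j" by (simp only: R_left sum_of_bool_complex)
  finally show ?thesis by (simp add: R_sum)
qed

lemma left_potential:
  assumes "(\<Sum>j\<in>UNIV. w j) = 0"
  shows "(\<Sum>j\<in>UNIV. w j * R j k) - (\<Sum>l\<in>UNIV. (\<Sum>j\<in>UNIV. w j * R j l) * Q l k) = w k"
proof -
  have nu_sum: "(\<Sum>l\<in>UNIV. \<Sum>j\<in>UNIV. w j * R j l) = 0"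
    by (subst sum.swap) (simp add: sum_distrib_left [symmetric] R_sum assms)
  have "(\<Sum>l\<in>UNIV. (\<Sum>j\<in>UNIV. w j * R j l) * T_entry l k) = (\<Sum>j\<in>UNIV. w j * (\<Sum>l\<in>UNIV. R j l * T_entry l k))"
    unfolding sum_distrib_left sum_distrib_right by (subst sum.swap) (simp only: mult.assoc)
  also have "\<dots> = w k" by (simp only: R_left sum_of_bool)
  also have "(\<Sum>l\<in>UNIV. (\<Sum>j\<in>UNIV. w j * R j l) * T_entry l k)
     = (\<Sum>j\<in>UNIV. w j * R j k) - (\<Sum>l\<in>UNIV. (\<Sum>j\<in>UNIV. w j * R j l) * Q l k) + (\<Sum>l\<in>UNIV. \<Sum>j\<in>UNIV. w j * R j l) * \<mu> k"
    by (simp only: distrib_left right_diff_distrib sum.distrib sum_subtractf sum_of_bool sum_distrib_right [symmetric])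
  finally show ?thesis by (simp only: nu_sum)
qed

end

text \<open>
  Existence and uniqueness of the solution that defines \<open>(Q - 1)\<^sup>-\<^sup>1 w\<close>.
\<close>

lemma right_potential_exists:
  assumes w: "(\<Sum>j\<in>UNIV. \<mu> j * w j) = 0"
  shows "\<exists>v. (\<Sum>j\<in>UNIV. \<mu> j * v j) = 0 \<and> (\<forall>j. (\<Sum>k\<in>UNIV. Q j k * v k) - v j = w j)"
proof -
  obtain R where R: "fundamental_inverse R" using fundamental_inverse_exists by blast
  define v where "v k = - (\<Sum>l\<in>UNIV. R k l * w l)" for k
  have Tv: "(\<Sum>k\<in>UNIV. Q j k * v k) - v j - (\<Sum>k\<in>UNIV. \<mu> k * v k) = w j" for j
  proof -
    have "(\<Sum>k\<in>UNIV. T_entry j k * (\<Sum>l\<in>UNIV. R k l * w l)) = (\<Sum>l\<in>UNIV. (\<Sum>k\<in>UNIV. T_entry j k * R k l) * w l)"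
      unfolding sum_distrib_left sum_distrib_right by (subst sum.swap) (simp only: mult.assoc)
    also have "\<dots> = w j" by (simp only: R_right[OF R] sum_of_bool)
    also have "(\<Sum>k\<in>UNIV. T_entry j k * (\<Sum>l\<in>UNIV. R k l * w l)) = - ((\<Sum>k\<in>UNIV. T_entry j k * v k))"
      unfolding v_def by (simp only: mult_minus_right sum_negf minus_minus)
    also have "(\<Sum>k\<in>UNIV. T_entry j k * v k) = v j - (\<Sum>k\<in>UNIV. Q j k * v k) + (\<Sum>k\<in>UNIV. \<mu> k * v k)"
      by (simp only: distrib_right left_diff_distrib sum.distrib sum_subtractf sum_of_bool)
    finally show ?thesis by simp
  qed
  have "0 = (\<Sum>j\<in>UNIV. \<mu> j * ((\<Sum>k\<in>UNIV. Q j k * v k) - v j - (\<Sum>k\<in>UNIV. \<mu> k * v k)))"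
    by (simp only: Tv w)
  also have "\<dots> = - (\<Sum>k\<in>UNIV. \<mu> k * v k)"
    by (simp add: right_diff_distrib sum_subtractf mu_sum_Q sum_distrib_right [symmetric] mu_sum)
  finally have "(\<Sum>k\<in>UNIV. \<mu> k * v k) = 0" by simp
  then show ?thesis using Tv by (intro exI[of _ v]) simp
qed

lemma right_potential_unique:
  assumes "(\<Sum>j\<in>UNIV. \<mu> j * v j) = 0" "\<And>j. (\<Sum>k\<in>UNIV. Q j k * v k) - v j = w j"
    and "(\<Sum>j\<in>UNIV. \<mu> j * v' j) = 0" "\<And>j. (\<Sum>k\<in>UNIV. Q j k * v' k) - v' j = w j"
  shows "v j = v' j"
proof -
  define d where "d j = v j - v' j" for j
  have "d j = (\<Sum>k\<in>UNIV. Q j k * d k)" for j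
    using assms(2)[of j] assms(4)[of j] by (simp add: d_def right_diff_distrib sum_subtractf)
  then have const: "d j = d k" for j k by (rule harmonic_constant)
  have "(\<Sum>k\<in>UNIV. \<mu> k * d k) = (\<Sum>k\<in>UNIV. \<mu> k * d j)"
    by (intro sum.cong refl) (metis const)
  moreover have "(\<Sum>k\<in>UNIV. \<mu> k * d k) = 0"
    using assms(1,3) by (simp add: d_def right_diff_distrib sum_subtractf)
  ultimately have "d j = 0" by (simp add: sum_distrib_right [symmetric] mu_sum)
  then show ?thesis by (simp add: d_def)
qed

end

section \<open>Resolvents of perturbed stochastic matrices\<close>

abbreviation resolvent_solution ::
    "(real \<Rightarrow> 'e::finite \<Rightarrow> 'e \<Rightarrow> complex) \<Rightarrow> real \<Rightarrow> real \<Rightarrow> 'e \<Rightarrow> ('e \<Rightarrow> complex) \<Rightarrow> bool" where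
  "resolvent_solution \<alpha> t z \<kappa> u \<equiv>
     (\<forall>j. u j = of_bool (j = \<kappa>) + of_real z * (\<Sum>k\<in>UNIV. \<alpha> t j k * u k))"

text \<open>
  By compactness \<open>norm (f - z \<alpha>(t) f)\<close> has a positive minimum over unit vectors \<open>f\<close>, and its inverse
  bounds every solution of the resolvent equation.
\<close>

lemma resolvent_bounded:
  fixes \<alpha> :: "real \<Rightarrow> 'e::finite \<Rightarrow> 'e \<Rightarrow> complex"
  assumes T: "compact T" and cont: "\<And>j k. continuous_on UNIV (\<lambda>t. \<alpha> t j k)"
    and inj: "\<And>t z f. t \<in> T \<Longrightarrow> 0 \<le> z \<Longrightarrow> z \<le> 1 \<Longrightarrow>
       (\<And>j. f j = of_real z * (\<Sum>k\<in>UNIV. \<alpha> t j k * f k)) \<Longrightarrow> f = (\<lambda>_. 0)"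
  shows "\<exists>C. \<forall>t\<in>T. \<forall>z\<in>{0..1}. \<forall>u. resolvent_solution \<alpha> t z \<kappa> u
     \<longrightarrow> (\<forall>j. norm (u j) \<le> C)"
proof (cases "T = {}")
  case False
  define A where "A z t f = (\<chi> j. f $ j - of_real z * (\<Sum>k\<in>UNIV. \<alpha> t j k * f $ k))" for z t and f :: "complex^'e"
  let ?K = "T \<times> {0..1::real} \<times> sphere (0::complex^'e) 1"
  have "compact ?K" by (intro compact_Times T compact_Icc compact_sphere)
  moreover have "?K \<noteq> {}"
    using False by (auto simp: ex_in_conv [symmetric] intro!: exI[of _ "axis undefined 1"])
  moreover have "continuous_on ?K (\<lambda>(t, z, f). norm (A z t f))"
    unfolding A_def case_prod_unfold
    by (intro continuous_intros continuous_on_compose2[OF cont]) auto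
  ultimately obtain w where w: "w \<in> ?K"
    and w_min: "\<And>v. v \<in> ?K \<Longrightarrow> (\<lambda>(t, z, f). norm (A z t f)) w \<le> (\<lambda>(t, z, f). norm (A z t f)) v"
    by (metis (no_types, lifting) continuous_attains_inf)
  obtain t0 z0 f0 where w_eq: "w = (t0, z0, f0)" by (cases w) auto
  define c where "c = norm (A z0 t0 f0)"
  have "A z0 t0 f0 \<noteq> 0"
  proof
    assume "A z0 t0 f0 = 0"
    then have "A z0 t0 f0 $ j = 0" for j by simp
    then have "f0 $ j - of_real z0 * (\<Sum>k\<in>UNIV. \<alpha> t0 j k * f0 $ k) = 0" for j
      by (simp only: A_def vec_lambda_beta)
    then have fz: "f0 $ j = of_real z0 * (\<Sum>k\<in>UNIV. \<alpha> t0 j k * f0 $ k)" for j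
      by (rule right_minus_eq[THEN iffD1])
    have "t0 \<in> T" "0 \<le> z0" "z0 \<le> 1" using w by (auto simp: w_eq)
    from inj[OF this fz] have "(\<lambda>j. f0 $ j) = (\<lambda>_. 0)" .
    then have "f0 = 0" by (simp add: vec_eq_iff fun_eq_iff)
    then show False using w by (simp add: w_eq)
  qed
  then have c: "c > 0" by (simp add: c_def)
  show ?thesis
  proof (intro exI[of _ "1 / c"] ballI allI impI)
    fix t z u j
    assume t: "t \<in> T" and z: "z \<in> {0..1::real}"
      and u: "resolvent_solution \<alpha> t z \<kappa> u"
    define f where "f = (\<chi> j. u j)"
    have Af: "A z t f = axis \<kappa> 1"
    proof (rule vec_eq_iff[THEN iffD2], rule allI)
      fix i show "A z t f $ i = axis \<kappa> 1 $ i"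
        using u[rule_format, of i] by (simp add: A_def f_def axis_def)
    qed
    have "f \<noteq> 0"
    proof
      assume "f = 0"
      then have "A z t f = 0" by (simp add: A_def vec_eq_iff)
      with Af show False by simp
    qed
    then have nf: "norm f > 0" by simp
    have "A z t ((1 / norm f) *\<^sub>R f) = (1 / norm f) *\<^sub>R A z t f"
      unfolding A_def vec_eq_iff
      by (simp add: scaleR_right_diff_distrib scaleR_sum_right [symmetric])
    moreover have "(t, z, (1 / norm f) *\<^sub>R f) \<in> ?K" using t z nf by auto
    ultimately have "c \<le> norm ((1 / norm f) *\<^sub>R A z t f)"
      using w_min[of "(t, z, (1 / norm f) *\<^sub>R f)"] by (simp add: w_eq c_def)
    then have "c \<le> 1 / norm f" by (simp add: Af)
    then have "norm f \<le> 1 / c" using c nf by (simp add: field_simps)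
    moreover have "norm (u j) \<le> norm f" using Finite_Cartesian_Product.norm_nth_le[of f j] by (simp add: f_def)
    ultimately show "norm (u j) \<le> 1 / c" by linarith
  qed
qed auto

lemma norm_sum_mult_le:
  fixes a b :: "'e \<Rightarrow> complex"
  assumes "\<And>k. k \<in> A \<Longrightarrow> norm (b k) \<le> B"
  shows "norm (\<Sum>k\<in>A. a k * b k) \<le> (\<Sum>k\<in>A. norm (a k)) * B"
proof -
  have "norm (\<Sum>k\<in>A. a k * b k) \<le> (\<Sum>k\<in>A. norm (a k) * norm (b k))"
    by (rule order_trans[OF norm_sum]) (simp add: norm_mult)
  also have "\<dots> \<le> (\<Sum>k\<in>A. norm (a k) * B)"
    by (intro sum_mono mult_left_mono assms) auto
  finally show ?thesis by (simp add: sum_distrib_right)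
qed

text \<open>
  A matrix function \<open>\<alpha>\<close> with a second-order expansion at \<open>0\<close> around a stochastic matrix \<open>Q\<close>.  The row \<open>\<nu>\<close> is the
  first-order correction of the left eigenvector \<open>\<mu>\<close>, and \<open>R\<close> controls the deviation of a vector from
  the constants.  The formula for \<open>\<sigma>\<close> is twice the second-order coefficient of \<open>1 - \<lambda>(t)\<close> for the eigenvalue
  \<open>\<lambda>(t)\<close> of \<open>\<alpha>(t)\<close> near \<open>1\<close>.
\<close>

locale resolvent_expansion =
  fixes Q m S R :: "'e::finite \<Rightarrow> 'e \<Rightarrow> real" and \<mu> \<nu> :: "'e \<Rightarrow> real"
    and \<alpha> \<rho> :: "real \<Rightarrow> 'e \<Rightarrow> 'e \<Rightarrow> complex" and \<sigma> :: real
  assumes Q_le: "\<And>j k. \<bar>Q j k\<bar> \<le> 1" and mu_le: "\<And>j. \<bar>\<mu> j\<bar> \<le> 1"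
    and mu_Q: "\<And>k. (\<Sum>j\<in>UNIV. \<mu> j * Q j k) = \<mu> k"
    and R: "\<And>(f :: 'e \<Rightarrow> complex) j. f j - (\<Sum>l\<in>UNIV. of_real (\<mu> l) * f l) =
        (\<Sum>k\<in>UNIV. of_real (R j k) * (f k - (\<Sum>l\<in>UNIV. of_real (Q k l) * f l)))"
    and nu: "\<And>k. \<nu> k - (\<Sum>j\<in>UNIV. \<nu> j * Q j k) = (\<Sum>j\<in>UNIV. \<mu> j * m j k)"
    and expansion: "\<And>t j k. \<alpha> t j k = of_real (Q j k) + \<i> * of_real (t * m j k)
        - of_real (t\<^sup>2 / 2 * S j k) + of_real (t\<^sup>2) * \<rho> t j k"
    and rho: "\<And>j k. ((\<lambda>t. \<rho> t j k) \<longlongrightarrow> 0) (at 0)"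
    and variance: "\<sigma> = (\<Sum>k\<in>UNIV. \<Sum>j\<in>UNIV. \<mu> j * S j k + 2 * \<nu> j * m j k)"
    and sigma_pos: "\<sigma> > 0"
begin

definition quad_row :: "'e \<Rightarrow> real" where
  "quad_row k = (\<Sum>j\<in>UNIV. \<mu> j * S j k / 2 + \<nu> j * m j k)"

definition remainder_row :: "real \<Rightarrow> 'e \<Rightarrow> complex" where
  "remainder_row t k = - (\<Sum>j\<in>UNIV. of_real (\<mu> j) * \<rho> t j k)
     + \<i> * of_real t * (\<Sum>j\<in>UNIV. of_real (\<nu> j) * (of_real (S j k / 2) - \<rho> t j k))"

definition left_approx :: "real \<Rightarrow> 'e \<Rightarrow> complex" where
  "left_approx t j = of_real (\<mu> j) + \<i> * of_real (t * \<nu> j)"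

lemma sum_quad_row: "(\<Sum>k\<in>UNIV. quad_row k) = \<sigma> / 2"
  unfolding quad_row_def variance sum_divide_distrib by (intro sum.cong refl) (simp add: add_divide_distrib)

text \<open>
  The choice of \<open>\<nu>\<close> cancels the term of order \<open>t\<close>.
\<close>

lemma left_vector: "(\<Sum>j\<in>UNIV. left_approx t j * \<alpha> t j k) = left_approx t k - of_real (t\<^sup>2) * (of_real (quad_row k) + remainder_row t k)"
proof -
  have "(\<Sum>j\<in>UNIV. left_approx t j * \<alpha> t j k)
     = of_real (\<Sum>j\<in>UNIV. \<mu> j * Q j k) + \<i> * of_real t * of_real (\<Sum>j\<in>UNIV. \<nu> j * Q j k)
       + \<i> * of_real t * of_real (\<Sum>j\<in>UNIV. \<mu> j * m j k)
       - of_real (t\<^sup>2) * (of_real (quad_row k) + remainder_row t k)"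
    unfolding left_approx_def expansion quad_row_def remainder_row_def of_real_sum sum_distrib_left sum.distrib [symmetric]
      sum_subtractf [symmetric] sum_negf [symmetric]
    by (intro sum.cong refl) (simp add: algebra_simps power2_eq_square)
  also have "(\<Sum>j\<in>UNIV. \<mu> j * m j k) = \<nu> k - (\<Sum>j\<in>UNIV. \<nu> j * Q j k)" by (simp add: nu)
  finally show ?thesis by (simp add: mu_Q left_approx_def algebra_simps)
qed

abbreviation "R_size \<equiv> (\<Sum>j\<in>UNIV. \<Sum>k\<in>UNIV. \<bar>R j k\<bar>)"
abbreviation "quad_size \<equiv> (\<Sum>k\<in>UNIV. \<bar>quad_row k\<bar>)"
abbreviation "nu_size \<equiv> (\<Sum>k\<in>UNIV. \<bar>\<nu> k\<bar>)"
definition "char_dev t = (\<Sum>j\<in>UNIV. \<Sum>k\<in>UNIV. norm (\<alpha> t j k - of_real (Q j k)))"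
definition "rem_size t = (\<Sum>k\<in>UNIV. norm (remainder_row t k))"
definition "lorentz t z = 1 - z + \<sigma> * t\<^sup>2 / 2"

text \<open>
  With \<open>M\<close> the size of a rescaled solution, its distance from the expected value is at most
  \<open>err_const + err_slope * M\<close>, and both coefficients vanish as \<open>(t, z)\<close> tends to \<open>(0, 1)\<close>.
\<close>

definition "err_const t z = R_size * lorentz t z * (1 + 2 / \<sigma> * quad_size) + \<bar>t\<bar> * nu_size"
definition "err_slope t z = R_size * (char_dev t + (1 - z)) * (1 + 2 / \<sigma> * quad_size) + (1 - z) + \<bar>t\<bar> * nu_size + 2 / \<sigma> * rem_size t"

text \<open>
  The solution \<open>u\<close> is of order \<open>1 / lorentz t z\<close>, so it is rescaled to \<open>w\<close>.  Two estimates combine.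
  Near \<open>(0, 1)\<close> the resolvent equation makes \<open>w - Q w\<close> small, hence \<open>w\<close> is close to the constant
  \<open>s = \<mu> \<cdot> w\<close>.  Pairing the equation with \<open>left_approx\<close> then determines that constant: the coefficient of \<open>s\<close> is \<open>1 - z\<close>
  plus \<open>z \<sigma> t\<^sup>2 / 2\<close>, which is \<open>lorentz t z\<close> up to a small relative error.
\<close>

lemma solution_bound:
  assumes z: "0 < z" "z < 1"
    and u: "\<And>j. u j = of_bool (j = \<kappa>) + of_real z * (\<Sum>k\<in>UNIV. \<alpha> t j k * u k)"
  defines "w \<equiv> \<lambda>j. of_real (lorentz t z) * u j"
  shows "norm (w j - of_real (\<mu> \<kappa>)) \<le> err_const t z + err_slope t z * (\<Sum>k\<in>UNIV. norm (w k))"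
proof -
  define D where "D = lorentz t z"
  have D: "D > 0" "1 - z \<le> D" "t\<^sup>2 \<le> 2 / \<sigma> * D" "t\<^sup>2 * \<sigma> / 2 \<le> D"
  proof -
    have "0 \<le> \<sigma> * t\<^sup>2 / 2" using sigma_pos by simp
    then show "D > 0" "1 - z \<le> D" using z by (auto simp: D_def lorentz_def)
    show "t\<^sup>2 \<le> 2 / \<sigma> * D" "t\<^sup>2 * \<sigma> / 2 \<le> D" using z sigma_pos by (auto simp: D_def lorentz_def field_simps)
  qed
  define M where "M = (\<Sum>k\<in>UNIV. norm (w k))"
  have wM: "norm (w k) \<le> M" for k unfolding M_def by (rule member_le_sum) auto
  have M0: "M \<ge> 0" unfolding M_def by (intro sum_nonneg) auto
  have w: "w j = of_real D * of_bool (j = \<kappa>) + of_real z * (\<Sum>k\<in>UNIV. \<alpha> t j k * w k)" for j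
    unfolding w_def D_def [symmetric] using arg_cong[OF u[of j], of "\<lambda>x. of_real D * x"]
    by (simp add: algebra_simps sum_distrib_left)
  define s where "s = (\<Sum>l\<in>UNIV. of_real (\<mu> l) * w l)"
  define X where "X = R_size * (D + (char_dev t + (1 - z)) * M)"
  have X: "norm (w j - s) \<le> X" for j
  proof -
    have "norm (w k - (\<Sum>l\<in>UNIV. of_real (Q k l) * w l)) \<le> D + (char_dev t + (1 - z)) * M" for k
    proof -
      have "w k - (\<Sum>l\<in>UNIV. of_real (Q k l) * w l) =
         of_real D * of_bool (k = \<kappa>) + of_real z * (\<Sum>l\<in>UNIV. (\<alpha> t k l - of_real (Q k l)) * w l)
           - of_real (1 - z) * (\<Sum>l\<in>UNIV. of_real (Q k l) * w l)"
        by (subst w[of k]) (simp add: algebra_simps sum_subtractf)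
      also have "norm \<dots> \<le> norm (of_real D * of_bool (k = \<kappa>) :: complex) + norm (of_real z * (\<Sum>l\<in>UNIV. (\<alpha> t k l - of_real (Q k l)) * w l))
           + norm (of_real (1 - z) * (\<Sum>l\<in>UNIV. of_real (Q k l) * w l))"
        by (intro order_trans[OF norm_triangle_ineq4] add_mono norm_triangle_ineq order_refl)
      also have "\<dots> \<le> D + char_dev t * M + (1 - z) * M"
      proof (intro add_mono)
        show "norm (of_real D * of_bool (k = \<kappa>) :: complex) \<le> D" using D by (simp add: norm_mult)
        have "norm (\<Sum>l\<in>UNIV. (\<alpha> t k l - of_real (Q k l)) * w l) \<le> (\<Sum>l\<in>UNIV. norm (\<alpha> t k l - of_real (Q k l))) * M"
          by (rule norm_sum_mult_le) (rule wM)
        also have "\<dots> \<le> char_dev t * M"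
          unfolding char_dev_def by (intro mult_right_mono M0 member_le_sum) (auto intro: sum_nonneg)
        finally show "norm (of_real z * (\<Sum>l\<in>UNIV. (\<alpha> t k l - of_real (Q k l)) * w l)) \<le> char_dev t * M"
          using z mult_mono[of z 1 "norm (\<Sum>l\<in>UNIV. (\<alpha> t k l - of_real (Q k l)) * w l)" "char_dev t * M"]
          by (simp add: norm_mult)
        have "norm (\<Sum>l\<in>UNIV. of_real (Q k l) * w l) \<le> (\<Sum>l\<in>UNIV. norm (of_real (Q k l) * w l))"
          by (rule norm_sum)
        also have "\<dots> \<le> M"
          unfolding M_def using mult_right_mono[OF Q_le] by (intro sum_mono) (fastforce simp: norm_mult)
        finally show "norm (of_real (1 - z) * (\<Sum>l\<in>UNIV. of_real (Q k l) * w l)) \<le> (1 - z) * M"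
          unfolding norm_mult norm_of_real using z by (simp add: mult_left_mono)
      qed
      finally show ?thesis by (simp add: algebra_simps)
    qed
    note bnd = this
    have "w j - s = (\<Sum>k\<in>UNIV. of_real (R j k) * (w k - (\<Sum>l\<in>UNIV. of_real (Q k l) * w l)))"
      unfolding s_def by (rule R)
    also have "norm \<dots> \<le> (\<Sum>k\<in>UNIV. norm (complex_of_real (R j k))) * (D + (char_dev t + (1 - z)) * M)"
      by (rule norm_sum_mult_le) (rule bnd)
    also have "\<dots> \<le> X"
      unfolding X_def norm_of_real
    proof (rule mult_right_mono)
      show "(\<Sum>k\<in>UNIV. \<bar>R j k\<bar>) \<le> R_size" by (rule member_le_sum) (auto intro: sum_nonneg)
      show "0 \<le> D + (char_dev t + (1 - z)) * M"
        using D M0 z by (intro add_nonneg_nonneg mult_nonneg_nonneg) (auto simp: char_dev_def intro!: sum_nonneg)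
    qed
    finally show ?thesis .
  qed
  have main: "of_real D * (s - of_real (\<mu> \<kappa>)) =
     of_real ((1 - z) * (t\<^sup>2 * \<sigma> / 2)) * s
     - of_real (1 - z) * (\<i> * of_real t * (\<Sum>k\<in>UNIV. of_real (\<nu> k) * w k))
     - of_real (z * t\<^sup>2) * (\<Sum>k\<in>UNIV. of_real (quad_row k) * (w k - s))
     - of_real (z * t\<^sup>2) * (\<Sum>k\<in>UNIV. remainder_row t k * w k)
     + of_real D * (\<i> * of_real (t * \<nu> \<kappa>))"
  proof -
    have "(\<Sum>j\<in>UNIV. left_approx t j * w j) = of_real D * left_approx t \<kappa> + of_real z * (\<Sum>j\<in>UNIV. \<Sum>k\<in>UNIV. left_approx t j * \<alpha> t j k * w k)"
    proof -
      have "left_approx t j * w j = (if j = \<kappa> then of_real D * left_approx t \<kappa> else 0)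
          + of_real z * (\<Sum>k\<in>UNIV. left_approx t j * \<alpha> t j k * w k)" for j
        by (subst w [of j]) (simp add: algebra_simps sum_distrib_left)
      then show ?thesis by (simp add: sum.distrib sum_distrib_left)
    qed
    also have "(\<Sum>j\<in>UNIV. \<Sum>k\<in>UNIV. left_approx t j * \<alpha> t j k * w k) = (\<Sum>k\<in>UNIV. (\<Sum>j\<in>UNIV. left_approx t j * \<alpha> t j k) * w k)"
      by (subst sum.swap) (simp add: sum_distrib_right)
    also have "\<dots> = (\<Sum>k\<in>UNIV. left_approx t k * w k) - of_real (t\<^sup>2) * ((\<Sum>k\<in>UNIV. of_real (quad_row k) * w k) + (\<Sum>k\<in>UNIV. remainder_row t k * w k))"
      unfolding left_vector by (simp add: algebra_simps sum_subtractf sum.distrib sum_distrib_left)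
    finally have 1: "of_real (1 - z) * (\<Sum>j\<in>UNIV. left_approx t j * w j) + of_real (z * t\<^sup>2) * ((\<Sum>k\<in>UNIV. of_real (quad_row k) * w k) + (\<Sum>k\<in>UNIV. remainder_row t k * w k)) = of_real D * left_approx t \<kappa>"
      by (simp add: algebra_simps)
    have 2: "(\<Sum>j\<in>UNIV. left_approx t j * w j) = s + \<i> * of_real t * (\<Sum>k\<in>UNIV. of_real (\<nu> k) * w k)"
      by (simp add: left_approx_def s_def algebra_simps sum.distrib sum_distrib_left)
    have "(\<Sum>k\<in>UNIV. of_real (quad_row k) * w k) = (\<Sum>k\<in>UNIV. of_real (quad_row k) * (w k - s)) + of_real (\<Sum>k\<in>UNIV. quad_row k) * s"
      by (simp add: algebra_simps sum_subtractf sum_distrib_left)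
    then have 3: "(\<Sum>k\<in>UNIV. of_real (quad_row k) * w k) = (\<Sum>k\<in>UNIV. of_real (quad_row k) * (w k - s)) + of_real (\<sigma> / 2) * s"
      by (simp add: sum_quad_row)
    have D_eq: "complex_of_real D = of_real (1 - z) + of_real (\<sigma> / 2) * of_real (t\<^sup>2)"
      by (simp add: D_def lorentz_def)
    have "of_real D * (s - of_real (\<mu> \<kappa>)) = of_real D * s - of_real D * left_approx t \<kappa> + of_real D * (\<i> * of_real (t * \<nu> \<kappa>))"
      by (simp add: left_approx_def algebra_simps)
    then show ?thesis
      unfolding 1 [symmetric] 2 3 by (simp add: D_eq algebra_simps diff_divide_distrib add_divide_distrib)
  qed
  have s_M: "norm s \<le> M"
  proof -
    have "norm s \<le> (\<Sum>l\<in>UNIV. norm (of_real (\<mu> l) * w l))" unfolding s_def by (rule norm_sum)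
    also have "\<dots> \<le> M"
      unfolding M_def using mult_right_mono[OF mu_le] by (intro sum_mono) (fastforce simp: norm_mult)
    finally show ?thesis .
  qed
  have "D * norm (s - of_real (\<mu> \<kappa>)) = norm (of_real D * (s - of_real (\<mu> \<kappa>)))"
    using D by (simp add: norm_mult)
  also have "\<dots> \<le> norm (of_real ((1 - z) * (t\<^sup>2 * \<sigma> / 2)) * s)
     + norm (of_real (1 - z) * (\<i> * of_real t * (\<Sum>k\<in>UNIV. of_real (\<nu> k) * w k)))
     + norm (of_real (z * t\<^sup>2) * (\<Sum>k\<in>UNIV. of_real (quad_row k) * (w k - s)))
     + norm (of_real (z * t\<^sup>2) * (\<Sum>k\<in>UNIV. remainder_row t k * w k))
     + norm (of_real D * (\<i> * complex_of_real (t * \<nu> \<kappa>)))"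
    unfolding main by (intro order_trans[OF norm_triangle_ineq] order_trans[OF norm_triangle_ineq4] add_mono order_refl)
  also have "\<dots> \<le> D * ((1 - z) * M) + D * (\<bar>t\<bar> * nu_size * M) + (2 / \<sigma> * D) * (quad_size * X) + (2 / \<sigma> * D) * (rem_size t * M) + D * (\<bar>t\<bar> * nu_size)"
  proof (intro add_mono)
    have "norm (of_real ((1 - z) * (t\<^sup>2 * \<sigma> / 2)) * s) = (1 - z) * ((t\<^sup>2 * \<sigma> / 2) * norm s)"
      unfolding norm_mult norm_of_real using z sigma_pos by (simp add: abs_mult)
    also have "\<dots> \<le> (1 - z) * (D * M)"
      using z sigma_pos D s_M by (intro mult_left_mono mult_mono) auto
    finally show "norm (of_real ((1 - z) * (t\<^sup>2 * \<sigma> / 2)) * s) \<le> D * ((1 - z) * M)" by (simp add: mult_ac)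
    have "norm (\<Sum>k\<in>UNIV. of_real (\<nu> k) * w k) \<le> nu_size * M"
      using norm_sum_mult_le[OF wM, where A = UNIV and a = "\<lambda>k. of_real (\<nu> k)"] by simp
    then have "(1 - z) * (\<bar>t\<bar> * norm (\<Sum>k\<in>UNIV. of_real (\<nu> k) * w k)) \<le> D * (\<bar>t\<bar> * (nu_size * M))"
      using z D by (intro mult_mono mult_left_mono) auto
    then show "norm (of_real (1 - z) * (\<i> * of_real t * (\<Sum>k\<in>UNIV. of_real (\<nu> k) * w k))) \<le> D * (\<bar>t\<bar> * nu_size * M)"
      unfolding norm_mult norm_of_real using z by (simp add: mult_ac)
    have zt: "\<bar>z * t\<^sup>2\<bar> \<le> 2 / \<sigma> * D"
      using z D mult_mono[of z 1 "t\<^sup>2" "2 / \<sigma> * D"] by (simp add: abs_mult)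
    have "norm (\<Sum>k\<in>UNIV. of_real (quad_row k) * (w k - s)) \<le> quad_size * X"
      using norm_sum_mult_le[OF X, where A = UNIV and a = "\<lambda>k. of_real (quad_row k)"] by simp
    then show "norm (of_real (z * t\<^sup>2) * (\<Sum>k\<in>UNIV. of_real (quad_row k) * (w k - s))) \<le> (2 / \<sigma> * D) * (quad_size * X)"
      unfolding norm_mult[of "of_real (z * t\<^sup>2)"] norm_of_real using zt by (intro mult_mono) auto
    have "norm (\<Sum>k\<in>UNIV. remainder_row t k * w k) \<le> rem_size t * M"
      unfolding rem_size_def by (rule norm_sum_mult_le) (rule wM)
    then show "norm (of_real (z * t\<^sup>2) * (\<Sum>k\<in>UNIV. remainder_row t k * w k)) \<le> (2 / \<sigma> * D) * (rem_size t * M)"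
      unfolding norm_mult[of "of_real (z * t\<^sup>2)"] norm_of_real using zt by (intro mult_mono) auto
    have "\<bar>\<nu> \<kappa>\<bar> \<le> nu_size" by (rule member_le_sum) auto
    then show "norm (of_real D * (\<i> * complex_of_real (t * \<nu> \<kappa>))) \<le> D * (\<bar>t\<bar> * nu_size)"
      unfolding norm_mult norm_of_real abs_mult using D by (simp add: mult_left_mono)
  qed
  also have "\<dots> = D * ((1 - z) * M + \<bar>t\<bar> * nu_size * M + 2 / \<sigma> * quad_size * X + 2 / \<sigma> * rem_size t * M + \<bar>t\<bar> * nu_size)"
    by (simp add: algebra_simps)
  finally have "norm (s - of_real (\<mu> \<kappa>)) \<le> (1 - z) * M + \<bar>t\<bar> * nu_size * M + 2 / \<sigma> * quad_size * X + 2 / \<sigma> * rem_size t * M + \<bar>t\<bar> * nu_size"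
    using D(1) by simp
  moreover have "norm (w j - of_real (\<mu> \<kappa>)) \<le> norm (w j - s) + norm (s - of_real (\<mu> \<kappa>))"
    by (rule norm_diff_triangle_le[OF order_refl order_refl])
  ultimately have "norm (w j - of_real (\<mu> \<kappa>)) \<le> X * (1 + 2 / \<sigma> * quad_size) + (1 - z) * M + \<bar>t\<bar> * nu_size * M + 2 / \<sigma> * rem_size t * M + \<bar>t\<bar> * nu_size"
    using X[of j] by (simp add: algebra_simps)
  also have "\<dots> = err_const t z + err_slope t z * M"
    unfolding X_def err_const_def err_slope_def D_def by (simp add: algebra_simps)
  finally show ?thesis unfolding M_def .
qed

text \<open>
  Summing the bound of \<open>solution_bound\<close> over all states bounds \<open>M\<close> by a constant plus a multiple less
  than \<open>1/2\<close> of \<open>M\<close>.  So \<open>M\<close> stays bounded, and the same estimate gives the limit.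
\<close>

lemma resolvent_near_origin:
  assumes "\<epsilon> > 0"
  shows "eventually (\<lambda>(t, z). \<forall>u. resolvent_solution \<alpha> t z \<kappa> u
     \<longrightarrow> (\<forall>j. norm (of_real (1 - z + \<sigma> * t\<^sup>2 / 2) * u j - of_real (\<mu> \<kappa>)) \<le> \<epsilon>)) (at 0 \<times>\<^sub>F at_left 1)"
proof -
  let ?F = "at (0::real) \<times>\<^sub>F at_left (1::real)"
  let ?n = "real (card (UNIV :: 'e set))"
  have t0: "(fst \<longlongrightarrow> 0) ?F"
    by (rule filterlim_compose[OF tendsto_ident_at filterlim_fst])
  have z1: "(snd \<longlongrightarrow> 1) ?F"
    by (rule filterlim_compose[OF tendsto_ident_at filterlim_snd])
  have "((\<lambda>t. \<alpha> t j k - of_real (Q j k)) \<longlongrightarrow> 0) (at 0)" for j k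
    unfolding expansion by (rule tendsto_eq_intros rho refl | simp)+
  then have "(char_dev \<longlongrightarrow> 0) (at 0)"
    unfolding char_dev_def by (intro tendsto_null_sum tendsto_norm_zero)
  then have char_dev: "((\<lambda>x. char_dev (fst x)) \<longlongrightarrow> 0) ?F" by (rule filterlim_compose[OF _ filterlim_fst])
  have "((\<lambda>t. remainder_row t k) \<longlongrightarrow> 0) (at 0)" for k
    unfolding remainder_row_def by (rule tendsto_eq_intros rho refl | simp)+
  then have "(rem_size \<longlongrightarrow> 0) (at 0)"
    unfolding rem_size_def by (intro tendsto_null_sum tendsto_norm_zero)
  then have rem_size: "((\<lambda>x. rem_size (fst x)) \<longlongrightarrow> 0) ?F" by (rule filterlim_compose[OF _ filterlim_fst])
  have err_const: "((\<lambda>x. err_const (fst x) (snd x)) \<longlongrightarrow> 0) ?F"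
    unfolding err_const_def lorentz_def by (rule tendsto_eq_intros t0 z1 refl | simp)+
  have err_slope: "((\<lambda>x. err_slope (fst x) (snd x)) \<longlongrightarrow> 0) ?F"
    unfolding err_slope_def by (rule tendsto_eq_intros t0 z1 char_dev rem_size refl | simp)+
  have n1: "?n \<ge> 1" by (simp add: Suc_leI card_gt_0_iff)
  have "((\<lambda>x. ?n * err_slope (fst x) (snd x)) \<longlongrightarrow> 0) ?F"
    by (rule tendsto_eq_intros err_slope refl | simp)+
  then have e1: "eventually (\<lambda>x. ?n * err_slope (fst x) (snd x) < 1 / 2) ?F"
    by (rule order_tendstoD) simp
  have "((\<lambda>x. err_const (fst x) (snd x) + err_slope (fst x) (snd x) * (2 * ?n * (1 + err_const (fst x) (snd x)))) \<longlongrightarrow> 0) ?F"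
    by (rule tendsto_eq_intros err_const err_slope refl | simp)+
  then have e2: "eventually (\<lambda>x. err_const (fst x) (snd x) + err_slope (fst x) (snd x) * (2 * ?n * (1 + err_const (fst x) (snd x))) < \<epsilon>) ?F"
    by (rule order_tendstoD) (rule assms)
  have "eventually (\<lambda>z::real. 0 < z \<and> z < 1) (at_left 1)"
    by (rule eventually_at_leftI[of 0]) auto
  then have e3: "eventually (\<lambda>x. 0 < snd x \<and> snd x < 1) ?F"
    by (rule eventually_compose_filterlim[OF _ filterlim_snd])
  show ?thesis
    unfolding case_prod_unfold
    using e1 e2 e3
  proof eventually_elim
    case (elim x)
    obtain t z where x: "x = (t, z)" by (cases x)
    note e = elim[unfolded x fst_conv snd_conv]
    show ?case unfolding x fst_conv snd_conv
    proof (intro allI impI)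
      fix u j assume u: "resolvent_solution \<alpha> t z \<kappa> u"
      define w where "w = (\<lambda>j. of_real (lorentz t z) * u j)"
      define M where "M = (\<Sum>k\<in>UNIV. norm (w k))"
      have M0: "M \<ge> 0" unfolding M_def by (intro sum_nonneg) auto
      have bnd: "norm (w j - of_real (\<mu> \<kappa>)) \<le> err_const t z + err_slope t z * M" for j
        unfolding M_def w_def using e by (intro solution_bound u[rule_format]) auto
      have "err_slope t z \<ge> 0"
        unfolding err_slope_def char_dev_def rem_size_def using e sigma_pos
        by (intro add_nonneg_nonneg mult_nonneg_nonneg sum_nonneg) auto
      have "norm (w j) \<le> 1 + (err_const t z + err_slope t z * M)" for j
        using norm_triangle_ineq2[of "w j" "of_real (\<mu> \<kappa>)"] bnd[of j] mu_le[of \<kappa>] by simp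
      then have "M \<le> (\<Sum>j\<in>(UNIV::'e set). 1 + (err_const t z + err_slope t z * M))"
        unfolding M_def by (rule sum_mono)
      also have "\<dots> = ?n * (1 + err_const t z) + (?n * err_slope t z) * M" by (simp add: algebra_simps)
      also have "\<dots> \<le> ?n * (1 + err_const t z) + (1 / 2) * M"
        using e(1) M0 by (intro add_left_mono mult_right_mono) auto
      finally have "M \<le> 2 * ?n * (1 + err_const t z)" by simp
      then have "err_slope t z * M \<le> err_slope t z * (2 * ?n * (1 + err_const t z))"
        using \<open>err_slope t z \<ge> 0\<close> by (rule mult_left_mono)
      with bnd[of j] e(2) show "norm (of_real (1 - z + \<sigma> * t\<^sup>2 / 2) * u j - of_real (\<mu> \<kappa>)) \<le> \<epsilon>"
        unfolding w_def lorentz_def by simp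
    qed
  qed
qed

end

section \<open>The Green function of the walk near the singularity\<close>

lemma lorentz_integral:
  fixes \<sigma> h :: real
  assumes "\<sigma> > 0" "h > 0"
  shows "integrable circle (\<lambda>t. 1 / (h + \<sigma> * t\<^sup>2 / 2))"
    and "(LINT t|circle. 1 / (h + \<sigma> * t\<^sup>2 / 2)) = 4 / sqrt (2 * \<sigma> * h) * arctan (pi * sqrt (\<sigma> / (2 * h)))"
proof -
  define c where "c = sqrt (\<sigma> / (2 * h))"
  define b where "b = sqrt (2 * \<sigma> * h)"
  have pos: "c > 0" "b > 0" using assms by (auto simp: c_def b_def)
  have c2: "c\<^sup>2 = \<sigma> / (2 * h)" using assms by (simp add: c_def)
  have bc: "b = 2 * h * c"
    using assms unfolding b_def c_def
    by (intro real_sqrt_unique) (auto simp: power_mult_distrib field_simps power2_eq_square)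
  have pos2: "h + \<sigma> * t\<^sup>2 / 2 > 0" for t using assms by (intro add_pos_nonneg) auto
  have cont: "continuous_on UNIV (\<lambda>t. 1 / (h + \<sigma> * t\<^sup>2 / 2))"
    by (intro continuous_intros ballI) (use pos2 in \<open>auto simp: less_le\<close>)
  have "((\<lambda>t. 1 / (h + \<sigma> * t\<^sup>2 / 2)) has_integral (2 / b * arctan (pi * c) - 2 / b * arctan (- pi * c))) {-pi..pi}"
  proof (rule fundamental_theorem_of_calculus)
    fix t
    have "((\<lambda>t. arctan (t * c)) has_real_derivative c / (1 + (t * c)\<^sup>2)) (at t within {-pi..pi})"
      by (auto intro!: derivative_eq_intros simp: field_simps)
    then have "((\<lambda>t. 2 / b * arctan (t * c)) has_real_derivative 2 / b * (c / (1 + (t * c)\<^sup>2))) (at t within {-pi..pi})"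
      by (rule DERIV_cmult)
    also have "2 / b * (c / (1 + (t * c)\<^sup>2)) = 1 / (h + \<sigma> * t\<^sup>2 / 2)"
    proof -
      have "2 / b * (c / (1 + (t * c)\<^sup>2)) = 1 / (h * (1 + t\<^sup>2 * c\<^sup>2))"
        unfolding bc using pos by (simp add: power_mult_distrib)
      also have "h * (1 + t\<^sup>2 * c\<^sup>2) = h + \<sigma> * t\<^sup>2 / 2" unfolding c2 using assms by (simp add: field_simps)
      finally show ?thesis .
    qed
    finally show "((\<lambda>t. 2 / b * arctan (t * c)) has_vector_derivative 1 / (h + \<sigma> * t\<^sup>2 / 2)) (at t within {-pi..pi})"
      by (simp add: has_real_derivative_iff_has_vector_derivative)
  qed simp
  then have "integral {-pi..pi} (\<lambda>t. 1 / (h + \<sigma> * t\<^sup>2 / 2)) = 4 / b * arctan (pi * c)"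
    by (simp add: integral_unique arctan_minus)
  then show "integrable circle (\<lambda>t. 1 / (h + \<sigma> * t\<^sup>2 / 2))"
    "(LINT t|circle. 1 / (h + \<sigma> * t\<^sup>2 / 2)) = 4 / sqrt (2 * \<sigma> * h) * arctan (pi * sqrt (\<sigma> / (2 * h)))"
    using integral_circle_continuous[OF cont] by (auto simp: b_def c_def)
qed

lemma lorentz_integral_limit:
  assumes "\<sigma> > 0"
  shows "((\<lambda>z. sqrt (1 - z) * (LINT t|circle. 1 / (1 - z + \<sigma> * t\<^sup>2 / 2))) \<longlongrightarrow> 2 * pi / sqrt (2 * \<sigma>)) (at_left 1)"
proof -
  have "((\<lambda>z. 4 / sqrt (2 * \<sigma>) * arctan (pi * sqrt (\<sigma> / (2 * (1 - z))))) \<longlongrightarrow> 4 / sqrt (2 * \<sigma>) * (pi / 2)) (at_left 1)"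
  proof (intro tendsto_mult tendsto_const)
    have "filterlim (\<lambda>z::real. \<sigma> / (2 * (1 - z))) at_top (at_left 1)" using assms by real_asymp
    then have "filterlim (\<lambda>z::real. sqrt (\<sigma> / (2 * (1 - z)))) at_top (at_left 1)"
      by (rule filterlim_compose[OF sqrt_at_top])
    then have "filterlim (\<lambda>z::real. pi * sqrt (\<sigma> / (2 * (1 - z)))) at_top (at_left 1)"
      by (rule filterlim_tendsto_pos_mult_at_top[OF tendsto_const pi_gt_zero])
    then show "((\<lambda>z. arctan (pi * sqrt (\<sigma> / (2 * (1 - z))))) \<longlongrightarrow> pi / 2) (at_left 1)"
      by (rule filterlim_compose[OF tendsto_arctan_at_top])
  qed
  also have "4 / sqrt (2 * \<sigma>) * (pi / 2) = 2 * pi / sqrt (2 * \<sigma>)" by simp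
  finally show ?thesis
  proof (rule Lim_transform_eventually)
    have "eventually (\<lambda>z::real. z < 1) (at_left 1)" by (simp add: eventually_at_filter)
    then show "\<forall>\<^sub>F z in at_left 1. 4 / sqrt (2 * \<sigma>) * arctan (pi * sqrt (\<sigma> / (2 * (1 - z))))
      = sqrt (1 - z) * (LINT t|circle. 1 / (1 - z + \<sigma> * t\<^sup>2 / 2))"
      by eventually_elim (use assms in \<open>simp add: lorentz_integral real_sqrt_mult\<close>)
  qed
qed

lemma eventually_unit_interval: "eventually (\<lambda>z::real. 0 < z \<and> z < 1) (at_left 1)"
  by (rule eventually_at_leftI[of 0]) auto

definition jump_mean :: "'e jumps \<Rightarrow> 'e \<Rightarrow> 'e \<Rightarrow> real" where
  "jump_mean J j k = expect (J j) (\<lambda>(y, l). of_int y * of_bool (l = k))"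

definition jump_square :: "'e jumps \<Rightarrow> 'e \<Rightarrow> 'e \<Rightarrow> real" where
  "jump_square J j k = expect (J j) (\<lambda>(y, l). (of_int y)\<^sup>2 * of_bool (l = k))"

lemma Q_prob_nonneg: "Q_prob J j k \<ge> 0"
  unfolding Q_prob_def by (rule Bochner_Integration.integral_nonneg) auto

lemma Q_prob_sum:
  fixes J :: "'e::finite jumps"
  shows "(\<Sum>k\<in>UNIV. Q_prob J j k) = 1"
  using expectation_split_state[of "\<lambda>y k. 1::real" 1 "J j"] by (simp add: Q_prob_def case_prod_unfold)

lemma Q_prob_le_1:
  fixes J :: "'e::finite jumps"
  shows "Q_prob J j k \<le> 1"
  by (rule order_trans[OF member_le_sum[of k UNIV "Q_prob J j"]]) (auto simp: Q_prob_nonneg Q_prob_sum)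

lemma norm_jump_char_le: "norm (jump_char J t j k) \<le> Q_prob J j k"
proof -
  have "norm (jump_char J t j k) \<le> expect (J j) (\<lambda>w. norm (case w of (y, l) \<Rightarrow> cis (t * of_int y) * of_bool (l = k)))"
    unfolding jump_char_def by (rule integral_norm_bound)
  also have "\<dots> = Q_prob J j k"
    unfolding Q_prob_def by (rule Bochner_Integration.integral_cong) (auto simp: norm_mult)
  finally show ?thesis .
qed

definition jump_remainder :: "'e jumps \<Rightarrow> real \<Rightarrow> 'e \<Rightarrow> 'e \<Rightarrow> complex" where
  "jump_remainder J t j k = expect (J j) (\<lambda>(y, l).
     (cis (t * of_int y) - 1 - \<i> * of_real (t * of_int y) + of_real ((t * of_int y)\<^sup>2 / 2)) / of_real (t\<^sup>2) * of_bool (l = k))"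

lemma integrable_of_int_if_square:
  assumes "integrable (measure_pmf P) (\<lambda>w. (real_of_int (f w))\<^sup>2)"
  shows "integrable (measure_pmf P) (\<lambda>w. real_of_int (f w))"
proof (rule Bochner_Integration.integrable_bound[OF assms])
  have "\<bar>real_of_int y\<bar> \<le> (real_of_int y)\<^sup>2" for y
  proof (cases "y = 0")
    case False
    then have "1 \<le> \<bar>real_of_int y\<bar>" by linarith
    then show ?thesis using mult_left_mono[of 1 "\<bar>real_of_int y\<bar>" "\<bar>real_of_int y\<bar>"] by (simp add: power2_eq_square)
  qed simp
  then show "AE w in P. norm (real_of_int (f w)) \<le> norm ((real_of_int (f w))\<^sup>2)"
    by (simp add: AE_measure_pmf_iff)
qed simp

lemma cis_taylor_bounds:
  "norm (cis x - 1 - \<i> * of_real x + of_real (x\<^sup>2 / 2)) \<le> x\<^sup>2"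
  "norm (cis x - 1 - \<i> * of_real x + of_real (x\<^sup>2 / 2)) \<le> \<bar>x\<bar> ^ 3 / 6"
proof -
  have e: "cis x - 1 - \<i> * of_real x + of_real (x\<^sup>2 / 2) = iexp x - (\<Sum>k\<le>2. (\<i> * of_real x) ^ k / fact k)"
    by (simp add: cis_conv_exp numeral_2_eq_2 power_mult_distrib algebra_simps)
  show "norm (cis x - 1 - \<i> * of_real x + of_real (x\<^sup>2 / 2)) \<le> x\<^sup>2"
    unfolding e using iexp_approx2[of x 2] by simp
  show "norm (cis x - 1 - \<i> * of_real x + of_real (x\<^sup>2 / 2)) \<le> \<bar>x\<bar> ^ 3 / 6"
    unfolding e using iexp_approx1[of x 2] by (simp add: fact_numeral numeral_3_eq_3)
qed

text \<open>
  A walk with mean zero and positive finite variance, in terms of its jump distributions.  The vector \<open>v\<close> is \<open>(Q - 1)\<^sup>-\<^sup>1 M 1\<close>, and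
  the assumption \<open>arith\<close> is the dual form of trivial arithmetic: a character of the integers that is
  trivial on all loops at some state is trivial.
\<close>

locale recurrent_walk = irreducible_chain "Q_prob J" \<mu> for J :: "'e::finite jumps" and \<mu> :: "'e \<Rightarrow> real" +
  fixes v :: "'e \<Rightarrow> real" and \<sigma> :: real
  assumes second_moment: "\<And>j. integrable (J j) (\<lambda>w. (real_of_int (fst w))\<^sup>2)"
    and arith: "\<And>j t. (\<And>n y. (y, j) \<in> set_pmf (walk J n (0, j)) \<Longrightarrow> cis (t * of_int y) = 1) \<Longrightarrow> cis t = 1"
    and zero_mean: "(\<Sum>j\<in>UNIV. \<Sum>k\<in>UNIV. \<mu> j * jump_mean J j k) = 0"
    and v: "\<And>j. (\<Sum>k\<in>UNIV. Q_prob J j k * v k) - v j = (\<Sum>k\<in>UNIV. jump_mean J j k)"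
    and variance: "\<sigma> = (\<Sum>j\<in>UNIV. \<Sum>k\<in>UNIV. \<mu> j * jump_square J j k) - 2 * (\<Sum>j\<in>UNIV. \<Sum>k\<in>UNIV. \<mu> j * jump_mean J j k * v k)"
    and sigma_pos: "\<sigma> > 0"
begin

lemma first_moment: "integrable (J j) (\<lambda>w. real_of_int (fst w))"
  by (rule integrable_of_int_if_square) (rule second_moment)

lemma jump_char_0: "jump_char J 0 j k = of_real (Q_prob J j k)"
  unfolding jump_char_def Q_prob_def integral_complex_of_real [symmetric]
  by (rule Bochner_Integration.integral_cong) auto

text \<open>
  At \<open>t = 0\<close> the remainder is \<open>0\<close> by the convention for division, which is consistent because
  \<open>jump_char\<close> is the matrix \<open>Q\<close> there.
\<close>

lemma jump_char_expansion:
  "jump_char J t j k = of_real (Q_prob J j k) + \<i> * of_real (t * jump_mean J j k)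
     - of_real (t\<^sup>2 / 2 * jump_square J j k) + of_real (t\<^sup>2) * jump_remainder J t j k"
proof (cases "t = 0")
  case False
  let ?b = "\<lambda>w. of_bool (snd w = k) :: real"
  have int0: "integrable (J j) ?b" by (rule integrable_bounded_pmf[where B = 1]) auto
  have int1: "integrable (J j) (\<lambda>w. of_int (fst w) * ?b w)"
    by (rule Bochner_Integration.integrable_bound[OF first_moment[of j]]) auto
  have int2: "integrable (J j) (\<lambda>w. (of_int (fst w))\<^sup>2 * ?b w)"
    by (rule Bochner_Integration.integrable_bound[OF second_moment[of j]]) auto
  have intc: "integrable (J j) (\<lambda>w. cis (t * of_int (fst w)) * of_bool (snd w = k))"
    by (rule integrable_bounded_pmf[where B = 1]) (auto simp: norm_mult)
  have "of_real (t\<^sup>2) * jump_remainder J t j k = expect (J j) (\<lambda>w.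
     cis (t * of_int (fst w)) * of_bool (snd w = k) - of_real (?b w) - \<i> * of_real t * of_real (of_int (fst w) * ?b w)
      + of_real (t\<^sup>2 / 2) * of_real ((of_int (fst w))\<^sup>2 * ?b w))"
    unfolding jump_remainder_def integral_mult_right_zero [symmetric] using False
    by (intro Bochner_Integration.integral_cong) (auto simp: case_prod_unfold power_mult_distrib)
  also have "\<dots> = jump_char J t j k - of_real (Q_prob J j k) - \<i> * of_real t * of_real (jump_mean J j k) + of_real (t\<^sup>2 / 2) * of_real (jump_square J j k)"
    unfolding jump_char_def Q_prob_def jump_mean_def jump_square_def case_prod_unfold
    by (intro has_bochner_integral_integral_eq has_bochner_integral_add has_bochner_integral_diff
          has_bochner_integral_mult_right has_bochner_integral_of_real has_bochner_integral_integrable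
          int0 int1 int2 intc)
  finally show ?thesis by simp
qed (simp add: jump_char_0)

text \<open>
  The second-order Taylor remainder of \<open>cis (t y)\<close> divided by \<open>t\<^sup>2\<close> is dominated by \<open>y\<^sup>2\<close> and, for fixed \<open>y\<close>, of
  order \<open>t\<close>.
\<close>

lemma jump_remainder_tendsto: "((\<lambda>t. jump_remainder J t j k) \<longlongrightarrow> 0) (at 0)"
  unfolding tendsto_at_iff_sequentially
proof (intro allI impI)
  fix X :: "nat \<Rightarrow> real" assume X: "\<forall>i. X i \<in> UNIV - {0}" "X \<longlonglongrightarrow> 0"
  let ?f = "\<lambda>t w. (cis (t * of_int (fst w)) - 1 - \<i> * of_real (t * of_int (fst w)) + of_real ((t * of_int (fst w))\<^sup>2 / 2)) / of_real (t\<^sup>2) * of_bool (snd w = k)"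
  have b: "norm (?f t w) \<le> (real_of_int (fst w))\<^sup>2" "norm (?f t w) \<le> \<bar>t\<bar> * (\<bar>real_of_int (fst w)\<bar> ^ 3 / 6)" if "t \<noteq> 0" for t and w :: "int \<times> 'e"
  proof -
    let ?c = "norm (cis (t * of_int (fst w)) - 1 - \<i> * of_real (t * of_int (fst w)) + of_real ((t * of_int (fst w))\<^sup>2 / 2))"
    have le: "norm (?f t w) \<le> ?c / t\<^sup>2" by (simp add: norm_mult norm_divide norm_power)
    have "?c / t\<^sup>2 \<le> (t * of_int (fst w))\<^sup>2 / t\<^sup>2" by (intro divide_right_mono cis_taylor_bounds) simp
    also have "\<dots> = (real_of_int (fst w))\<^sup>2" using that by (simp add: power_mult_distrib)
    finally show "norm (?f t w) \<le> (real_of_int (fst w))\<^sup>2" using le by linarith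
    have "?c / t\<^sup>2 \<le> (\<bar>t * of_int (fst w)\<bar> ^ 3 / 6) / t\<^sup>2" by (intro divide_right_mono cis_taylor_bounds) simp
    also have "\<dots> = \<bar>t\<bar> * (\<bar>real_of_int (fst w)\<bar> ^ 3 / 6)"
    proof -
      have "\<bar>t\<bar> ^ 3 = \<bar>t\<bar> * t\<^sup>2" by (simp add: power3_eq_cube power2_eq_square)
      then show ?thesis using that by (simp add: power_mult_distrib abs_mult)
    qed
    finally show "norm (?f t w) \<le> \<bar>t\<bar> * (\<bar>real_of_int (fst w)\<bar> ^ 3 / 6)" using le by linarith
  qed
  have "(\<lambda>n. expect (J j) (?f (X n))) \<longlonglongrightarrow> expect (J j) (\<lambda>w. 0)"
  proof (rule integral_dominated_convergence[where w = "\<lambda>w. (real_of_int (fst w))\<^sup>2"])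
    show "AE w in J j. (\<lambda>n. ?f (X n) w) \<longlonglongrightarrow> 0"
    proof (rule AE_I2)
      fix w :: "int \<times> 'e"
      have "(\<lambda>n. \<bar>X n\<bar> * (\<bar>real_of_int (fst w)\<bar> ^ 3 / 6)) \<longlonglongrightarrow> 0"
        using tendsto_mult_left_zero[OF tendsto_rabs_zero[OF X(2)]] .
      then show "(\<lambda>n. ?f (X n) w) \<longlonglongrightarrow> 0"
        by (rule Lim_null_comparison[rotated]) (use b(2) X(1) in \<open>auto intro!: always_eventually\<close>)
    qed
    show "AE w in J j. norm (?f (X n) w) \<le> (real_of_int (fst w))\<^sup>2" for n
      using b(1)[of "X n"] X(1) by (intro AE_I2) auto
  qed (use second_moment in auto)
  then show "((\<lambda>t. jump_remainder J t j k) \<circ> X) \<longlonglongrightarrow> 0"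
    by (simp add: jump_remainder_def o_def case_prod_unfold)
qed

text \<open>
  The mixed term of the variance can be computed with the left or with the right potential of the drift, since
  \<open>\<nu> M 1 = \<nu> (Q - 1) v = - \<mu> M v\<close>.
\<close>

lemma variance_left:
  assumes nu: "\<And>k. \<nu> k - (\<Sum>j\<in>UNIV. \<nu> j * Q_prob J j k) = (\<Sum>j\<in>UNIV. \<mu> j * jump_mean J j k)"
  shows "\<sigma> = (\<Sum>k\<in>UNIV. \<Sum>j\<in>UNIV. \<mu> j * jump_square J j k + 2 * \<nu> j * jump_mean J j k)"
proof -
  have "(\<Sum>j\<in>UNIV. \<Sum>k\<in>UNIV. \<nu> j * jump_mean J j k) = (\<Sum>j\<in>UNIV. \<nu> j * ((\<Sum>k\<in>UNIV. Q_prob J j k * v k) - v j))"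
    by (simp add: v sum_distrib_left)
  also have "\<dots> = (\<Sum>j\<in>UNIV. \<Sum>k\<in>UNIV. \<nu> j * Q_prob J j k * v k) - (\<Sum>k\<in>UNIV. \<nu> k * v k)"
    by (simp add: right_diff_distrib sum_subtractf sum_distrib_left mult_ac)
  also have "(\<Sum>j\<in>UNIV. \<Sum>k\<in>UNIV. \<nu> j * Q_prob J j k * v k) = (\<Sum>k\<in>UNIV. (\<Sum>j\<in>UNIV. \<nu> j * Q_prob J j k) * v k)"
    by (subst sum.swap) (simp add: sum_distrib_right)
  also have "\<dots> - (\<Sum>k\<in>UNIV. \<nu> k * v k) = - (\<Sum>k\<in>UNIV. (\<nu> k - (\<Sum>j\<in>UNIV. \<nu> j * Q_prob J j k)) * v k)"
    by (simp add: algebra_simps sum_subtractf)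
  also have "\<dots> = - (\<Sum>j\<in>UNIV. \<Sum>k\<in>UNIV. \<mu> j * jump_mean J j k * v k)"
    unfolding nu by (subst sum.swap) (simp add: sum_distrib_right)
  finally have "(\<Sum>k\<in>UNIV. \<Sum>j\<in>UNIV. \<nu> j * jump_mean J j k) = - (\<Sum>j\<in>UNIV. \<Sum>k\<in>UNIV. \<mu> j * jump_mean J j k * v k)"
    by (subst sum.swap)
  moreover have "(\<Sum>k\<in>UNIV. \<Sum>j\<in>UNIV. \<mu> j * jump_square J j k + 2 * \<nu> j * jump_mean J j k)
    = (\<Sum>k\<in>UNIV. \<Sum>j\<in>UNIV. \<mu> j * jump_square J j k) + 2 * (\<Sum>k\<in>UNIV. \<Sum>j\<in>UNIV. \<nu> j * jump_mean J j k)"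
    by (simp add: sum.distrib sum_distrib_left mult_ac)
  ultimately show ?thesis unfolding variance by (subst sum.swap) simp
qed

text \<open>
  Let \<open>norm (f j)\<close> be maximal.  If \<open>z < 1\<close> the equation makes it smaller than itself unless \<open>f = 0\<close>.  If \<open>z = 1\<close>,
  iteration writes \<open>f j\<close> as the mean of \<open>e\<^sup>i\<^sup>t\<^sup>y f k\<close> over the walk after \<open>n\<close> steps.  A mean of complex numbers
  of norm at most \<open>norm (f j)\<close> can only equal \<open>f j\<close> if all of them do, and on the loops, where \<open>k = j\<close>, this
  says \<open>e\<^sup>i\<^sup>t\<^sup>y = 1\<close>.
\<close>

lemma no_unimodular_eigenvalue:
  assumes t: "t \<noteq> 0" "\<bar>t\<bar> \<le> pi" and z: "0 \<le> z" "z \<le> 1"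
    and f: "\<And>j. f j = of_real z * (\<Sum>k\<in>UNIV. jump_char J t j k * f k)"
  shows "f = (\<lambda>_. 0)"
proof (rule ccontr)
  assume "f \<noteq> (\<lambda>_. 0)"
  then obtain i where i: "f i \<noteq> 0" by auto
  define m where "m = Max (range (\<lambda>j. norm (f j)))"
  have le: "norm (f j) \<le> m" for j by (simp add: m_def)
  then have m: "m > 0" using i by (meson less_le_trans zero_less_norm_iff)
  have "m \<in> range (\<lambda>j. norm (f j))" unfolding m_def by (rule Max_in) auto
  then obtain j where j: "norm (f j) = m" by auto
  have z1: "z = 1"
  proof -
    have "norm (\<Sum>k\<in>UNIV. jump_char J t j k * f k) \<le> (\<Sum>k\<in>UNIV. norm (jump_char J t j k)) * m"
      by (rule norm_sum_mult_le) (rule le)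
    also have "\<dots> \<le> 1 * m"
      using m norm_jump_char_le[of J t j] by (intro mult_right_mono) (auto simp: Q_prob_sum [of J j, symmetric] intro: sum_mono)
    finally have "z * norm (\<Sum>k\<in>UNIV. jump_char J t j k * f k) \<le> z * m" using z by (intro mult_left_mono) auto
    moreover have "m = z * norm (\<Sum>k\<in>UNIV. jump_char J t j k * f k)"
      using arg_cong[OF f[of j], of norm] j z by (simp add: norm_mult)
    ultimately have "m \<le> z * m" by simp
    then show "z = 1" using m z by simp
  qed
  have walk_f: "(\<Sum>k\<in>UNIV. walk_char J t n j k * f k) = f j" for n j
  proof (induction n arbitrary: j)
    case 0
    show ?case by (simp add: sum_of_bool)
  next
    case (Suc n)
    have "(\<Sum>k\<in>UNIV. walk_char J t (Suc n) j k * f k) = (\<Sum>i\<in>UNIV. jump_char J t j i * (\<Sum>k\<in>UNIV. walk_char J t n i k * f k))"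
      by (simp add: walk_char_Suc sum_distrib_left sum_distrib_right mult.assoc) (rule sum.swap)
    then show ?case using f[of j] z1 by (simp add: Suc)
  qed
  have "cis (t * of_int y) = 1" if y: "(y, j) \<in> set_pmf (walk J n (0, j))" for n y
  proof -
    define g where "g = (\<lambda>w::int \<times> 'e. cis (t * of_int (fst w)) * f (snd w))"
    have ng: "norm (g w) \<le> m" for w by (simp add: g_def norm_mult le)
    have intg: "integrable (measure_pmf (walk J n (0, j))) g" by (rule integrable_bounded_pmf[OF ng])
    have "expect (walk J n (0, j)) g = (\<Sum>k\<in>UNIV. walk_char J t n j k * f k)"
      using expectation_split_state[of "\<lambda>y k. cis (t * of_int y) * f k" m "walk J n (0, j)"] le
      by (simp add: g_def walk_char_def case_prod_unfold norm_mult mult_ac flip: integral_mult_right_zero)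
    then have Eg: "expect (walk J n (0, j)) g = f j" by (simp add: walk_f)
    \<comment> \<open>The nonnegative function \<open>h\<close> has mean \<open>0\<close>, so it vanishes on the support.\<close>
    define h where "h = (\<lambda>w. m\<^sup>2 - Re (cnj (f j) * g w))"
    have h0: "h w \<ge> 0" for w
    proof -
      have "Re (cnj (f j) * g w) \<le> norm (cnj (f j) * g w)" by (rule complex_Re_le_cmod)
      also have "\<dots> \<le> m * m" unfolding norm_mult using ng[of w] j m by (intro mult_mono) auto
      finally show ?thesis by (simp add: h_def power2_eq_square)
    qed
    have inth: "integrable (measure_pmf (walk J n (0, j))) h"
      unfolding h_def by (intro Bochner_Integration.integrable_diff integrable_Re integrable_mult_right intg) simp
    have "expect (walk J n (0, j)) h = m\<^sup>2 - Re (cnj (f j) * f j)"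
      unfolding h_def using intg by (subst Bochner_Integration.integral_diff) (auto simp: integral_Re Eg)
    also have "\<dots> = 0" using j by (simp add: complex_norm_square [symmetric] mult.commute flip: of_real_power)
    finally have "AE w in walk J n (0, j). h w = 0"
      using integral_nonneg_eq_0_iff_AE[OF inth] h0 by auto
    then have "h (y, j) = 0" using y by (simp add: AE_measure_pmf_iff)
    moreover have "Re (cnj (f j) * g (y, j)) = m\<^sup>2 * cos (t * of_int y)"
    proof -
      have "cnj (f j) * g (y, j) = of_real (m\<^sup>2) * cis (t * of_int y)"
        using complex_norm_square[of "f j"] j by (simp add: g_def mult_ac)
      then show ?thesis by simp
    qed
    ultimately have "m\<^sup>2 = m\<^sup>2 * cos (t * of_int y)" by (simp only: h_def right_minus_eq)
    then have "cos (t * of_int y) = 1" using m by simp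
    then show ?thesis using sin_cos_squared_add[of "t * of_int y"] by (intro complex_eqI) auto
  qed
  then have "cis t = 1" by (rule arith)
  from arg_cong[OF this, of Re] have "cos t = 1" by (simp only: cis.sel one_complex.sel)
  then have "cos \<bar>t\<bar> = cos 0" by simp
  from cos_inj_pi[OF _ _ _ _ this] have "\<bar>t\<bar> = 0" using t by simp
  then show False using t by simp
qed

lemma green_char_near:
  assumes "\<epsilon> > 0"
  shows "\<exists>\<delta>>0. \<forall>t z. t \<noteq> 0 \<longrightarrow> \<bar>t\<bar> < \<delta> \<longrightarrow> 1 - \<delta> < z \<longrightarrow> 0 < z \<longrightarrow> z < 1 \<longrightarrow>
     norm (green_char J z t j k - of_real (\<mu> k / (1 - z + \<sigma> * t\<^sup>2 / 2))) \<le> \<epsilon> / (1 - z + \<sigma> * t\<^sup>2 / 2)"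
proof -
  obtain R where R: "fundamental_inverse R" using fundamental_inverse_exists by blast
  define \<nu> where "\<nu> k = (\<Sum>i\<in>UNIV. (\<Sum>j\<in>UNIV. \<mu> j * jump_mean J j i) * R i k)" for k
  have "(\<Sum>i\<in>UNIV. \<Sum>j\<in>UNIV. \<mu> j * jump_mean J j i) = 0"
    using zero_mean by (subst sum.swap)
  from left_potential[OF R this]
  have nu: "\<nu> k - (\<Sum>j\<in>UNIV. \<nu> j * Q_prob J j k) = (\<Sum>j\<in>UNIV. \<mu> j * jump_mean J j k)" for k
    unfolding \<nu>_def .
  interpret resolvent_expansion "Q_prob J" "jump_mean J" "jump_square J" R \<mu> \<nu> "jump_char J" "jump_remainder J" \<sigma>
  proof
    show "\<bar>Q_prob J j k\<bar> \<le> 1" "\<bar>\<mu> j\<bar> \<le> 1" for j k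
      using Q_prob_nonneg[of J j k] Q_prob_le_1[of J j k] mu_nonneg[of j] mu_le_1[of j] by auto
  qed (rule mu_Q fundamental_inverse_apply[OF R] nu jump_char_expansion jump_remainder_tendsto variance_left[OF nu] sigma_pos)+
  from resolvent_near_origin[OF assms, of k, unfolded eventually_prod_filter prod.case]
  obtain P1 P2 where P1: "eventually P1 (at 0)" and P2: "eventually P2 (at_left (1::real))"
    and P: "\<And>t z. P1 t \<Longrightarrow> P2 z \<Longrightarrow> \<forall>u. resolvent_solution (jump_char J) t z k u
     \<longrightarrow> (\<forall>j. norm (of_real (1 - z + \<sigma> * t\<^sup>2 / 2) * u j - of_real (\<mu> k)) \<le> \<epsilon>)"
    by blast
  obtain d1 where d1: "d1 > 0" "\<And>t. t \<noteq> 0 \<Longrightarrow> \<bar>t\<bar> < d1 \<Longrightarrow> P1 t"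
    using P1 by (auto simp: eventually_at dist_real_def)
  obtain d2 where d2: "d2 < 1" "\<And>z. d2 < z \<Longrightarrow> z < 1 \<Longrightarrow> P2 z"
    using P2 by (auto simp: eventually_at_left[of 0 "1::real"])
  show ?thesis
  proof (intro exI[of _ "min d1 (1 - d2)"] conjI allI impI)
    fix t z :: real
    assume t: "t \<noteq> 0" "\<bar>t\<bar> < min d1 (1 - d2)" and z: "1 - min d1 (1 - d2) < z" "0 < z" "z < 1"
    have D: "1 - z + \<sigma> * t\<^sup>2 / 2 > 0" using z sigma_pos by (intro add_pos_nonneg) auto
    let ?D = "1 - z + \<sigma> * t\<^sup>2 / 2"
    have "P1 t" "P2 z" using d1 d2 t z by auto
    have sol: "\<forall>j. green_char J z t j k = of_bool (j = k) + of_real z * (\<Sum>i\<in>UNIV. jump_char J t j i * green_char J z t i k)"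
      using z by (intro allI green_char_eq) auto
    have "norm (of_real ?D * green_char J z t j k - of_real (\<mu> k)) \<le> \<epsilon>"
      by (rule P[OF \<open>P1 t\<close> \<open>P2 z\<close>, THEN spec[of _ "\<lambda>j. green_char J z t j k"], THEN mp, THEN spec, OF sol])
    then have "norm (of_real ?D * green_char J z t j k - of_real (\<mu> k)) / ?D \<le> \<epsilon> / ?D"
      using D by (intro divide_right_mono) auto
    also have "norm (of_real ?D * green_char J z t j k - of_real (\<mu> k)) / ?D
       = norm ((of_real ?D * green_char J z t j k - of_real (\<mu> k)) / of_real ?D)"
      unfolding norm_divide norm_of_real using D by simp
    also have "(of_real ?D * green_char J z t j k - of_real (\<mu> k)) / of_real ?D
       = green_char J z t j k - of_real (\<mu> k / ?D)"
    proof -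
      have "complex_of_real ?D \<noteq> 0" using D by (simp only: of_real_eq_0_iff)
      from nonzero_mult_div_cancel_left[OF this] show ?thesis by (simp only: diff_divide_distrib of_real_divide)
    qed
    finally show "norm (green_char J z t j k - of_real (\<mu> k / ?D)) \<le> \<epsilon> / ?D" .
  qed (use d1 d2 in auto)
qed

lemma green_char_far:
  assumes "\<delta> > 0"
  shows "\<exists>C. \<forall>t z. \<delta> \<le> \<bar>t\<bar> \<longrightarrow> \<bar>t\<bar> \<le> pi \<longrightarrow> 0 < z \<longrightarrow> z < 1 \<longrightarrow> norm (green_char J z t j k) \<le> C"
proof -
  let ?T = "{- pi..- \<delta>} \<union> {\<delta>..pi}"
  have "\<exists>C. \<forall>t\<in>?T. \<forall>z\<in>{0..1}. \<forall>u. resolvent_solution (jump_char J) t z k u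
     \<longrightarrow> (\<forall>j. norm (u j) \<le> C)"
  proof (rule resolvent_bounded)
    show "compact ?T" by (intro compact_Un compact_Icc)
    show "continuous_on UNIV (\<lambda>t. jump_char J t j k)" for j k by (rule continuous_jump_char)
    show "f = (\<lambda>_. 0)" if "t \<in> ?T" "0 \<le> z" "z \<le> 1" "\<And>j. f j = of_real z * (\<Sum>k\<in>UNIV. jump_char J t j k * f k)" for t z f
      using that(1) assms by (intro no_unimodular_eigenvalue[OF _ _ that(2-4)]) auto
  qed
  then obtain C where C: "\<And>t z u j. t \<in> ?T \<Longrightarrow> z \<in> {0..1} \<Longrightarrow> (\<And>j. u j = of_bool (j = k) + of_real z * (\<Sum>i\<in>UNIV. jump_char J t j i * u i))
     \<Longrightarrow> norm (u j) \<le> C" by blast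
  show ?thesis
  proof (intro exI[of _ C] allI impI)
    fix t z :: real assume "\<delta> \<le> \<bar>t\<bar>" "\<bar>t\<bar> \<le> pi" and z: "0 < z" "z < 1"
    then have "t \<in> ?T" "z \<in> {0..1}" by auto
    from C[OF this, of "\<lambda>j. green_char J z t j k"] show "norm (green_char J z t j k) \<le> C"
      using green_char_eq[of z J t _ k] z by (metis less_imp_le)
  qed
qed

text \<open>
  The Lorentz kernel \<open>1 / (1 - z + \<sigma> t\<^sup>2 / 2)\<close> has an integral of order \<open>(1 - z)\<^sup>-\<^sup>1\<^sup>/\<^sup>2\<close>.  The error of the
  approximation is an arbitrarily small multiple of the kernel near \<open>0\<close> and bounded elsewhere, hence
  negligible after multiplication by \<open>\<surd>(1 - z)\<close>.
\<close>

lemma green_asymptotics: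
  "((\<lambda>z. sqrt (1 - z) * green J z j k) \<longlongrightarrow> \<mu> k / sqrt (2 * \<sigma>)) (at_left 1)"
proof -
  define I where "I = (\<lambda>z. (LINT t|circle. 1 / (1 - z + \<sigma> * t\<^sup>2 / 2)))"
  have I_lim: "((\<lambda>z. sqrt (1 - z) * I z) \<longlongrightarrow> 2 * pi / sqrt (2 * \<sigma>)) (at_left 1)"
    unfolding I_def by (rule lorentz_integral_limit[OF sigma_pos])
  have h_lim: "((\<lambda>z::real. sqrt (1 - z)) \<longlongrightarrow> 0) (at_left 1)"
    by (rule tendsto_eq_intros refl | simp)+
  let ?err = "\<lambda>z. 2 * pi * (sqrt (1 - z) * green J z j k) - \<mu> k * (sqrt (1 - z) * I z)"
  have err: "(?err \<longlongrightarrow> 0) (at_left 1)"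
  proof (rule tendstoI)
    fix e :: real assume e: "e > 0"
    define L where "L = 2 * pi / sqrt (2 * \<sigma>)"
    have L: "L > 0" using sigma_pos by (simp add: L_def)
    define \<epsilon> where "\<epsilon> = e / (2 * (L + 1))"
    have \<epsilon>: "\<epsilon> > 0" "\<epsilon> * (L + 1) = e / 2" using e L by (auto simp: \<epsilon>_def field_simps)
    obtain \<delta> where \<delta>: "\<delta> > 0" and near: "\<And>t z. t \<noteq> 0 \<Longrightarrow> \<bar>t\<bar> < \<delta> \<Longrightarrow> 1 - \<delta> < z \<Longrightarrow> 0 < z \<Longrightarrow> z < 1 \<Longrightarrow>
        norm (green_char J z t j k - of_real (\<mu> k / (1 - z + \<sigma> * t\<^sup>2 / 2))) \<le> \<epsilon> / (1 - z + \<sigma> * t\<^sup>2 / 2)"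
      using green_char_near[OF \<epsilon>(1)] by metis
    obtain C where far: "\<And>t z. \<delta> \<le> \<bar>t\<bar> \<Longrightarrow> \<bar>t\<bar> \<le> pi \<Longrightarrow> 0 < z \<Longrightarrow> z < 1 \<Longrightarrow> norm (green_char J z t j k) \<le> C"
      using green_char_far[OF \<delta>] by metis
    define C' where "C' = \<bar>C\<bar> + 2 / (\<sigma> * \<delta>\<^sup>2)"
    have C': "C' \<ge> 0" using sigma_pos by (simp add: C'_def)
    have bound: "\<bar>2 * pi * green J z j k - \<mu> k * I z\<bar> \<le> \<epsilon> * I z + C' * (2 * pi)"
      if z: "1 - \<delta> < z" "0 < z" "z < 1" for z
    proof -
      interpret C: finite_measure circle by (rule finite_measure_circle)
      let ?D = "\<lambda>t. 1 - z + \<sigma> * t\<^sup>2 / 2"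
      have D: "?D t > 0" for t using z sigma_pos by (intro add_pos_nonneg) auto
      have h: "1 - z > 0" using z by simp
      note li = lorentz_integral(1)[OF sigma_pos h]
      have intg: "integrable circle (\<lambda>t. green_char J z t j k)" using z by (intro green_fourier(2)) auto
      have li': "integrable circle (\<lambda>t. complex_of_real (\<mu> k / ?D t))"
        using integrable_mult_right[OF li, of "\<mu> k"] by (intro integrable_of_real) simp
      have "complex_of_real (2 * pi * green J z j k - \<mu> k * I z) =
         (LINT t|circle. green_char J z t j k - of_real (\<mu> k / ?D t))"
      proof -
        have "(LINT t|circle. \<mu> k / ?D t) = \<mu> k * I z"
          unfolding I_def using integral_mult_right_zero[of circle "\<mu> k" "\<lambda>t. 1 / ?D t"] by simp
        then have "(LINT t|circle. complex_of_real (\<mu> k / ?D t)) = of_real (\<mu> k * I z)"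
          by (simp only: integral_complex_of_real)
        then show ?thesis
          using z by (subst Bochner_Integration.integral_diff[OF intg li'])  (simp add: green_fourier(1))
      qed
      then have "\<bar>2 * pi * green J z j k - \<mu> k * I z\<bar> = norm ((LINT t|circle. green_char J z t j k - of_real (\<mu> k / ?D t)))"
        by (metis norm_of_real)
      also have "\<dots> \<le> (LINT t|circle. norm (green_char J z t j k - of_real (\<mu> k / ?D t)))"
        by (rule integral_norm_bound)
      also have "\<dots> \<le> (LINT t|circle. \<epsilon> * (1 / ?D t) + C')"
      proof (rule integral_mono_AE)
        show "integrable circle (\<lambda>t. norm (green_char J z t j k - of_real (\<mu> k / ?D t)))"
          by (intro integrable_norm Bochner_Integration.integrable_diff intg li')
        show "integrable circle (\<lambda>t. \<epsilon> * (1 / ?D t) + C')"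
          by (intro Bochner_Integration.integrable_add integrable_mult_right li) simp
        have "AE t in lborel. t \<noteq> (0::real)" by (rule AE_lborel_singleton)
        then have "AE t in circle. t \<noteq> 0"
          unfolding circle_def by (subst AE_restrict_space_iff) auto
        moreover have "AE t in circle. t \<in> {-pi..pi}"
          using AE_space[of circle] by (simp add: space_circle)
        ultimately show "AE t in circle. norm (green_char J z t j k - of_real (\<mu> k / ?D t)) \<le> \<epsilon> * (1 / ?D t) + C'"
        proof eventually_elim
          case (elim t)
          have e0: "\<epsilon> * (1 / ?D t) \<ge> 0" using \<epsilon>(1) D[of t] by (intro mult_nonneg_nonneg divide_nonneg_pos) auto
          show ?case
          proof (cases "\<bar>t\<bar> < \<delta>")
            case True
            then show ?thesis using near[OF elim(1) True z] C' by simp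
          next
            case False
            then have "\<delta>\<^sup>2 \<le> t\<^sup>2" using \<delta> by (metis abs_le_square_iff abs_of_pos not_less)
            then have "\<sigma> * \<delta>\<^sup>2 \<le> \<sigma> * t\<^sup>2" using sigma_pos by (intro mult_left_mono) auto
            then have "\<sigma> * \<delta>\<^sup>2 / 2 \<le> ?D t" using h by linarith
            then have "\<mu> k / ?D t \<le> 1 / (\<sigma> * \<delta>\<^sup>2 / 2)"
              using mu_le_1[of k] mu_nonneg[of k] sigma_pos \<delta> by (intro frac_le) auto
            moreover have "\<mu> k / ?D t \<ge> 0" using D[of t] mu_nonneg[of k] by (intro divide_nonneg_pos)
            ultimately have "norm (complex_of_real (\<mu> k / ?D t)) \<le> 2 / (\<sigma> * \<delta>\<^sup>2)"
              by (simp only: norm_of_real abs_of_nonneg) simp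
            moreover have "norm (green_char J z t j k) \<le> \<bar>C\<bar>" using far[of t z] False elim(2) z by force
            ultimately have "norm (green_char J z t j k - of_real (\<mu> k / ?D t)) \<le> C'"
              unfolding C'_def by (intro order_trans[OF norm_triangle_ineq4] add_mono)
            with e0 show ?thesis by linarith
          qed
        qed
      qed
      also have "\<dots> = \<epsilon> * I z + C' * (2 * pi)"
      proof -
        have "(LINT t|circle. \<epsilon> * (1 / ?D t) + C') = (LINT t|circle. \<epsilon> * (1 / ?D t)) + (LINT t|circle. C')"
          by (rule Bochner_Integration.integral_add[OF integrable_mult_right[OF li]]) simp
        then show ?thesis unfolding I_def integral_mult_right_zero using measure_circle by (simp add: mult.commute)
      qed
      finally show ?thesis .
    qed
    have "eventually (\<lambda>z. sqrt (1 - z) * I z < L + 1) (at_left 1)"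
      using I_lim by (rule order_tendstoD) (simp add: L_def)
    moreover have "((\<lambda>z. C' * (2 * pi) * sqrt (1 - z)) \<longlongrightarrow> C' * (2 * pi) * 0) (at_left 1)"
      by (intro tendsto_mult tendsto_const h_lim)
    then have "eventually (\<lambda>z. C' * (2 * pi) * sqrt (1 - z) < e / 2) (at_left 1)"
      by (rule order_tendstoD) (use e in simp)
    moreover have "eventually (\<lambda>z. 1 - \<delta> < z) (at_left (1::real))"
      by (rule eventually_at_leftI[of "1 - \<delta>"]) (use \<delta> in auto)
    ultimately show "eventually (\<lambda>z. dist (?err z) 0 < e) (at_left 1)"
      using eventually_unit_interval
    proof eventually_elim
      case (elim z)
      have "dist (?err z) 0 = sqrt (1 - z) * \<bar>2 * pi * green J z j k - \<mu> k * I z\<bar>"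
      proof -
        have "?err z = sqrt (1 - z) * (2 * pi * green J z j k - \<mu> k * I z)"
          by (simp only: right_diff_distrib mult_ac)
        then show ?thesis using elim(4) by (simp only: dist_real_def diff_0_right abs_mult) simp
      qed
      also have "\<dots> \<le> sqrt (1 - z) * (\<epsilon> * I z + C' * (2 * pi))"
        using elim by (intro mult_left_mono bound) auto
      also have "\<dots> = \<epsilon> * (sqrt (1 - z) * I z) + C' * (2 * pi) * sqrt (1 - z)" by (simp add: algebra_simps)
      also have "\<dots> < e / 2 + e / 2"
        using elim(1,2) \<epsilon> mult_left_mono[of "sqrt (1 - z) * I z" "L + 1" \<epsilon>] by (intro add_le_less_mono) auto
      finally show ?case by simp
    qed
  qed
  have "((\<lambda>z. (?err z + \<mu> k * (sqrt (1 - z) * I z)) / (2 * pi)) \<longlongrightarrow> (0 + \<mu> k * (2 * pi / sqrt (2 * \<sigma>))) / (2 * pi)) (at_left 1)"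
    by (intro tendsto_intros err I_lim) simp
  then show ?thesis by simp
qed

section \<open>From the Green function to the mean range\<close>

definition no_return_gf :: "real \<Rightarrow> 'e \<Rightarrow> real" where
  "no_return_gf z j = (\<Sum>n. no_return J n j * z ^ n)"

definition mean_range_gf :: "real \<Rightarrow> 'e \<Rightarrow> real" where
  "mean_range_gf z j = (\<Sum>n. mean_range J n j * z ^ n)"

lemma summable_bounded_power:
  fixes c :: "nat \<Rightarrow> real"
  assumes "\<And>n. \<bar>c n\<bar> \<le> 1" "0 < z" "z < 1"
  shows "summable (\<lambda>n. \<bar>c n * z ^ n\<bar>)"
proof (rule summable_comparison_test')
  show "summable (\<lambda>n. z ^ n)" using assms by (intro summable_geometric) auto
  show "norm \<bar>c n * z ^ n\<bar> \<le> z ^ n" for n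
    using assms mult_right_mono[OF assms(1)[of n], of "z ^ n"] by (simp add: abs_mult)
qed

lemma summable_no_return: "0 < z \<Longrightarrow> z < 1 \<Longrightarrow> summable (\<lambda>n. \<bar>no_return J n j * z ^ n\<bar>)"
  using no_return_bounds[of J _ j] by (intro summable_bounded_power) auto

lemma summable_mean_range:
  assumes "0 < z" "z < 1"
  shows "summable (\<lambda>n. mean_range J n j * z ^ n)"
proof (rule summable_comparison_test')
  have "summable (\<lambda>n. diffs (\<lambda>_. 1) n * z ^ n)"
    using assms by (intro termdiff_converges[where K = 1] summable_geometric) (auto intro: summable_geometric)
  then show "summable (\<lambda>n. real (Suc n) * z ^ n)" by (simp add: diffs_def)
  show "norm (mean_range J n j * z ^ n) \<le> real (Suc n) * z ^ n" for n
    using assms mean_range_bounds[of J n j] by (simp add: abs_mult mult_right_mono del: of_nat_Suc)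
qed

lemma renewal_gf:
  assumes z: "0 < z" "z < 1"
  shows "(\<Sum>i\<in>UNIV. green J z j i * no_return_gf z i) = 1 / (1 - z)"
proof -
  let ?a = "\<lambda>i n. pmf (walk J n (0, j)) (0, i) * z ^ n"
  let ?b = "\<lambda>i n. no_return J n i * z ^ n"
  have sa: "summable (\<lambda>n. norm (?a i n))" for i
    using summable_bounded_power[of "\<lambda>n. pmf (walk J n (0, j)) (0, i)", OF _ z] by (simp add: pmf_le_1)
  have sb: "summable (\<lambda>n. norm (?b i n))" for i
    using summable_no_return[OF z] by simp
  have "(\<Sum>i\<in>UNIV. green J z j i * no_return_gf z i) = (\<Sum>i\<in>UNIV. \<Sum>n. \<Sum>k\<le>n. ?a i k * ?b i (n - k))"
    unfolding green_def no_return_gf_def by (intro sum.cong refl Cauchy_product sa sb)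
  also have "\<dots> = (\<Sum>n. \<Sum>i\<in>UNIV. \<Sum>k\<le>n. ?a i k * ?b i (n - k))"
    by (intro suminf_sum [symmetric] summable_Cauchy_product sa sb)
  also have "\<dots> = (\<Sum>n. z ^ n)"
  proof (rule suminf_cong)
    fix n
    have "(\<Sum>i\<in>UNIV. \<Sum>k\<le>n. ?a i k * ?b i (n - k)) = (\<Sum>i\<in>UNIV. \<Sum>k\<le>n. (pmf (walk J k (0, j)) (0, i) * no_return J (n - k) i) * z ^ n)"
    proof (intro sum.cong refl)
      fix i k assume "k \<in> {..n}"
      then have "z ^ n = z ^ k * z ^ (n - k)" by (simp add: power_add [symmetric])
      then show "?a i k * ?b i (n - k) = (pmf (walk J k (0, j)) (0, i) * no_return J (n - k) i) * z ^ n" by simp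
    qed
    also have "\<dots> = (\<Sum>k\<le>n. \<Sum>i\<in>UNIV. pmf (walk J k (0, j)) (0, i) * no_return J (n - k) i) * z ^ n"
      by (subst sum.swap) (simp add: sum_distrib_right)
    finally show "(\<Sum>i\<in>UNIV. \<Sum>k\<le>n. ?a i k * ?b i (n - k)) = z ^ n"
      by (simp add: last_visit_decomposition)
  qed
  also have "\<dots> = 1 / (1 - z)" using z by (intro suminf_geometric) auto
  finally show ?thesis .
qed

lemma no_return_gf_nonneg: "0 < z \<Longrightarrow> z < 1 \<Longrightarrow> no_return_gf z j \<ge> 0"
  unfolding no_return_gf_def
  by (intro suminf_nonneg summable_rabs_cancel[OF summable_no_return] mult_nonneg_nonneg) (auto simp: no_return_bounds)

lemma mean_range_gf_nonneg: "0 < z \<Longrightarrow> z < 1 \<Longrightarrow> mean_range_gf z j \<ge> 0"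
  unfolding mean_range_gf_def
  by (intro suminf_nonneg summable_mean_range mult_nonneg_nonneg) (auto simp: mean_range_bounds)

lemma mean_range_gf_eq:
  assumes z: "0 < z" "z < 1"
  shows "mean_range_gf z j = no_return_gf z j + z * (\<Sum>k\<in>UNIV. Q_prob J j k * mean_range_gf z k)"
proof -
  have sn: "summable (\<lambda>n. no_return J n j * z ^ n)" using summable_no_return[OF z] by (rule summable_rabs_cancel)
  have sn': "summable (\<lambda>n. no_return J (Suc n) j * z ^ Suc n)" using sn by (subst summable_Suc_iff)
  have sr: "summable (\<lambda>n. z * (Q_prob J j k * (mean_range J n k * z ^ n)))" for k
    by (intro summable_mult summable_mean_range z)
  have "mean_range_gf z j = 1 + (\<Sum>n. mean_range J (Suc n) j * z ^ Suc n)"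
    unfolding mean_range_gf_def using suminf_split_head[OF summable_mean_range[OF z, of j]] by simp
  also have "(\<Sum>n. mean_range J (Suc n) j * z ^ Suc n) =
      (\<Sum>n. no_return J (Suc n) j * z ^ Suc n + (\<Sum>k\<in>UNIV. z * (Q_prob J j k * (mean_range J n k * z ^ n))))"
    by (simp add: mean_range_Suc algebra_simps sum_distrib_left)
  also have "\<dots> = (\<Sum>n. no_return J (Suc n) j * z ^ Suc n) + (\<Sum>k\<in>UNIV. \<Sum>n. z * (Q_prob J j k * (mean_range J n k * z ^ n)))"
    by (subst suminf_add [symmetric]) (auto intro!: summable_sum sr sn' simp: suminf_sum[OF sr] simp del: power_Suc)
  also have "(\<Sum>k\<in>UNIV. \<Sum>n. z * (Q_prob J j k * (mean_range J n k * z ^ n))) = z * (\<Sum>k\<in>UNIV. Q_prob J j k * mean_range_gf z k)"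
    unfolding mean_range_gf_def
    by (simp add: suminf_mult summable_mult summable_mean_range z sum_distrib_left)
  also have "(\<Sum>n. no_return J (Suc n) j * z ^ Suc n) = no_return_gf z j - 1"
    unfolding no_return_gf_def using suminf_split_head[OF sn] by simp
  finally show ?thesis by simp
qed

text \<open>
  The matrix of leading coefficients of the Green function has rank one, so with several states it
  cannot be inverted.
  Nonnegativity replaces inversion: each product \<open>A z i * X z i\<close> is at most \<open>1\<close>, which keeps \<open>X\<close> bounded, and
  then \<open>A\<close> may be replaced by its limit.
\<close>

lemma tendsto_mu_sum:
  fixes X :: "real \<Rightarrow> 'e \<Rightarrow> real"
  assumes nonneg: "eventually (\<lambda>z. \<forall>j. 0 \<le> X z j) F"
    and A: "\<And>i. ((\<lambda>z. A z i) \<longlongrightarrow> a * \<mu> i) F" and a: "a > 0"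
    and one: "eventually (\<lambda>z. (\<Sum>i\<in>UNIV. A z i * X z i) = 1) F"
  shows "((\<lambda>z. \<Sum>i\<in>UNIV. \<mu> i * X z i) \<longlongrightarrow> 1 / a) F"
    and "\<And>i. Bfun (\<lambda>z. X z i) F"
proof -
  have pos: "a * \<mu> i > 0" for i using a mu_pos[of i] by simp
  have low: "eventually (\<lambda>z. \<forall>i. A z i > a * \<mu> i / 2) F"
    by (rule eventually_all_finite, rule order_tendstoD[OF A]) (use pos in simp)
  show bdd: "Bfun (\<lambda>z. X z i) F" for i
  proof (rule BfunI)
    show "eventually (\<lambda>z. norm (X z i) \<le> 2 / (a * \<mu> i)) F"
      using low nonneg one
    proof eventually_elim
      case (elim z)
      have "a * \<mu> i / 2 * X z i \<le> A z i * X z i" using elim by (intro mult_right_mono) (auto intro: less_imp_le)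
      also have "\<dots> \<le> (\<Sum>i\<in>UNIV. A z i * X z i)"
      proof (rule member_le_sum)
        show "0 \<le> A z k * X z k" for k using elim(1)[rule_format, of k] elim(2) pos[of k] by (intro mult_nonneg_nonneg) auto
      qed auto
      also have "\<dots> = 1" by (rule elim)
      finally show ?case using pos[of i] elim by (simp add: field_simps)
    qed
  qed
  have "((\<lambda>z. \<Sum>i\<in>UNIV. (A z i - a * \<mu> i) * X z i) \<longlongrightarrow> 0) F"
  proof (rule tendsto_null_sum)
    fix i
    have "Zfun (\<lambda>z. A z i - a * \<mu> i) F" using A[of i] by (simp add: tendsto_Zfun_iff)
    then show "((\<lambda>z. (A z i - a * \<mu> i) * X z i) \<longlongrightarrow> 0) F"
      using bounded_bilinear.Zfun_prod_Bfun[OF bounded_bilinear_mult _ bdd[of i]] by (simp add: tendsto_Zfun_iff)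
  qed
  then have "((\<lambda>z. (1 - (\<Sum>i\<in>UNIV. (A z i - a * \<mu> i) * X z i)) / a) \<longlongrightarrow> (1 - 0) / a) F"
    using a by (intro tendsto_intros) auto
  then have "((\<lambda>z. (1 - (\<Sum>i\<in>UNIV. (A z i - a * \<mu> i) * X z i)) / a) \<longlongrightarrow> 1 / a) F" by simp
  then show "((\<lambda>z. \<Sum>i\<in>UNIV. \<mu> i * X z i) \<longlongrightarrow> 1 / a) F"
  proof (rule Lim_transform_eventually)
    show "\<forall>\<^sub>F z in F. (1 - (\<Sum>i\<in>UNIV. (A z i - a * \<mu> i) * X z i)) / a = (\<Sum>i\<in>UNIV. \<mu> i * X z i)"
      using one
    proof eventually_elim
      case (elim z)
      have "(\<Sum>i\<in>UNIV. (A z i - a * \<mu> i) * X z i) = 1 - a * (\<Sum>i\<in>UNIV. \<mu> i * X z i)"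
        using elim by (simp add: left_diff_distrib sum_subtractf sum_distrib_left mult.assoc)
      then show ?case using a by simp
    qed
  qed
qed

lemma no_return_gf_asymptotics:
  shows "((\<lambda>z. \<Sum>i\<in>UNIV. \<mu> i * (sqrt (1 - z) * no_return_gf z i)) \<longlongrightarrow> sqrt (2 * \<sigma>)) (at_left 1)"
    and "Bfun (\<lambda>z. sqrt (1 - z) * no_return_gf z i) (at_left 1)"
proof -
  fix j :: 'e
  have 1: "eventually (\<lambda>z. \<forall>i. 0 \<le> sqrt (1 - z) * no_return_gf z i) (at_left 1)"
    using eventually_unit_interval by eventually_elim (auto simp: no_return_gf_nonneg)
  have 2: "((\<lambda>z. sqrt (1 - z) * green J z j i) \<longlongrightarrow> 1 / sqrt (2 * \<sigma>) * \<mu> i) (at_left 1)" for i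
    using green_asymptotics[of j i] by simp
  have 3: "eventually (\<lambda>z. (\<Sum>i\<in>UNIV. (sqrt (1 - z) * green J z j i) * (sqrt (1 - z) * no_return_gf z i)) = 1) (at_left 1)"
    using eventually_unit_interval
  proof eventually_elim
    case (elim z)
    have "(\<Sum>i\<in>UNIV. (sqrt (1 - z) * green J z j i) * (sqrt (1 - z) * no_return_gf z i))
       = (sqrt (1 - z) * sqrt (1 - z)) * (\<Sum>i\<in>UNIV. green J z j i * no_return_gf z i)"
      by (simp only: sum_distrib_left mult_ac)
    then show ?case using elim by (simp add: renewal_gf)
  qed
  have 4: "1 / sqrt (2 * \<sigma>) > 0" using sigma_pos by simp
  show "((\<lambda>z. \<Sum>i\<in>UNIV. \<mu> i * (sqrt (1 - z) * no_return_gf z i)) \<longlongrightarrow> sqrt (2 * \<sigma>)) (at_left 1)"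
    using tendsto_mu_sum(1)[OF 1 2 4 3] by simp
  show "Bfun (\<lambda>z. sqrt (1 - z) * no_return_gf z i) (at_left 1)"
    by (rule tendsto_mu_sum(2)[OF 1 2 4 3])
qed

text \<open>
  For \<open>W = (1 - z)\<^sup>3\<^sup>/\<^sup>2 r(z)\<close> the first-step relation gives \<open>\<mu> \<cdot> W = \<mu> \<cdot> X\<close>, where \<open>X = \<surd>(1 - z) q(z)\<close>.  It also
  gives \<open>W - Q W = (1 - z) (X - Q W)\<close>, which tends to \<open>0\<close>, so all components of \<open>W\<close> have the same limit.
\<close>

lemma mean_range_gf_asymptotics:
  "((\<lambda>z. sqrt (1 - z) * ((1 - z) * mean_range_gf z j)) \<longlongrightarrow> sqrt (2 * \<sigma>)) (at_left 1)"
proof -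
  define W where "W z i = sqrt (1 - z) * ((1 - z) * mean_range_gf z i)" for z i
  define X where "X z i = sqrt (1 - z) * no_return_gf z i" for z i
  obtain R where R: "fundamental_inverse R" using fundamental_inverse_exists by blast
  have Rr: "f j - (\<Sum>l\<in>UNIV. \<mu> l * f l) = (\<Sum>k\<in>UNIV. R j k * (f k - (\<Sum>l\<in>UNIV. Q_prob J k l * f l)))" for f :: "'e \<Rightarrow> real" and j
  proof -
    have "complex_of_real (f j - (\<Sum>l\<in>UNIV. \<mu> l * f l)) = of_real (\<Sum>k\<in>UNIV. R j k * (f k - (\<Sum>l\<in>UNIV. Q_prob J k l * f l)))"
      using fundamental_inverse_apply[OF R, of "\<lambda>j. of_real (f j)" j] by simp
    then show ?thesis by (simp only: of_real_eq_iff)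
  qed
  have W_eq: "W z i = (1 - z) * X z i + z * (\<Sum>k\<in>UNIV. Q_prob J i k * W z k)" if "0 < z" "z < 1" for z i
    unfolding W_def X_def by (subst mean_range_gf_eq[OF that]) (simp add: algebra_simps sum_distrib_left)
  have mu_W: "(\<Sum>i\<in>UNIV. \<mu> i * W z i) = (\<Sum>i\<in>UNIV. \<mu> i * X z i)" if z: "0 < z" "z < 1" for z
  proof -
    have "(\<Sum>i\<in>UNIV. \<mu> i * W z i) = (1 - z) * (\<Sum>i\<in>UNIV. \<mu> i * X z i) + z * (\<Sum>i\<in>UNIV. \<mu> i * (\<Sum>k\<in>UNIV. Q_prob J i k * W z k))"
      by (subst W_eq[OF z]) (simp add: algebra_simps sum.distrib sum_subtractf sum_distrib_left)
    also have "(\<Sum>i\<in>UNIV. \<mu> i * (\<Sum>k\<in>UNIV. Q_prob J i k * W z k)) = (\<Sum>k\<in>UNIV. (\<Sum>i\<in>UNIV. \<mu> i * Q_prob J i k) * W z k)"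
      by (simp add: sum_distrib_left sum_distrib_right mult_ac) (rule sum.swap)
    finally have "(1 - z) * (\<Sum>i\<in>UNIV. \<mu> i * W z i) = (1 - z) * (\<Sum>i\<in>UNIV. \<mu> i * X z i)"
      by (simp add: mu_Q algebra_simps)
    then show ?thesis using z by simp
  qed
  have mu_W_lim: "((\<lambda>z. \<Sum>i\<in>UNIV. \<mu> i * W z i) \<longlongrightarrow> sqrt (2 * \<sigma>)) (at_left 1)"
    using no_return_gf_asymptotics(1)
  proof (rule Lim_transform_eventually)
    show "\<forall>\<^sub>F z in at_left 1. (\<Sum>i\<in>UNIV. \<mu> i * (sqrt (1 - z) * no_return_gf z i)) = (\<Sum>i\<in>UNIV. \<mu> i * W z i)"
      using eventually_unit_interval by eventually_elim (simp add: mu_W X_def)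
  qed
  have W_bdd: "Bfun (\<lambda>z. W z i) (at_left 1)" for i
  proof (rule BfunI)
    show "\<forall>\<^sub>F z in at_left 1. norm (W z i) \<le> (sqrt (2 * \<sigma>) + 1) / \<mu> i"
      using eventually_unit_interval order_tendstoD(2)[OF mu_W_lim less_add_one]
    proof eventually_elim
      case (elim z)
      have W0: "W z k \<ge> 0" for k unfolding W_def using elim by (auto simp: mean_range_gf_nonneg)
      have "\<mu> i * W z i \<le> (\<Sum>i\<in>UNIV. \<mu> i * W z i)"
        by (rule member_le_sum) (auto intro: mult_nonneg_nonneg mu_nonneg W0)
      then show ?case using elim W0[of i] mu_pos[of i] by (simp add: field_simps)
    qed
  qed
  have z0: "Zfun (\<lambda>z::real. 1 - z) (at_left 1)"
  proof -
    have "((\<lambda>z::real. 1 - z) \<longlongrightarrow> 1 - 1) (at_left 1)" by (intro tendsto_intros)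
    then show ?thesis by (simp add: tendsto_Zfun_iff)
  qed
  have small: "((\<lambda>z. (1 - z) * Y z) \<longlongrightarrow> 0) (at_left 1)" if "Bfun Y (at_left 1)" for Y :: "real \<Rightarrow> real"
    using bounded_bilinear.Zfun_prod_Bfun[OF bounded_bilinear_mult z0 that] by (simp add: tendsto_Zfun_iff)
  let ?dev = "\<lambda>z. \<Sum>k\<in>UNIV. R j k * ((1 - z) * X z k - (\<Sum>l\<in>UNIV. Q_prob J k l * ((1 - z) * W z l)))"
  have "((\<lambda>z. ?dev z) \<longlongrightarrow>
     (\<Sum>k\<in>UNIV. R j k * (0 - (\<Sum>l\<in>UNIV. Q_prob J k l * 0)))) (at_left 1)"
    by (intro tendsto_intros small W_bdd) (simp add: X_def no_return_gf_asymptotics(2))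
  then have diff: "((\<lambda>z. ?dev z) \<longlongrightarrow> 0) (at_left 1)"
    by simp
  from tendsto_add[OF diff mu_W_lim]
  have "((\<lambda>z. ?dev z + (\<Sum>i\<in>UNIV. \<mu> i * W z i)) \<longlongrightarrow> sqrt (2 * \<sigma>)) (at_left 1)"
    by simp
  then show ?thesis
  proof (rule Lim_transform_eventually)
    show "\<forall>\<^sub>F z in at_left 1. ?dev z + (\<Sum>i\<in>UNIV. \<mu> i * W z i)
       = sqrt (1 - z) * ((1 - z) * mean_range_gf z j)"
      using eventually_unit_interval
    proof eventually_elim
      case (elim z)
      have "W z k - (\<Sum>l\<in>UNIV. Q_prob J k l * W z l) = (1 - z) * X z k - (\<Sum>l\<in>UNIV. Q_prob J k l * ((1 - z) * W z l))" for k
        using W_eq[of z k] elim by (simp add: algebra_simps sum_subtractf sum_distrib_left)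
      then show ?case using Rr[of "W z" j] by (simp add: W_def)
    qed
  qed
qed

text \<open>
  The increments \<open>b\<close> of the mean range are nonnegative and have the generating function
  \<open>(1 - z) r(z)\<close>.  Working with them instead of the mean range itself makes the mean range a
  partial sum, which is what the Tauberian theorem describes.
\<close>

theorem mean_range_asymptotics:
  "(\<lambda>n. mean_range J n j / sqrt (real n)) \<longlonglongrightarrow> sqrt (8 * \<sigma> / pi)"
proof -
  define b where "b n = (case n of 0 \<Rightarrow> 1 | Suc m \<Rightarrow> mean_range J (Suc m) j - mean_range J m j)" for n
  have b_sum: "(\<Sum>k\<le>n. b k) = mean_range J n j" for n
    by (induction n) (simp_all add: b_def)
  have b_sums: "(\<lambda>n. b n * z ^ n) sums ((1 - z) * mean_range_gf z j)" if z: "0 < z" "z < 1" for z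
  proof -
    have s: "(\<lambda>n. mean_range J n j * z ^ n) sums mean_range_gf z j"
      unfolding mean_range_gf_def by (rule summable_sums[OF summable_mean_range[OF z]])
    have "(\<lambda>n. mean_range J (Suc n) j * z ^ Suc n) sums (mean_range_gf z j - 1)"
      using s by (subst sums_Suc_iff) simp
    from sums_diff[OF this sums_mult[OF s, of z]]
    have "(\<lambda>n. b (Suc n) * z ^ Suc n) sums (mean_range_gf z j - 1 - z * mean_range_gf z j)"
      by (simp add: b_def algebra_simps)
    then show ?thesis by (subst (asm) sums_Suc_iff) (simp add: b_def algebra_simps)
  qed
  interpret abelian_half_limit b "sqrt (2 * \<sigma>)"
  proof
    show "b n \<ge> 0" for n by (cases n) (simp_all add: b_def mean_range_mono)
    show "summable (\<lambda>n. b n * z ^ n)" if "0 < z" "z < 1" for z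
      using b_sums[OF that] by (rule sums_summable)
    show "((\<lambda>z. sqrt (1 - z) * (\<Sum>n. b n * z ^ n)) \<longlongrightarrow> sqrt (2 * \<sigma>)) (at_left 1)"
      using mean_range_gf_asymptotics[of j]
    proof (rule Lim_transform_eventually)
      show "\<forall>\<^sub>F z in at_left 1. sqrt (1 - z) * ((1 - z) * mean_range_gf z j) = sqrt (1 - z) * (\<Sum>n. b n * z ^ n)"
        using eventually_unit_interval
      proof eventually_elim
        case (elim z)
        then show ?case using sums_unique[OF b_sums[of z]] by simp
      qed
    qed
  qed
  have "sqrt (2 * \<sigma>) * (2 / sqrt pi) = sqrt (8 * \<sigma> / pi)"
  proof (rule real_sqrt_unique [symmetric])
    show "(sqrt (2 * \<sigma>) * (2 / sqrt pi))\<^sup>2 = 8 * \<sigma> / pi" using sigma_pos by (simp add: power_mult_distrib power_divide)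
  qed (use sigma_pos in simp)
  then show ?thesis using karamata_half by (simp add: b_sum)
qed

end

section \<open>The kernel of the walk and its discrete distributions\<close>

lemma abs_summable_on_real_iff:
  fixes f :: "'a \<Rightarrow> real"
  shows "Infinite_Set_Sum.abs_summable_on f A \<longleftrightarrow> f summable_on A"
  using trans[OF summable_on_iff_abs_summable_on_real[of f A] abs_summable_equivalent[of f A]] by (rule sym)

lemma integrable_pmf_iff_summable:
  fixes g :: "'a \<Rightarrow> real"
  shows "integrable (measure_pmf P) g \<longleftrightarrow> (\<lambda>x. pmf P x * g x) summable_on UNIV"
proof -
  have "integrable (measure_pmf P) g \<longleftrightarrow> integrable (count_space UNIV) (\<lambda>x. pmf P x * g x)"
    unfolding measure_pmf_eq_density by (subst integrable_density) auto
  also have "\<dots> \<longleftrightarrow> (\<lambda>x. pmf P x * g x) summable_on UNIV"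
    by (simp only: Infinite_Set_Sum.abs_summable_on_def [symmetric] abs_summable_on_real_iff)
  finally show ?thesis .
qed

lemma has_sum_expectation_pmf:
  fixes g :: "'a \<Rightarrow> real"
  assumes "integrable (measure_pmf P) g"
  shows "((\<lambda>x. pmf P x * g x) has_sum expect P g) UNIV"
proof -
  have s: "(\<lambda>x. pmf P x * g x) summable_on UNIV" using assms by (simp add: integrable_pmf_iff_summable)
  then have "Infinite_Set_Sum.abs_summable_on (\<lambda>x. pmf P x * g x) UNIV"
    by (rule abs_summable_on_real_iff[THEN iffD2])
  then have "expect P g = infsum (\<lambda>x. pmf P x * g x) UNIV"
    by (simp add: pmf_expectation_eq_infsetsum infsetsum_infsum)
  then show ?thesis using s by (simp add: has_sum_infsum)
qed

lemma has_sum_fibre: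
  fixes f :: "'a \<times> 'e \<Rightarrow> real"
  shows "((\<lambda>w. f w * of_bool (snd w = k)) has_sum S) UNIV \<longleftrightarrow> ((\<lambda>y. f (y, k)) has_sum S) UNIV"
proof -
  have "((\<lambda>w. f w * of_bool (snd w = k)) has_sum S) UNIV \<longleftrightarrow> (f has_sum S) ((\<lambda>y. (y, k)) ` UNIV)"
    by (rule has_sum_cong_neutral) auto
  also have "\<dots> \<longleftrightarrow> ((\<lambda>y. f (y, k)) has_sum S) UNIV"
    by (subst has_sum_reindex) (auto simp: inj_on_def o_def)
  finally show ?thesis .
qed

lemma has_sum_matrix:
  fixes f :: "'i \<Rightarrow> real^'n^'m"
  assumes "\<And>j k. ((\<lambda>i. f i $ j $ k) has_sum S $ j $ k) A"
  shows "(f has_sum S) A"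
  unfolding has_sum_def
proof (intro vec_tendstoI)
  fix j k
  show "((\<lambda>F. sum f F $ j $ k) \<longlongrightarrow> S $ j $ k) (finite_subsets_at_top A)"
    using assms[of j k] by (simp add: has_sum_def)
qed

lemma Collect_hist_eq:
  assumes "length l = Suc n"
  shows "{\<omega>\<in>S. \<forall>i\<le>n. X i \<omega> = l ! i} = {\<omega>\<in>S. map (\<lambda>i. X i \<omega>) [0..<Suc n] = l}"
  using assms by (auto simp: list_eq_iff_nth_eq less_Suc_eq_le simp del: upt_Suc)

lemma group_closure_subgroup:
  assumes "x \<in> group_closure S" "0 \<in> H" "S \<subseteq> H" "\<And>a b. a \<in> H \<Longrightarrow> b \<in> H \<Longrightarrow> a - b \<in> H"
  shows "x \<in> H"
  using assms(1) by induction (use assms in auto)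

locale rwis =
  fixes p :: "int \<Rightarrow> 'e::finite \<Rightarrow> 'e \<Rightarrow> real"
  assumes p_nonneg: "\<And>y j k. p y j k \<ge> 0"
    and p_sum: "\<And>j. ((\<lambda>(y, k). p y j k) has_sum 1) UNIV"
begin

definition jump :: "'e jumps" where
  "jump j = embed_pmf (\<lambda>(y, k). p y j k)"

lemma pmf_jump: "pmf (jump j) (y, k) = p y j k"
proof -
  let ?f = "\<lambda>(y, k). p y j k"
  have "?f summable_on UNIV" using p_sum by (rule has_sum_imp_summable)
  then have "Infinite_Set_Sum.abs_summable_on ?f UNIV"
    by (rule abs_summable_on_real_iff[THEN iffD2])
  then have "(\<integral>\<^sup>+ w. ?f w \<partial>count_space UNIV) = ennreal (infsum ?f UNIV)"
    by (subst nn_integral_conv_infsetsum) (auto simp: p_nonneg infsetsum_infsum)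
  also have "infsum ?f UNIV = 1" using p_sum by (rule infsumI)
  finally have "pmf (embed_pmf ?f) (y, k) = ?f (y, k)"
    by (intro pmf_embed_pmf) (auto simp: p_nonneg)
  then show ?thesis by (simp add: jump_def)
qed

lemma pmf_step: "pmf (step jump s) t = rwis_kernel p s t"
proof -
  obtain x j x' k where st: "s = (x, j)" "t = (x', k)" by (cases s, cases t)
  have "inj (\<lambda>(y, k). (x + y, k :: 'e))" by (auto simp: inj_def)
  from pmf_map_inj'[OF this, of "jump j" "(x' - x, k)"]
  show ?thesis by (simp add: step_def st rwis_kernel_def pmf_jump)
qed

lemma transition_prob_rwis: "transition_prob (rwis_kernel p) n s t = pmf (walk jump n s) t"
proof (induction n arbitrary: s)
  case 0
  show ?case by (simp add: pmf_return indicator_def)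
next
  case (Suc n)
  have "integrable (measure_pmf (step jump s)) (\<lambda>u. pmf (walk jump n u) t)"
    by (rule integrable_bounded_pmf[where B = 1]) (simp add: pmf_le_1)
  from infsumI[OF has_sum_expectation_pmf[OF this]]
  show ?case by (simp add: Suc pmf_bind pmf_step)
qed

lemma jump_expectation_has_sum:
  assumes "integrable (jump j) (\<lambda>w. g (fst w) * of_bool (snd w = k))"
  shows "((\<lambda>y. g y * p y j k) has_sum expect (jump j) (\<lambda>(y, l). g y * of_bool (l = k))) UNIV"
proof -
  from has_sum_expectation_pmf[OF assms]
  have "((\<lambda>w. (pmf (jump j) w * g (fst w)) * of_bool (snd w = k)) has_sum expect (jump j) (\<lambda>w. g (fst w) * of_bool (snd w = k))) UNIV"
    by (simp only: mult.assoc)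
  then show ?thesis
    unfolding has_sum_fibre by (simp add: pmf_jump case_prod_unfold mult.commute)
qed

lemma Q_matrix_eq: "Q_matrix p $ j $ k = Q_prob jump j k"
proof -
  have "(jump_matrix p has_sum (\<chi> j k. Q_prob jump j k)) UNIV"
  proof (rule has_sum_matrix)
    fix j k
    have "integrable (jump j) (\<lambda>w. 1 * of_bool (snd w = k) :: real)"
      by (rule integrable_bounded_pmf[where B = 1]) auto
    from jump_expectation_has_sum[of j "\<lambda>_. 1", OF this]
    show "((\<lambda>y. jump_matrix p y $ j $ k) has_sum (\<chi> j k. Q_prob jump j k) $ j $ k) UNIV"
      by (simp add: jump_matrix_def Q_prob_def)
  qed
  then show ?thesis unfolding Q_matrix_def by (simp add: infsumI)
qed

context
  assumes second_moments: "(\<lambda>y. (of_int y)\<^sup>2 *\<^sub>R jump_matrix p y) summable_on UNIV"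
begin

lemma jump_second_moment: "integrable (jump j) (\<lambda>w. (real_of_int (fst w))\<^sup>2)"
proof -
  have "integrable (jump j) (\<lambda>w. (real_of_int (fst w))\<^sup>2 * of_bool (snd w = k))" for k
  proof -
    have "bounded_linear (\<lambda>A :: real^'e^'e. A $ j $ k)"
      by (intro bounded_linear_vec_nth bounded_linear_compose[OF bounded_linear_vec_nth])
    from summable_on_bounded_linear[OF this second_moments]
    have "(\<lambda>y. (real_of_int y)\<^sup>2 * p y j k) summable_on UNIV" by (simp add: jump_matrix_def)
    then obtain S where "((\<lambda>y. (real_of_int y)\<^sup>2 * p y j k) has_sum S) UNIV" by (auto simp: summable_on_def)
    then have "((\<lambda>w. (pmf (jump j) w * (real_of_int (fst w))\<^sup>2) * of_bool (snd w = k)) has_sum S) UNIV"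
      unfolding has_sum_fibre by (simp add: pmf_jump mult.commute)
    then show ?thesis
      unfolding integrable_pmf_iff_summable mult.assoc [symmetric] by (rule has_sum_imp_summable)
  qed
  then have "integrable (jump j) (\<lambda>w. \<Sum>k\<in>UNIV. (real_of_int (fst w))\<^sup>2 * of_bool (snd w = k))"
    by (intro Bochner_Integration.integrable_sum)
  then show ?thesis by (simp add: of_bool_def if_distrib cong: if_cong)
qed

lemma Sigma_matrix_eq: "Sigma_matrix p $ j $ k = jump_square jump j k"
proof -
  have "((\<lambda>y. (of_int y)\<^sup>2 *\<^sub>R jump_matrix p y) has_sum (\<chi> j k. jump_square jump j k)) UNIV"
  proof (rule has_sum_matrix)
    fix j k
    have "integrable (jump j) (\<lambda>w. (real_of_int (fst w))\<^sup>2 * of_bool (snd w = k))"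
      by (rule Bochner_Integration.integrable_bound[OF jump_second_moment[of j]]) auto
    from jump_expectation_has_sum[of j "\<lambda>y. (real_of_int y)\<^sup>2", OF this]
    show "((\<lambda>y. ((of_int y)\<^sup>2 *\<^sub>R jump_matrix p y) $ j $ k) has_sum (\<chi> j k. jump_square jump j k) $ j $ k) UNIV"
      by (simp add: jump_matrix_def jump_square_def)
  qed
  then show ?thesis unfolding Sigma_matrix_def by (simp add: infsumI)
qed

lemma M_matrix_eq: "M_matrix p $ j $ k = jump_mean jump j k"
proof -
  have "((\<lambda>y. of_int y *\<^sub>R jump_matrix p y) has_sum (\<chi> j k. jump_mean jump j k)) UNIV"
  proof (rule has_sum_matrix)
    fix j k
    have "integrable (jump j) (\<lambda>w. real_of_int (fst w) * of_bool (snd w = k))"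
      by (rule Bochner_Integration.integrable_bound[OF integrable_of_int_if_square[OF jump_second_moment[of j]]]) auto
    from jump_expectation_has_sum[of j real_of_int, OF this]
    show "((\<lambda>y. (of_int y *\<^sub>R jump_matrix p y) $ j $ k) has_sum (\<chi> j k. jump_mean jump j k) $ j $ k) UNIV"
      by (simp add: jump_matrix_def jump_mean_def)
  qed
  then show ?thesis unfolding M_matrix_def by (simp add: infsumI)
qed

end

text \<open>
  A set of states that the matrix \<open>Q\<close> does not leave is not left by its powers either.
\<close>

lemma closed_set_UNIV:
  assumes irred: "irreducible_kernel (\<lambda>j k. Q_matrix p $ j $ k)"
    and A: "A \<noteq> {}" and closed: "\<And>j k. j \<in> A \<Longrightarrow> Q_prob jump j k > 0 \<Longrightarrow> k \<in> A"
  shows "A = UNIV"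
proof -
  have reach: "k \<in> A" if "transition_prob (\<lambda>j k. Q_matrix p $ j $ k) n j k > 0" "j \<in> A" for n j k
    using that
  proof (induction n arbitrary: j)
    case 0
    then show ?case by (simp split: if_splits)
  next
    case (Suc n)
    have "\<exists>u. Q_prob jump j u * transition_prob (\<lambda>j k. Q_matrix p $ j $ k) n u k > 0"
    proof (rule ccontr)
      assume "\<not> ?thesis"
      then have "(\<Sum>u\<in>UNIV. Q_prob jump j u * transition_prob (\<lambda>j k. Q_matrix p $ j $ k) n u k) \<le> 0"
        by (intro sum_nonpos) (auto simp: not_less)
      then show False using Suc.prems(1) by (simp add: Q_matrix_eq)
    qed
    then obtain u where u: "Q_prob jump j u * transition_prob (\<lambda>j k. Q_matrix p $ j $ k) n u k > 0" by blast
    then have "Q_prob jump j u > 0" "transition_prob (\<lambda>j k. Q_matrix p $ j $ k) n u k > 0"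
      using Q_prob_nonneg[of jump j u] by (auto simp: zero_less_mult_iff)
    then show ?case using Suc.IH closed[OF Suc.prems(2)] by blast
  qed
  obtain j where "j \<in> A" using A by blast
  then show ?thesis using irred reach unfolding irreducible_kernel_def by blast
qed

text \<open>
  The integers \<open>y\<close> with \<open>e\<^sup>i\<^sup>t\<^sup>y = 1\<close> form a subgroup.  It contains the loops, hence their differences and the group
  generated by them.
\<close>

lemma trivial_arithmetic_cis:
  assumes arith: "trivial_arithmetic p"
    and loops: "\<And>n y. (y, j) \<in> set_pmf (walk jump n (0, j)) \<Longrightarrow> cis (t * of_int y) = 1"
  shows "cis t = 1"
proof -
  let ?S = "{y - y' | y y'. \<exists>n\<ge>1. transition_prob (rwis_kernel p) n (0, j) (y, j) > 0 \<and>
                              transition_prob (rwis_kernel p) n (0, j) (y', j) > 0}"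
  let ?H = "{y :: int. cis (t * of_int y) = 1}"
  have diff: "a - b \<in> ?H" if "a \<in> ?H" "b \<in> ?H" for a b
  proof -
    have "cis (t * of_int (a - b)) = cis (t * of_int a) / cis (t * of_int b)"
      by (simp add: cis_divide right_diff_distrib)
    then show ?thesis using that by simp
  qed
  have loop: "y \<in> ?H" if "transition_prob (rwis_kernel p) n (0, j) (y, j) > 0" for n y
    using that loops[of y n] by (simp add: transition_prob_rwis pmf_positive_iff)
  have "1 \<in> group_closure ?S" using arith by (auto simp: trivial_arithmetic_def)
  then have "1 \<in> ?H"
  proof (rule group_closure_subgroup)
    show "?S \<subseteq> ?H" using loop diff by blast
  qed (use diff in auto)
  then show ?thesis by simp
qed

end

section \<open>The path measure of the given Markov chain\<close>

locale rwis_chain = rwis p for p :: "int \<Rightarrow> 'e::finite \<Rightarrow> 'e \<Rightarrow> real" +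
  fixes M :: "'a measure" and \<eta> :: "nat \<Rightarrow> 'a \<Rightarrow> int" and \<epsilon> :: "nat \<Rightarrow> 'a \<Rightarrow> 'e"
  assumes chain: "markov_chain M (rwis_kernel p) (\<lambda>n \<omega>. (\<eta> n \<omega>, \<epsilon> n \<omega>))"
    and start: "AE \<omega> in M. \<eta> 0 \<omega> = 0"
begin

sublocale prob_space M
  using chain by (simp add: markov_chain_def)

definition state :: "nat \<Rightarrow> 'a \<Rightarrow> int \<times> 'e" where
  "state n \<omega> = (\<eta> n \<omega>, \<epsilon> n \<omega>)"

definition hist :: "nat \<Rightarrow> 'a \<Rightarrow> (int \<times> 'e) list" where
  "hist n \<omega> = map (\<lambda>i. state i \<omega>) [0..<Suc n]"

lemma state_measurable [measurable]: "state n \<in> M \<rightarrow>\<^sub>M count_space UNIV"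
  using chain by (simp add: markov_chain_def state_def [abs_def])

lemma length_hist [simp]: "length (hist n \<omega>) = Suc n"
  by (simp add: hist_def)

lemma hist_Suc: "hist (Suc n) \<omega> = hist n \<omega> @ [state (Suc n) \<omega>]"
  by (simp add: hist_def)

lemma hist_event: "{\<omega> \<in> space M. hist n \<omega> = l} \<in> events"
proof (induction n arbitrary: l)
  case 0
  have "{\<omega> \<in> space M. hist 0 \<omega> = l} = (if length l = 1 then {\<omega> \<in> space M. state 0 \<omega> = hd l} else {})"
    by (cases l) (auto simp: hist_def)
  then show ?case by simp
next
  case (Suc n)
  show ?case
  proof (cases l rule: rev_cases)
    case Nil
    then show ?thesis by (simp add: hist_Suc)
  next
    case (snoc l' t)
    have "{\<omega> \<in> space M. hist (Suc n) \<omega> = l} = {\<omega> \<in> space M. hist n \<omega> = l'} \<inter> {\<omega> \<in> space M. state (Suc n) \<omega> = t}"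
      by (auto simp: hist_Suc snoc)
    then show ?thesis using Suc by simp
  qed
qed

lemma hist_measurable [measurable]: "hist n \<in> M \<rightarrow>\<^sub>M count_space UNIV"
proof (rule measurableI)
  fix A :: "(int \<times> 'e) list set"
  have "hist n -` A \<inter> space M = (\<Union>l\<in>A. {\<omega> \<in> space M. hist n \<omega> = l})" by auto
  then show "hist n -` A \<inter> space M \<in> events"
    using hist_event by (auto intro!: sets.countable_UN')
qed simp

abbreviation "hist_is n l \<equiv> {\<omega> \<in> space M. hist n \<omega> = l}"

text \<open>
  The law of the initial internal state; the initial site is \<open>0\<close> almost surely.
\<close>

definition initial :: "'e pmf" where
  "initial = embed_pmf (\<lambda>j. prob {\<omega> \<in> space M. state 0 \<omega> = (0, j)})"

lemma pmf_initial: "pmf initial j = prob {\<omega> \<in> space M. state 0 \<omega> = (0, j)}"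
proof -
  have "(\<Sum>j\<in>UNIV. prob {\<omega> \<in> space M. state 0 \<omega> = (0, j)}) = prob (\<Union>j. {\<omega> \<in> space M. state 0 \<omega> = (0, j)})"
    by (rule finite_measure_finite_Union [symmetric]) (auto simp: disjoint_family_on_def)
  also have "\<dots> = 1"
  proof (rule prob_eq_1[THEN iffD2])
    show "(\<Union>j. {\<omega> \<in> space M. state 0 \<omega> = (0, j)}) \<in> events"
      by (intro sets.finite_UN) auto
    show "AE \<omega> in M. \<omega> \<in> (\<Union>j. {\<omega> \<in> space M. state 0 \<omega> = (0, j)})"
      using start AE_space by eventually_elim (auto simp: state_def)
  qed
  finally show ?thesis
    unfolding initial_def
    by (intro pmf_embed_pmf) (auto simp: nn_integral_count_space_finite sum_ennreal)
qed

lemma prob_hist_Suc: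
  "prob (hist_is (Suc n) (l @ [t])) = prob (hist_is n l) * pmf (step jump (last l)) t"
proof (cases "prob (hist_is n l) > 0")
  case True
  have len: "length l = Suc n"
  proof (rule ccontr)
    assume "length l \<noteq> Suc n"
    then have "hist_is n l = {}" using length_hist by auto
    from True[unfolded this] show False by simp
  qed
  then have last: "last l = l ! n" by (subst last_conv_nth) auto
  have ev: "{\<omega> \<in> space M. \<forall>i\<le>n. state i \<omega> = l ! i} = (hist_is n l)"
    unfolding hist_def by (rule Collect_hist_eq[OF len])
  have "\<P>(\<omega> in M. state (Suc n) \<omega> = t \<bar> \<forall>i\<le>n. state i \<omega> = l ! i) = rwis_kernel p (l ! n) t"
    using chain True unfolding markov_chain_def state_def [symmetric] ev [symmetric] by blast
  then have "prob {\<omega> \<in> space M. state (Suc n) \<omega> = t \<and> (\<forall>i\<le>n. state i \<omega> = l ! i)} = prob (hist_is n l) * rwis_kernel p (l ! n) t"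
    using True unfolding cond_prob_def ev by (simp add: field_simps)
  moreover have "{\<omega> \<in> space M. state (Suc n) \<omega> = t \<and> (\<forall>i\<le>n. state i \<omega> = l ! i)} = (hist_is (Suc n) (l @ [t]))"
    using ev by (auto simp: hist_Suc)
  ultimately show ?thesis by (simp add: pmf_step last)
next
  case False
  then have z: "prob (hist_is n l) = 0" by (simp add: zero_less_measure_iff)
  have "prob (hist_is (Suc n) (l @ [t])) \<le> prob (hist_is n l)"
    by (rule finite_measure_mono) (auto simp: hist_Suc hist_event)
  then show ?thesis using z by (simp add: measure_le_0_iff)
qed

text \<open>
  The Markov property prescribes the law of the chain only through conditional probabilities of
  histories of positive probability.  Histories range over a countable set, so multiplying these
  probabilities determines the law of the whole history.
\<close>

lemma prob_hist:
  "prob (hist_is n l) = pmf (bind_pmf initial (\<lambda>j. traj jump n (0, j))) l"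
proof (induction n arbitrary: l)
  case 0
  have b: "bind_pmf initial (\<lambda>j. traj jump 0 (0, j)) = map_pmf (\<lambda>j. [(0, j)]) initial"
    by (simp add: map_pmf_def)
  show ?case
  proof (cases "\<exists>j. l = [(0, j)]")
    case True
    then obtain j where l: "l = [(0, j)]" by blast
    have "inj (\<lambda>j :: 'e. [(0 :: int, j)])" by (simp add: inj_def)
    from pmf_map_inj'[OF this] show ?thesis
      unfolding b l by (simp add: pmf_initial hist_def)
  next
    case False
    have "prob (hist_is 0 l) = 0"
    proof -
      have "AE \<omega> in M. hist 0 \<omega> \<noteq> l"
        using start by eventually_elim (use False in \<open>auto simp: hist_def state_def\<close>)
      then show ?thesis
        using prob_eq_0[OF hist_event[of 0 l]] by auto
    qed
    moreover have "l \<notin> set_pmf (map_pmf (\<lambda>j. [(0, j)]) initial)" using False by auto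
    ultimately show ?thesis unfolding b by (simp add: pmf_eq_0_set_pmf)
  qed
next
  case (Suc n)
  let ?P = "bind_pmf initial (\<lambda>j. traj jump n (0, j))"
  have b: "bind_pmf initial (\<lambda>j. traj jump (Suc n) (0, j)) = bind_pmf ?P (\<lambda>l. map_pmf (\<lambda>t. l @ [t]) (step jump (last l)))"
    by (simp only: traj_snoc bind_assoc_pmf)
  show ?case
  proof (cases l rule: rev_cases)
    case Nil
    have "[] \<notin> set_pmf (bind_pmf ?P (\<lambda>l. map_pmf (\<lambda>t. l @ [t]) (step jump (last l))))" by auto
    then show ?thesis unfolding b by (simp add: Nil hist_Suc pmf_eq_0_set_pmf)
  next
    case (snoc l' t)
    have "pmf (map_pmf (\<lambda>t. l0 @ [t]) (step jump (last l0))) (l' @ [t]) = indicator {l'} l0 * pmf (step jump (last l')) t" for l0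
    proof (cases "l0 = l'")
      case True
      have "inj (\<lambda>t. l' @ [t])" by (simp add: inj_def)
      from pmf_map_inj'[OF this] show ?thesis by (simp add: True)
    next
      case False
      then have "l' @ [t] \<notin> set_pmf (map_pmf (\<lambda>t. l0 @ [t]) (step jump (last l0)))" by auto
      then show ?thesis using False by (simp add: pmf_eq_0_set_pmf)
    qed
    then have "pmf (bind_pmf ?P (\<lambda>l. map_pmf (\<lambda>t. l @ [t]) (step jump (last l)))) (l' @ [t]) = pmf ?P l' * pmf (step jump (last l')) t"
      by (simp only: pmf_bind[of ?P]) (simp add: measure_pmf_single)
    then show ?thesis unfolding b snoc prob_hist_Suc Suc by simp
  qed
qed

lemma expected_range:
  "integral\<^sup>L M (\<lambda>\<omega>. real (visited_sites \<eta> n \<omega>)) = (\<Sum>j\<in>UNIV. mean_range jump n j * pmf initial j)"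
proof -
  let ?P = "bind_pmf initial (\<lambda>j. traj jump n (0, j))"
  have "distr M (count_space UNIV) (hist n) = measure_pmf ?P"
  proof (rule measure_eqI_countable[where A = UNIV])
    fix l
    have "emeasure (distr M (count_space UNIV) (hist n)) {l} = emeasure M (hist_is n l)"
      by (subst emeasure_distr) (auto intro!: arg_cong[where f = "emeasure M"])
    also have "\<dots> = emeasure (measure_pmf ?P) {l}"
      by (simp add: emeasure_eq_measure prob_hist emeasure_pmf_single)
    finally show "emeasure (distr M (count_space UNIV) (hist n)) {l} = emeasure (measure_pmf ?P) {l}" .
  qed auto
  moreover have "visited_sites \<eta> n \<omega> = card (sites (hist n \<omega>))" for \<omega>
    unfolding visited_sites_def sites_def hist_def
    by (rule arg_cong[where f = card]) (force simp: state_def image_image simp del: upt_Suc)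
  ultimately have "integral\<^sup>L M (\<lambda>\<omega>. real (visited_sites \<eta> n \<omega>)) = expect ?P (\<lambda>l. real (card (sites l)))"
    using integral_distr[of "hist n" M "count_space UNIV" "\<lambda>l. real (card (sites l))"] by simp
  also have "\<dots> = expect initial (mean_range jump n)"
    unfolding mean_range_def [abs_def]
    by (rule expectation_bind_real[where B = "real (Suc n)"]) (auto simp del: of_nat_Suc dest!: card_sites_traj)
  also have "\<dots> = (\<Sum>j\<in>UNIV. mean_range jump n j * pmf initial j)"
    by (rule integral_measure_pmf_real) auto
  finally show ?thesis .
qed

lemma initial_sum: "(\<Sum>j\<in>UNIV. pmf initial j) = 1"
  by (rule sum_pmf_eq_1) auto

end

section \<open>Asymptotics of the mean range\<close>

theorem proposition8:
  fixes p :: "int \<Rightarrow> 'e::finite \<Rightarrow> 'e \<Rightarrow> real"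
    and \<mu> :: "real^'e"
    and M :: "'a measure"
    and \<eta> :: "nat \<Rightarrow> 'a \<Rightarrow> int"
    and \<epsilon> :: "nat \<Rightarrow> 'a \<Rightarrow> 'e"
  assumes p_nonneg: "\<And>y j k. p y j k \<ge> 0"
    and p_sum: "\<And>j. ((\<lambda>(y, k). p y j k) has_sum 1) UNIV"
    and chain: "markov_chain M (rwis_kernel p) (\<lambda>n \<omega>. (\<eta> n \<omega>, \<epsilon> n \<omega>))"
    and start: "AE \<omega> in M. \<eta> 0 \<omega> = 0"
    and irred: "irreducible_kernel (\<lambda>j k. Q_matrix p $ j $ k)"
    and aper: "aperiodic_kernel (\<lambda>j k. Q_matrix p $ j $ k)"
    and stationary: "stationary_distribution (Q_matrix p) \<mu>"
    and arith: "trivial_arithmetic p"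
    and zero_mean: "\<mu> \<bullet> (M_matrix p *v 1) = 0"
    and second_moments: "(\<lambda>y. (of_int y)\<^sup>2 *\<^sub>R jump_matrix p y) summable_on UNIV"
    and nonsingular: "rwis_variance p \<mu> > 0"
  shows "(\<lambda>n. integral\<^sup>L M (\<lambda>\<omega>. real (visited_sites \<eta> n \<omega>)))
           \<sim>[at_top] (\<lambda>n. sqrt (8 * rwis_variance p \<mu> / pi) * sqrt (real n))"
proof -
  interpret rwis_chain p M \<eta> \<epsilon>
    by unfold_locales (fact p_nonneg p_sum chain start)+
  let ?\<mu> = "\<lambda>j. \<mu> $ j"
  interpret irreducible_chain "Q_prob jump" ?\<mu>
  proof
    show "(\<Sum>j\<in>UNIV. \<mu> $ j * Q_prob jump j k) = \<mu> $ k" for k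
    proof -
      have "\<mu> v* Q_matrix p = \<mu>" using stationary by (simp add: stationary_distribution_def)
      from arg_cong[OF this, of "\<lambda>x. x $ k"] show ?thesis
        by (simp add: vector_matrix_mult_def Q_matrix_eq mult.commute)
    qed
  qed (use stationary closed_set_UNIV[OF irred] in \<open>auto simp: stationary_distribution_def Q_prob_nonneg Q_prob_sum\<close>)
  define w where "w = M_matrix p *v 1"
  have w: "w $ j = (\<Sum>k\<in>UNIV. jump_mean jump j k)" for j
    by (simp add: w_def matrix_vector_mult_def M_matrix_eq[OF second_moments])
  have mu_w: "(\<Sum>j\<in>UNIV. \<mu> $ j * w $ j) = 0"
    using zero_mean by (simp add: inner_vec_def w_def)
  define v where "v = Q_minus_1_inverse p \<mu> w"
  have v_iff: "\<mu> \<bullet> x = 0 \<and> Q_matrix p *v x - x = w \<longleftrightarrow>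
      (\<Sum>j\<in>UNIV. \<mu> $ j * x $ j) = 0 \<and> (\<forall>j. (\<Sum>k\<in>UNIV. Q_prob jump j k * x $ k) - x $ j = w $ j)" for x
    by (simp add: inner_vec_def vec_eq_iff matrix_vector_mult_def Q_matrix_eq)
  have "\<mu> \<bullet> v = 0 \<and> Q_matrix p *v v - v = w"
    unfolding v_def Q_minus_1_inverse_def
  proof (rule theI')
    show "\<exists>!v. \<mu> \<bullet> v = 0 \<and> Q_matrix p *v v - v = w"
    proof (rule ex_ex1I)
      obtain f where "(\<Sum>j\<in>UNIV. \<mu> $ j * f j) = 0" "\<forall>j. (\<Sum>k\<in>UNIV. Q_prob jump j k * f k) - f j = w $ j"
        using right_potential_exists[OF mu_w] by blast
      then show "\<exists>v. \<mu> \<bullet> v = 0 \<and> Q_matrix p *v v - v = w"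
        unfolding v_iff by (intro exI[of _ "\<chi> j. f j"]) simp
    next
      fix x y
      assume "\<mu> \<bullet> x = 0 \<and> Q_matrix p *v x - x = w" "\<mu> \<bullet> y = 0 \<and> Q_matrix p *v y - y = w"
      then have "x $ j = y $ j" for j
        unfolding v_iff by (intro right_potential_unique[of "\<lambda>j. x $ j" "\<lambda>j. w $ j" "\<lambda>j. y $ j"]) auto
      then show "x = y" by (simp add: vec_eq_iff)
    qed
  qed
  then have v: "(\<Sum>k\<in>UNIV. Q_prob jump j k * v $ k) - v $ j = (\<Sum>k\<in>UNIV. jump_mean jump j k)" for j
    unfolding v_iff by (simp add: w)
  have variance: "rwis_variance p \<mu> = (\<Sum>j\<in>UNIV. \<Sum>k\<in>UNIV. \<mu> $ j * jump_square jump j k)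
      - 2 * (\<Sum>j\<in>UNIV. \<Sum>k\<in>UNIV. \<mu> $ j * jump_mean jump j k * v $ k)"
    unfolding rwis_variance_def w_def [symmetric] v_def [symmetric]
    by (simp add: inner_vec_def matrix_vector_mult_def M_matrix_eq[OF second_moments] Sigma_matrix_eq[OF second_moments]
        sum_distrib_left mult.assoc sum_negf)
  \<comment> \<open>With \<open>v = (Q - 1)\<^sup>-\<^sup>1 M 1\<close> well defined, the given variance is the one of \<open>recurrent_walk\<close>.\<close>
  interpret recurrent_walk jump ?\<mu> "\<lambda>j. v $ j" "rwis_variance p \<mu>"
  proof
    show "integrable (jump j) (\<lambda>w. (real_of_int (fst w))\<^sup>2)" for j
      by (rule jump_second_moment[OF second_moments])
    show "cis t = 1" if "\<And>n y. (y, j) \<in> set_pmf (walk jump n (0, j)) \<Longrightarrow> cis (t * of_int y) = 1" for j t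
      by (rule trivial_arithmetic_cis[OF arith that])
    show "(\<Sum>j\<in>UNIV. \<Sum>k\<in>UNIV. \<mu> $ j * jump_mean jump j k) = 0"
      using mu_w by (simp add: w sum_distrib_left)
  qed (fact v variance nonsingular)+
  define c where "c = sqrt (8 * rwis_variance p \<mu> / pi)"
  have c: "c > 0" using nonsingular by (simp add: c_def)
  have "(\<lambda>n. \<Sum>j\<in>UNIV. mean_range jump n j / sqrt (real n) * pmf initial j) \<longlonglongrightarrow> (\<Sum>j\<in>UNIV. c * pmf initial j)"
    unfolding c_def by (intro tendsto_sum tendsto_mult tendsto_const mean_range_asymptotics)
  then have "(\<lambda>n. (\<Sum>j\<in>UNIV. mean_range jump n j * pmf initial j) / sqrt (real n)) \<longlonglongrightarrow> c"
    by (simp add: sum_divide_distrib sum_distrib_left [symmetric] initial_sum)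
  then have "(\<lambda>n. (\<Sum>j\<in>UNIV. mean_range jump n j * pmf initial j) / sqrt (real n) / c) \<longlonglongrightarrow> c / c"
    by (rule tendsto_divide) (use c in auto)
  then have lim: "(\<lambda>n. (\<Sum>j\<in>UNIV. mean_range jump n j * pmf initial j) / (c * sqrt (real n))) \<longlonglongrightarrow> 1"
    using c by (simp add: mult.commute)
  show ?thesis
    unfolding expected_range c_def [symmetric]
  proof (rule asymp_equivI'[OF lim])
  qed
qed

end
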